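(* For every tripartite quantum state $\rho_{ABE}$, the intrinsic information is an upper bound on distillable key: $$K_D(\rho_{ABE})\le I(A:B\downarrow E)_\rho .$$
   Context: Hilbert spaces are finite-dimensional and $\log$ is to base 2. $S$ denotes von Neumann entropy, $S(A)_\rho:=S(\rho_A)$, and $I(A:B|E)_\rho:=S(AE)_\rho+S(BE)_\rho-S(ABE)_\rho-S(E)_\rho$. Intrinsic information: $I(A:B\downarrow E)_\rho:=\inf I(A:B|E')_\rho$, where the infimum is over all completely positive trace preserving (CPTP) maps $\Lambda_{E\to E'}$ from $E$ to $E'$ and $\rho_{ABE'}=(I_{AB}\otimes\Lambda_{E\to E'})(\rho_{ABE})$. Key rate. A tripartite state $\rho_{ABE}$ is a density operator on $\mathcal H_A\otimes\mathcal H_B\otimes\mathcal H_E$, held by Alice, Bob and the adversary Eve. Distance: $\|\rho-\sigma\|:=\frac12\mathrm{Tr}|\rho-\sigma|$. LOPC operation: a concatenation of finitely many steps, each being either (i) a local quantum operation of Bob, $\rho_{ABE}\mapsto(I_{AE}\otimes\Lambda_B)(\rho_{ABE})$ with $\Lambda_B$ CPTP, or the analogue for Alice; or (ii) public classical communication from Alice to Bob: a state $\sum_i\rho^i_{ABE}\otimes|i\rangle\langle i|_{A'}$ ($A'$ a classical register of Alice) is transformed into $\sum_i\rho^i_{ABE}\otimes|iii\rangle\langle iii|_{A'B'E'}$, or the analogue from Bob to Alice. LOPC protocol: a family $\mathcal P=\{\Lambda_n\}_{n\in\mathbb N}$ of CPTP maps $\Lambda_n:(\mathcal H_A\otimes\mathcal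 H_B\otimes\mathcal H_E)^{\otimes n}\to\mathcal H_A^n\otimes\mathcal H_B^n\otimes\mathcal H_E^n$, each an LOPC operation. Let $\tau^\ell_{ABE}:=\frac1{2^\ell}\sum_{i=1}^{2^\ell}|ii\rangle\langle ii|_{AB}\otimes\tau_E$ for some arbitrary state $\tau_E$. $\mathcal P$ distills key at rate $R_{\mathcal P}$ from $\rho_{ABE}$ if there is a sequence $\{\ell_n\}$ with $\limsup_{n\to\infty}\ell_n/n=R_{\mathcal P}$ and $\lim_{n\to\infty}\|\Lambda_n(\rho_{ABE}^{\otimes n})-\tau^{\ell_n}_{ABE}\|=0$. The key rate (distillable key) is $K_D(\rho_{ABE}):=\sup_{\mathcal P}R_{\mathcal P}$. *)

theory Defs
  imports
    "Jordan_Normal_Form.Char_Poly"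
    "Jordan_Normal_Form.Schur_Decomposition"
    "HOL-Computational_Algebra.Fundamental_Theorem_Algebra"
    "HOL-Library.Extended_Real"
    "HOL-Library.Liminf_Limsup"
begin

text \<open>
  Operators on a finite-dimensional Hilbert space are complex square matrices with respect to a
  fixed orthonormal basis. A threefold tensor product of spaces of dimensions \<open>(a, b, c)\<close> has its
  product basis numbered lexicographically (the Kronecker convention). The encoding is
  associative: grouping neighbouring factors, or inserting factors of dimension 1, does not
  change the number of a basis vector. So the same functions also serve for bipartite spaces and
  for arbitrary groupings of the factors.
\<close>

type_synonym dims = "nat \<times> nat \<times> nat"

fun dim3 :: "dims \<Rightarrow> nat" where
  "dim3 (a, b, c) = a * b * c"

fun enc :: "dims \<Rightarrow> nat \<times> nat \<times> nat \<Rightarrow> nat" where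
  "enc (a, b, c) (x, y, z) = (x * b + y) * c + z"

fun dec :: "dims \<Rightarrow> nat \<Rightarrow> nat \<times> nat \<times> nat" where
  "dec (a, b, c) i = (i div (b * c), i div c mod b, i mod c)"

definition mat3 ::
  "dims \<Rightarrow> (nat \<times> nat \<times> nat \<Rightarrow> nat \<times> nat \<times> nat \<Rightarrow> complex) \<Rightarrow> complex mat" where
  "mat3 D f = mat (dim3 D) (dim3 D) (\<lambda>(i, j). f (dec D i) (dec D j))"

definition entry3 ::
  "dims \<Rightarrow> complex mat \<Rightarrow> nat \<times> nat \<times> nat \<Rightarrow> nat \<times> nat \<times> nat \<Rightarrow> complex" where
  "entry3 D M s t = M $$ (enc D s, enc D t)"

definition mtrace :: "complex mat \<Rightarrow> complex" where
  "mtrace A = (\<Sum>i<dim_row A. A $$ (i, i))"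

text \<open>The order on \<^typ>\<open>complex\<close> makes \<open>0 \<le> z\<close> say that \<open>z\<close> is real and nonnegative; hence
  positive semidefinite matrices are Hermitian.\<close>

definition psd :: "nat \<Rightarrow> complex mat \<Rightarrow> bool" where
  "psd d A \<longleftrightarrow> A \<in> carrier_mat d d \<and> (\<forall>v\<in>carrier_vec d. 0 \<le> (A *\<^sub>v v) \<bullet>c v)"

definition density :: "nat \<Rightarrow> complex mat \<Rightarrow> bool" where
  "density d \<rho> \<longleftrightarrow> psd d \<rho> \<and> mtrace \<rho> = 1"

text \<open>\<open>Tr f(A)\<close> for Hermitian \<open>A\<close>: the sum of \<open>f\<close> over the (real) eigenvalues, counted with
  multiplicity.\<close>

definition trace_fun :: "(real \<Rightarrow> real) \<Rightarrow> complex mat \<Rightarrow> real" where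
  "trace_fun f A = (\<Sum>x\<in>#proots (char_poly A). f (Re x))"

text \<open>\<open>S(\<rho>) = - Tr \<rho> log \<rho>\<close>; the convention \<open>0 log 0 = 0\<close> holds in HOL.\<close>

definition vN_entropy :: "complex mat \<Rightarrow> real" where
  "vN_entropy \<rho> = - trace_fun (\<lambda>x. x * log 2 x) \<rho>"

text \<open>\<open>Tr |A| = Tr sqrt(A\<^sup>* A)\<close>.\<close>

definition trace_dist :: "complex mat \<Rightarrow> complex mat \<Rightarrow> real" where
  "trace_dist \<rho> \<sigma> = trace_fun sqrt (mat_adjoint (\<rho> - \<sigma>) * (\<rho> - \<sigma>)) / 2"

text \<open>Trace out the middle factor.\<close>

fun ptrace :: "dims \<Rightarrow> complex mat \<Rightarrow> complex mat" where
  "ptrace (p, d, q) M = mat (p * q) (p * q) (\<lambda>(i, j).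
     \<Sum>y<d. entry3 (p, d, q) M (i div q, y, i mod q) (j div q, y, j mod q))"

text \<open>\<open>I(A:B|E) = S(AE) + S(BE) - S(ABE) - S(E)\<close>.\<close>

fun cond_mutual_info :: "dims \<Rightarrow> complex mat \<Rightarrow> real" where
  "cond_mutual_info (a, b, e) \<rho> =
     vN_entropy (ptrace (a, b, e) \<rho>) + vN_entropy (ptrace (1, a, b * e) \<rho>)
     - vN_entropy \<rho> - vN_entropy (ptrace (1, a * b, e) \<rho>)"

text \<open>\<open>extend p q d d' \<Lambda>\<close> is the map \<open>id \<otimes> \<Lambda> \<otimes> id\<close> from dimensions \<open>(p, d, q)\<close> to \<open>(p, d', q)\<close>:
  \<open>\<Lambda>\<close> is applied to each \<open>d \<times> d\<close> block of the matrix at fixed outer indices.\<close>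

definition extend ::
  "nat \<Rightarrow> nat \<Rightarrow> nat \<Rightarrow> nat \<Rightarrow> (complex mat \<Rightarrow> complex mat) \<Rightarrow> complex mat \<Rightarrow> complex mat" where
  "extend p q d d' \<Lambda> M = mat3 (p, d', q) (\<lambda>(x, y, z) (x', y', z').
     \<Lambda> (mat d d (\<lambda>(u, v). entry3 (p, d, q) M (x, u, z) (x', v, z'))) $$ (y, y'))"

definition cptp :: "nat \<Rightarrow> nat \<Rightarrow> (complex mat \<Rightarrow> complex mat) \<Rightarrow> bool" where
  "cptp d d' \<Lambda> \<longleftrightarrow>
     (\<forall>A\<in>carrier_mat d d. \<Lambda> A \<in> carrier_mat d' d') \<and>
     (\<forall>A\<in>carrier_mat d d. \<forall>B\<in>carrier_mat d d. \<Lambda> (A + B) = \<Lambda> A + \<Lambda> B) \<and>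
     (\<forall>c. \<forall>A\<in>carrier_mat d d. \<Lambda> (c \<cdot>\<^sub>m A) = c \<cdot>\<^sub>m \<Lambda> A) \<and>
     (\<forall>A\<in>carrier_mat d d. mtrace (\<Lambda> A) = mtrace A) \<and>
     (\<forall>k M. psd (k * d) M \<longrightarrow> psd (k * d') (extend k 1 d d' \<Lambda> M))"

fun intrinsic_info :: "dims \<Rightarrow> complex mat \<Rightarrow> ereal" where
  "intrinsic_info (a, b, e) \<rho> =
     (INF (e', \<Lambda>) \<in> {(e', \<Lambda>). cptp e e' \<Lambda>}.
        ereal (cond_mutual_info (a, b, e') (extend (a * b) 1 e e' \<Lambda> \<rho>)))"

text \<open>
  Public communication. Alice's space is \<open>A \<otimes> A'\<close> where \<open>A'\<close> is the last factor, of dimension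
  \<open>k\<close>; the registers \<open>B'\<close> and \<open>E'\<close> are likewise appended as last factors. The map is
  \<open>\<rho> \<mapsto> \<Sum>i. \<langle>i| \<rho> |i\<rangle> \<otimes> |iii\<rangle>\<langle>iii|\<close>, with the matrix elements taken on \<open>A'\<close>. On states
  \<open>\<Sum>i. \<rho>\<^sup>i \<otimes> |i\<rangle>\<langle>i|\<close>, for which \<open>A'\<close> is classical, this copies \<open>i\<close> to Bob and Eve. On all other
  operators, \<open>A'\<close> is first made classical by measuring it in the computational basis.
\<close>

definition publish_A :: "dims \<Rightarrow> nat \<Rightarrow> complex mat \<Rightarrow> complex mat" where
  "publish_A = (\<lambda>(a, b, e) k M. mat3 (a * k, b * k, e * k) (\<lambda>(x, y, z) (x', y', z').
     if x mod k = y mod k \<and> y mod k = z mod k \<and> z mod k = x' mod k \<and>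
        x' mod k = y' mod k \<and> y' mod k = z' mod k
     then entry3 (a * k, b, e) M (x, y div k, z div k) (x', y' div k, z' div k) else 0))"

definition publish_B :: "dims \<Rightarrow> nat \<Rightarrow> complex mat \<Rightarrow> complex mat" where
  "publish_B = (\<lambda>(a, b, e) k M. mat3 (a * k, b * k, e * k) (\<lambda>(x, y, z) (x', y', z').
     if x mod k = y mod k \<and> y mod k = z mod k \<and> z mod k = x' mod k \<and>
        x' mod k = y' mod k \<and> y' mod k = z' mod k
     then entry3 (a, b * k, e) M (x div k, y, z div k) (x' div k, y', z' div k) else 0))"

inductive lopc_step :: "dims \<Rightarrow> dims \<Rightarrow> (complex mat \<Rightarrow> complex mat) \<Rightarrow> bool" where
  local_A: "cptp a a' \<Lambda> \<Longrightarrow> lopc_step (a, b, e) (a', b, e) (extend 1 (b * e) a a' \<Lambda>)"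
| local_B: "cptp b b' \<Lambda> \<Longrightarrow> lopc_step (a, b, e) (a, b', e) (extend a e b b' \<Lambda>)"
| public_A: "lopc_step (a * k, b, e) (a * k, b * k, e * k) (publish_A (a, b, e) k)"
| public_B: "lopc_step (a, b * k, e) (a * k, b * k, e * k) (publish_B (a, b, e) k)"

inductive lopc :: "dims \<Rightarrow> dims \<Rightarrow> (complex mat \<Rightarrow> complex mat) \<Rightarrow> bool" where
  lopc_id: "lopc D D (\<lambda>M. M)"
| lopc_comp: "lopc D D' \<Lambda> \<Longrightarrow> lopc_step D' D'' \<Gamma> \<Longrightarrow> lopc D D'' (\<lambda>M. \<Gamma> (\<Lambda> M))"

fun dims_power :: "dims \<Rightarrow> nat \<Rightarrow> dims" where
  "dims_power (a, b, e) n = (a ^ n, b ^ n, e ^ n)"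

definition digit :: "nat \<Rightarrow> nat \<Rightarrow> nat \<Rightarrow> nat" where
  "digit d i x = x div d ^ i mod d"

text \<open>The \<open>n\<close>-fold tensor power of a tripartite operator, with the factors regrouped into
  \<open>A\<^sup>n \<otimes> B\<^sup>n \<otimes> E\<^sup>n\<close>; the \<open>i\<close>-th copy is addressed by the \<open>i\<close>-th digit of each of the three indices,
  in base \<open>a\<close>, \<open>b\<close> and \<open>e\<close> respectively.\<close>

fun tensor_power :: "dims \<Rightarrow> nat \<Rightarrow> complex mat \<Rightarrow> complex mat" where
  "tensor_power (a, b, e) n \<rho> = mat3 (a ^ n, b ^ n, e ^ n) (\<lambda>(x, y, z) (x', y', z').
     \<Prod>i<n. entry3 (a, b, e) \<rho> (digit a i x, digit b i y, digit e i z)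
                               (digit a i x', digit b i y', digit e i z'))"

text \<open>A protocol is given by its maps \<open>\<Lambda> n\<close> and the dimensions \<open>D n\<close> of their output systems.\<close>

definition lopc_protocol ::
  "dims \<Rightarrow> (nat \<Rightarrow> dims) \<Rightarrow> (nat \<Rightarrow> complex mat \<Rightarrow> complex mat) \<Rightarrow> bool" where
  "lopc_protocol D0 D \<Lambda> \<longleftrightarrow>
     (\<forall>n. cptp (dim3 (dims_power D0 n)) (dim3 (D n)) (\<Lambda> n) \<and> lopc (dims_power D0 n) (D n) (\<Lambda> n))"

text \<open>The key state \<open>2\<^sup>-\<^sup>l \<Sum>i<2\<^sup>l. |ii\<rangle>\<langle>ii| \<otimes> \<tau>\<close>, where \<open>i\<close> runs through the first \<open>2\<^sup>l\<close> basis vectors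
  of Alice's and of Bob's space. These spaces may be larger, but not smaller, than \<open>2\<^sup>l\<close>; the
  predicate \<open>fits_key\<close> says so.\<close>

fun key_state :: "dims \<Rightarrow> nat \<Rightarrow> complex mat \<Rightarrow> complex mat" where
  "key_state (a, b, e) l \<tau> = mat3 (a, b, e) (\<lambda>(x, y, z) (x', y', z').
     if x < 2 ^ l \<and> y = x \<and> x' = x \<and> y' = x then \<tau> $$ (z, z') / 2 ^ l else 0)"

fun fits_key :: "dims \<Rightarrow> nat \<Rightarrow> bool" where
  "fits_key (a, b, e) l \<longleftrightarrow> 2 ^ l \<le> a \<and> 2 ^ l \<le> b"

fun eve_state :: "dims \<Rightarrow> complex mat \<Rightarrow> bool" where
  "eve_state (a, b, e) \<tau> \<longleftrightarrow> density e \<tau>"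

definition distills ::
  "dims \<Rightarrow> complex mat \<Rightarrow> (nat \<Rightarrow> dims) \<Rightarrow> (nat \<Rightarrow> complex mat \<Rightarrow> complex mat) \<Rightarrow> ereal \<Rightarrow> bool" where
  "distills D0 \<rho> D \<Lambda> R \<longleftrightarrow>
     (\<exists>l \<tau>. (\<forall>n. fits_key (D n) (l n) \<and> eve_state (D n) (\<tau> n)) \<and>
        limsup (\<lambda>n. ereal (real (l n) / real n)) = R \<and>
        (\<lambda>n. trace_dist (\<Lambda> n (tensor_power D0 n \<rho>)) (key_state (D n) (l n) (\<tau> n)))
          \<longlonglongrightarrow> 0)"

definition key_rate :: "dims \<Rightarrow> complex mat \<Rightarrow> ereal" where
  "key_rate D0 \<rho> = Sup {R. \<exists>D \<Lambda>. lopc_protocol D0 D \<Lambda> \<and> distills D0 \<rho> D \<Lambda> R}"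

end

(*
  Fix a channel from E to E' and put c = I(A:B|E') for the resulting state. For the n-fold tensor
  power the n-fold channel achieves the value n c, and an LOPC operation never increases the
  achievable values: local operations commute with the channel on Eve's side, and what is published
  is simply forwarded by Eve. After the protocol the state is close to a key state of l bits, whose
  conditional mutual information is l for every state of Eve; the dimension of Eve's space does not
  enter the continuity estimate, so l (1 - 2 eps) - 4 (1 + eps) <= n c, and one divides by n.

  Everything rests on strong subadditivity. It is obtained from the monotonicity of the relative
  entropy D(rho, sigma), which is the integral over t > 0, up to a constant independent of sigma, of
    sup over X of  2 Re tr (X' rho) - tr (X' sigma X) - t tr (X rho X')   (X' the adjoint of X);
  for a partial trace this supremum decreases because X may be replaced by its tensor product with
  the identity. Instead of integrating, one compares derivatives of logarithms.
*)
theory Submission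
  imports Defs "HOL-Analysis.L2_Norm"
begin

text \<open>States are kernels on product index sets, so regrouping needs no index arithmetic;
  matrices appear only in the spectral theorem and where the definitions are translated. Kernels are
  positive but not normalised, and this shapes the continuity estimate: with \<epsilon> the trace
  distance, \<rho> + N = \<sigma> + P for positive N, P of trace \<epsilon>, and the conditional
  mutual information is additive under sums up to 2 ln 2 times the total trace, as each of its four
  entropies is off by at most the entropy of a one-bit flag. Two sums of trace 1 + \<epsilon> give 4
  (1 + \<epsilon>); N contributes 2 \<epsilon> times the log of Alice's dimension. The obstacle is
  that her output space may be far larger than the key. So Alice and Bob first fold their spaces
  onto the 2^l key values: this keeps the form of the key state, cannot raise the information and
  turns that log into l. Relative entropy is taken to 1 \<otimes> \<rho>_C, where it is minus the
  entropy of B given C. This operator dominates \<rho> up to the factor |B|, which gives the support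
  inclusion on which the eigenvector formulas rest, and a dimension bound.\<close>

section \<open>From resolvents to logarithms\<close>

text \<open>Stands in for the integral over t > 0 of 1 / (x + t) - 1 / (1 + t), which is - ln x. The
  difference \<open>g\<close> of the shifted logarithms has as derivative the right side of
  \<open>le\<close> minus its left side, so it increases; it tends to 0 at infinity, hence
  \<open>g 0 \<le> 0\<close>.\<close>

lemma log_from_resolvent:
  fixes a x :: "'i \<Rightarrow> real" and b y :: "'j \<Rightarrow> real"
  assumes "finite I" "finite J" "\<forall>i\<in>I. 0 < x i" "\<forall>j\<in>J. 0 < y j"
    and "sum a I = sum b J"
    and le: "\<And>t. 0 < t \<Longrightarrow> (\<Sum>i\<in>I. a i / (x i + t)) \<le> (\<Sum>j\<in>J. b j / (y j + t))"
  shows "(\<Sum>i\<in>I. a i * - ln (x i)) \<le> (\<Sum>j\<in>J. b j * - ln (y j))"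
proof -
  define g where "g t = (\<Sum>j\<in>J. b j * ln (y j + t)) - (\<Sum>i\<in>I. a i * ln (x i + t))" for t
  have deriv: "(g has_real_derivative (\<Sum>j\<in>J. b j / (y j + t)) - (\<Sum>i\<in>I. a i / (x i + t))) (at t)"
    if "0 \<le> t" for t
  proof -
    have y: "y j + t > 0" if "j \<in> J" for j using assms(4) that \<open>0 \<le> t\<close> by (meson add_pos_nonneg)
    have x: "x j + t > 0" if "j \<in> I" for j using assms(3) that \<open>0 \<le> t\<close> by (meson add_pos_nonneg)
    have term_deriv: "((\<lambda>t. c * ln (z + t)) has_real_derivative c / (z + t)) (at t)" if "z + t > 0" for c z :: real
      using that by (auto intro!: derivative_eq_intros simp: divide_inverse mult.commute)
    have "((\<lambda>t. (\<Sum>j\<in>J. b j * ln (y j + t)) - (\<Sum>i\<in>I. a i * ln (x i + t))) has_real_derivative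
        (\<Sum>j\<in>J. b j / (y j + t)) - (\<Sum>i\<in>I. a i / (x i + t))) (at t)"
      by (intro DERIV_diff DERIV_sum term_deriv x y)
    then show "(g has_real_derivative (\<Sum>j\<in>J. b j / (y j + t)) - (\<Sum>i\<in>I. a i / (x i + t))) (at t)"
      by (simp only: g_def[abs_def])
  qed
  have mono: "g 0 \<le> g t" if "0 < t" for t
  proof (rule DERIV_nonneg_imp_increasing_open[where f = g])
    show "\<exists>l. DERIV g u :> l \<and> 0 \<le> l" if "0 < u" "u < t" for u
      using that by (intro exI[of _ "(\<Sum>j\<in>J. b j / (y j + u)) - (\<Sum>i\<in>I. a i / (x i + u))"] conjI deriv) (simp_all add: le)
    show "continuous_on {0..t} g"
      by (intro continuous_at_imp_continuous_on ballI DERIV_isCont[OF deriv]) auto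
  qed (use that in auto)
  have lim1: "((\<lambda>t. ln (c + t) - ln t) \<longlongrightarrow> 0) at_top" for c :: real
  proof -
    have "((\<lambda>t. ln (1 + c / t)) \<longlongrightarrow> ln (1 + 0)) at_top"
      by (intro tendsto_intros tendsto_divide_0[OF tendsto_const] filterlim_ident
          filterlim_at_top_imp_at_infinity) auto
    moreover have "\<forall>\<^sub>F t in at_top. ln (1 + c / t) = ln (c + t) - ln t"
      using eventually_gt_at_top[of "max 0 (- c)"]
    proof eventually_elim
      case (elim t)
      then have "1 + c / t = (c + t) / t" by (simp add: field_simps)
      then show ?case using elim by (simp add: ln_div)
    qed
    ultimately show ?thesis by (simp add: tendsto_cong)
  qed
  \<comment> \<open>Each logarithm alone diverges. Since the weights have equal totals,
    \<open>ln t\<close> can be subtracted from all of them without changing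
    \<open>g\<close>.\<close>
  have "((\<lambda>t. (\<Sum>j\<in>J. b j * (ln (y j + t) - ln t)) - (\<Sum>i\<in>I. a i * (ln (x i + t) - ln t)))
      \<longlongrightarrow> (\<Sum>j\<in>J. b j * 0) - (\<Sum>i\<in>I. a i * 0)) at_top"
    by (intro tendsto_intros lim1)
  moreover have "(\<Sum>j\<in>J. b j * (ln (y j + t) - ln t)) - (\<Sum>i\<in>I. a i * (ln (x i + t) - ln t)) = g t" for t
    using assms(5) by (simp add: g_def right_diff_distrib sum_subtractf flip: sum_distrib_right)
  ultimately have "(g \<longlongrightarrow> 0) at_top" by simp
  then have "g 0 \<le> 0"
    by (rule tendsto_lowerbound) (auto simp: eventually_at_top_linorder intro!: exI[of _ 1] mono)
  then show ?thesis by (simp add: g_def sum_negf)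
qed

section \<open>Vectors on an index set, orthonormal families and spectral decompositions\<close>

definition ip :: "'i set \<Rightarrow> ('i \<Rightarrow> complex) \<Rightarrow> ('i \<Rightarrow> complex) \<Rightarrow> complex" where
  "ip I u v = (\<Sum>x\<in>I. cnj (u x) * v x)"

definition sqn :: "'i set \<Rightarrow> ('i \<Rightarrow> complex) \<Rightarrow> real" where
  "sqn I v = (\<Sum>x\<in>I. (cmod (v x))\<^sup>2)"

definition ortho :: "'i set \<Rightarrow> 'k set \<Rightarrow> ('k \<Rightarrow> 'i \<Rightarrow> complex) \<Rightarrow> bool" where
  "ortho I K u \<longleftrightarrow> (\<forall>k\<in>K. \<forall>l\<in>K. ip I (u k) (u l) = (if k = l then 1 else 0))"

text \<open>Only the strictly positive eigenvalues are listed, so the \<open>u k\<close> span the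
  support of \<open>\<rho>\<close> and every logarithm has a positive argument. The labels may have
  any type, which lets products and disjoint sums of decompositions be written down
  directly.\<close>

definition spec :: "'i set \<Rightarrow> ('i \<Rightarrow> 'i \<Rightarrow> complex) \<Rightarrow> 'k set \<Rightarrow> ('k \<Rightarrow> real) \<Rightarrow> ('k \<Rightarrow> 'i \<Rightarrow> complex) \<Rightarrow> bool"
  where "spec I \<rho> K p u \<longleftrightarrow> finite K \<and> (\<forall>k\<in>K. 0 < p k) \<and> ortho I K u \<and>
    (\<forall>x\<in>I. \<forall>y\<in>I. \<rho> x y = (\<Sum>k\<in>K. of_real (p k) * u k x * cnj (u k y)))"

definition quad :: "'i set \<Rightarrow> ('i \<Rightarrow> 'i \<Rightarrow> complex) \<Rightarrow> ('i \<Rightarrow> complex) \<Rightarrow> complex" where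
  "quad I \<rho> v = (\<Sum>x\<in>I. \<Sum>y\<in>I. cnj (v x) * \<rho> x y * v y)"

lemma ip_self: "ip I v v = of_real (sqn I v)"
  unfolding ip_def sqn_def of_real_sum complex_norm_square by (simp add: mult.commute)

lemma ip_cnj: "cnj (ip I u v) = ip I v u"
  by (simp add: ip_def mult.commute)

lemma cmod_ip_commute: "cmod (ip I u v) = cmod (ip I v u)"
  by (metis ip_cnj complex_mod_cnj)

lemma ip_diff_right: "ip I u (\<lambda>x. v x - w x) = ip I u v - ip I u w"
  by (simp add: ip_def right_diff_distrib sum_subtractf)

lemma ip_diff_left: "ip I (\<lambda>x. v x - w x) u = ip I v u - ip I w u"
  by (simp add: ip_def left_diff_distrib sum_subtractf)

lemma ip_sum_right: "ip I u (\<lambda>x. \<Sum>k\<in>K. c k * v k x) = (\<Sum>k\<in>K. c k * ip I u (v k))"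
  unfolding ip_def sum_distrib_left by (subst sum.swap) (simp add: algebra_simps)

lemma ip_sum_left: "ip I (\<lambda>x. \<Sum>k\<in>K. c k * v k x) u = (\<Sum>k\<in>K. cnj (c k) * ip I (v k) u)"
  by (subst ip_cnj[symmetric], subst ip_sum_right) (simp add: ip_cnj)

lemma sqn_nonneg: "0 \<le> sqn I v"
  by (simp add: sqn_def sum_nonneg)

lemma orthoD: "ortho I K u \<Longrightarrow> k \<in> K \<Longrightarrow> l \<in> K \<Longrightarrow> ip I (u k) (u l) = (if k = l then 1 else 0)"
  by (simp add: ortho_def)

lemma ip_ortho_sum:
  assumes "finite K" "ortho I K u" "l \<in> K"
  shows "ip I (u l) (\<lambda>x. \<Sum>k\<in>K. c k * u k x) = c l"
proof -
  have "ip I (u l) (\<lambda>x. \<Sum>k\<in>K. c k * u k x) = (\<Sum>k\<in>K. c k * (if l = k then 1 else 0))"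
    unfolding ip_sum_right using assms by (intro sum.cong) (auto simp: orthoD)
  then show ?thesis using assms by (simp add: if_distrib cong: if_cong)
qed

lemma sqn_ortho_sum:
  assumes "finite K" "ortho I K u"
  shows "sqn I (\<lambda>x. \<Sum>k\<in>K. c k * u k x) = (\<Sum>k\<in>K. (cmod (c k))\<^sup>2)"
proof -
  have "complex_of_real (sqn I (\<lambda>x. \<Sum>k\<in>K. c k * u k x)) = (\<Sum>k\<in>K. cnj (c k) * c k)"
    unfolding ip_self[symmetric] ip_sum_left
    using assms by (intro sum.cong) (auto simp: ip_ortho_sum)
  also have "\<dots> = of_real (\<Sum>k\<in>K. (cmod (c k))\<^sup>2)"
    unfolding of_real_sum complex_norm_square by (simp add: mult.commute)
  finally show ?thesis by (simp only: of_real_eq_iff)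
qed

text \<open>Pythagoras. The exact defect is recorded because \<open>ortho_complete\<close> needs the
  case of equality, not only Bessel's inequality.\<close>

lemma sqn_bessel_defect:
  assumes "finite K" "ortho I K u"
  shows "sqn I (\<lambda>x. v x - (\<Sum>k\<in>K. ip I (u k) v * u k x)) = sqn I v - (\<Sum>k\<in>K. (cmod (ip I (u k) v))\<^sup>2)"
proof -
  let ?w = "\<lambda>x. \<Sum>k\<in>K. ip I (u k) v * u k x"
  let ?S = "complex_of_real (\<Sum>k\<in>K. (cmod (ip I (u k) v))\<^sup>2)"
  have 1: "ip I v ?w = ?S"
    unfolding ip_sum_right of_real_sum complex_norm_square by (simp add: ip_cnj)
  have 2: "ip I ?w v = ?S"
    using arg_cong[OF 1, of cnj] unfolding ip_cnj by simp
  have 3: "ip I ?w ?w = ?S" unfolding ip_self sqn_ortho_sum[OF assms] ..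
  have "ip I (\<lambda>x. v x - ?w x) (\<lambda>x. v x - ?w x) = ip I v v - ?S"
    by (simp only: ip_diff_right ip_diff_left 1 2 3 diff_self diff_zero)
  then have "complex_of_real (sqn I (\<lambda>x. v x - ?w x)) = of_real (sqn I v) - ?S"
    by (simp only: ip_self)
  then have "complex_of_real (sqn I (\<lambda>x. v x - ?w x)) =
      of_real (sqn I v - (\<Sum>k\<in>K. (cmod (ip I (u k) v))\<^sup>2))"
    by (simp only: of_real_diff)
  then show ?thesis by (simp only: of_real_eq_iff)
qed

lemma bessel:
  assumes "finite K" "ortho I K u"
  shows "(\<Sum>k\<in>K. (cmod (ip I (u k) v))\<^sup>2) \<le> sqn I v"
  using sqn_bessel_defect[OF assms, of v] sqn_nonneg[of I "\<lambda>x. v x - (\<Sum>k\<in>K. ip I (u k) v * u k x)"]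
  by linarith

lemma sqn_eq_0: "finite I \<Longrightarrow> sqn I v = 0 \<longleftrightarrow> (\<forall>x\<in>I. v x = 0)"
  by (simp add: sqn_def sum_nonneg_eq_0_iff)

lemma sqn_unit: "ortho I K u \<Longrightarrow> k \<in> K \<Longrightarrow> sqn I (u k) = 1"
  using orthoD[of I K u k k] by (simp add: ip_self)

lemma spec_apply:
  assumes "spec I \<rho> K p u" "x \<in> I"
  shows "(\<Sum>y\<in>I. \<rho> x y * v y) = (\<Sum>k\<in>K. of_real (p k) * ip I (u k) v * u k x)"
proof -
  have "(\<Sum>y\<in>I. \<rho> x y * v y) = (\<Sum>y\<in>I. \<Sum>k\<in>K. of_real (p k) * u k x * cnj (u k y) * v y)"
    using assms by (intro sum.cong) (auto simp: spec_def sum_distrib_right)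
  also have "\<dots> = (\<Sum>k\<in>K. \<Sum>y\<in>I. of_real (p k) * u k x * cnj (u k y) * v y)"
    by (rule sum.swap)
  finally show ?thesis by (simp add: ip_def sum_distrib_left sum_distrib_right mult_ac)
qed

lemma spec_quadratic:
  assumes "spec I \<rho> K p u"
  shows "quad I \<rho> v = of_real (\<Sum>k\<in>K. p k * (cmod (ip I (u k) v))\<^sup>2)"
proof -
  have "quad I \<rho> v = ip I v (\<lambda>x. \<Sum>k\<in>K. (of_real (p k) * ip I (u k) v) * u k x)"
    using spec_apply[OF assms, of _ v] unfolding ip_def quad_def
    by (intro sum.cong) (simp_all add: sum_distrib_left[symmetric] mult.assoc)
  also have "\<dots> = of_real (\<Sum>k\<in>K. p k * (cmod (ip I (u k) v))\<^sup>2)"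
    unfolding ip_sum_right of_real_sum of_real_mult complex_norm_square
    by (intro sum.cong) (simp_all add: ip_cnj mult.assoc)
  finally show ?thesis .
qed

lemma spec_trace:
  assumes "spec I \<rho> K p u"
  shows "(\<Sum>x\<in>I. \<rho> x x) = of_real (sum p K)"
proof -
  have "(\<Sum>x\<in>I. \<rho> x x) = (\<Sum>x\<in>I. \<Sum>k\<in>K. of_real (p k) * u k x * cnj (u k x))"
    using assms by (intro sum.cong) (auto simp: spec_def)
  also have "\<dots> = (\<Sum>k\<in>K. of_real (p k) * ip I (u k) (u k))"
    by (subst sum.swap) (simp add: ip_def sum_distrib_left mult_ac)
  also have "\<dots> = of_real (sum p K)"
    unfolding of_real_sum using assms by (intro sum.cong) (auto simp: spec_def orthoD)
  finally show ?thesis .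
qed

lemma spec_eigen:
  assumes "spec I \<rho> K p u" "k \<in> K" "x \<in> I"
  shows "(\<Sum>y\<in>I. \<rho> x y * u k y) = of_real (p k) * u k x"
proof -
  have "(\<Sum>l\<in>K. of_real (p l) * ip I (u l) (u k) * u l x) =
      (\<Sum>l\<in>K. if l = k then of_real (p k) * u k x else 0)"
    using assms by (intro sum.cong) (auto simp: spec_def orthoD)
  then show ?thesis unfolding spec_apply[OF assms(1,3)] using assms by (simp add: spec_def)
qed

text \<open>The dominating sum of squares forces \<open>w\<close> into the span of the eigenvectors of \<open>\<sigma>\<close>.\<close>

lemma spec_support:
  assumes "finite I" "spec I \<sigma> J q v" "0 < c"
    and dom: "\<And>z. c * (cmod (ip I z w))\<^sup>2 \<le> Re (quad I \<sigma> z)"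
    and "x \<in> I"
  shows "w x = (\<Sum>j\<in>J. ip I (v j) w * v j x)"
proof -
  have fJ: "finite J" "ortho I J v" using assms(2) by (auto simp: spec_def)
  define z where "z = (\<lambda>x. w x - (\<Sum>j\<in>J. ip I (v j) w * v j x))"
  have orth: "ip I (v j) z = 0" if "j \<in> J" for j
    unfolding z_def ip_diff_right ip_ortho_sum[OF fJ that] by simp
  have "Re (quad I \<sigma> z) = 0"
    unfolding spec_quadratic[OF assms(2)] by (simp add: orth)
  with dom[of z] have "c * (cmod (ip I z w))\<^sup>2 \<le> 0" by simp
  with \<open>0 < c\<close> have "ip I z w = 0"
    by (simp add: mult_le_0_iff)
  moreover have "ip I z z = ip I z w - (\<Sum>j\<in>J. ip I (v j) w * ip I z (v j))"
    by (subst (2) z_def) (simp add: ip_diff_right ip_sum_right)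
  moreover have "ip I z (v j) = 0" if "j \<in> J" for j
    using orth[OF that] by (metis ip_cnj complex_cnj_zero)
  ultimately have "sqn I z = 0" by (simp add: ip_self)
  then show ?thesis using assms by (simp add: sqn_eq_0 z_def)
qed

text \<open>\<open>\<rho>\<close> dominates each of its own rank-one terms, so
  \<open>spec_support\<close> applies with \<open>\<rho>\<close> in the role of
  \<open>\<sigma>\<close>.\<close>

lemma spec_self_support:
  assumes "finite I" "spec I \<rho> K p u" "spec I \<rho> J q v" "k \<in> K" "x \<in> I"
  shows "u k x = (\<Sum>j\<in>J. ip I (v j) (u k) * v j x)"
proof (rule spec_support[OF assms(1,3)])
  show "0 < p k" using assms by (simp add: spec_def)
  fix z
  have "p k * (cmod (ip I (u k) z))\<^sup>2 \<le> (\<Sum>k\<in>K. p k * (cmod (ip I (u k) z))\<^sup>2)"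
    using assms by (intro member_le_sum) (auto simp: spec_def less_imp_le)
  then show "p k * (cmod (ip I z (u k)))\<^sup>2 \<le> Re (quad I \<rho> z)"
    by (simp add: spec_quadratic[OF assms(2)] cmod_ip_commute[of I z])
qed fact

text \<open>Parseval inside the span. For a unit vector \<open>w\<close> it makes the squared
  overlaps with the \<open>v j\<close> a probability distribution.\<close>

lemma support_weights:
  assumes "finite J" "ortho I J v" "\<And>x. x \<in> I \<Longrightarrow> w x = (\<Sum>j\<in>J. ip I (v j) w * v j x)"
  shows "(\<Sum>j\<in>J. (cmod (ip I (v j) w))\<^sup>2) = sqn I w"
proof -
  have "sqn I w = sqn I (\<lambda>x. \<Sum>j\<in>J. ip I (v j) w * v j x)"
    unfolding sqn_def by (rule sum.cong[OF refl]) (subst assms(3), auto)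
  then show ?thesis using sqn_ortho_sum[OF assms(1,2)] by simp
qed

text \<open>The squared overlaps of the two eigenbases form a doubly stochastic matrix, by support
  inclusion in both directions, and an overlap vanishes unless the eigenvalues agree. So
  \<open>f\<close> can be moved from one list to the other. This makes entropy independent of the
  decomposition.\<close>

lemma spec_unique:
  fixes f :: "real \<Rightarrow> real"
  assumes "finite I" "spec I \<rho> K p u" "spec I \<rho> J q v"
  shows "(\<Sum>k\<in>K. f (p k)) = (\<Sum>j\<in>J. f (q j))"
proof -
  define w where "w k j = (cmod (ip I (v j) (u k)))\<^sup>2" for k j
  have fin: "finite K" "finite J" "ortho I K u" "ortho I J v" using assms by (auto simp: spec_def)
  have 1: "(\<Sum>j\<in>J. w k j) = 1" if "k \<in> K" for k
    unfolding w_def using support_weights[OF fin(2,4) spec_self_support[OF assms that]]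
    by (simp add: sqn_unit[OF fin(3) that])
  have 2: "(\<Sum>k\<in>K. w k j) = 1" if "j \<in> J" for j
    unfolding w_def cmod_ip_commute[of I "v j"]
    using support_weights[OF fin(1,3) spec_self_support[OF assms(1,3,2) that]]
    by (simp add: sqn_unit[OF fin(4) that])
  have 3: "w k j * f (p k) = w k j * f (q j)" if "k \<in> K" "j \<in> J" for k j
  proof -
    \<comment> \<open>The matrix element of \<open>\<rho>\<close> between \<open>v j\<close> and
      \<open>u k\<close>, evaluated once with each eigenvalue.\<close>
    have "of_real (p k) * ip I (v j) (u k) = (\<Sum>x\<in>I. cnj (v j x) * (of_real (p k) * u k x))"
      by (simp add: ip_def sum_distrib_left mult_ac)
    also have "\<dots> = (\<Sum>x\<in>I. cnj (v j x) * (\<Sum>y\<in>I. \<rho> x y * u k y))"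
      using spec_eigen[OF assms(2) that(1)] by simp
    also have "\<dots> = (\<Sum>x\<in>I. cnj (v j x) * (\<Sum>i\<in>J. of_real (q i) * ip I (v i) (u k) * v i x))"
      using spec_apply[OF assms(3)] by simp
    also have "\<dots> = of_real (q j) * ip I (v j) (u k)"
      using ip_ortho_sum[OF fin(2,4) that(2)] by (simp add: ip_def)
    finally have "p k = q j \<or> ip I (v j) (u k) = 0" by (metis mult_cancel_right of_real_eq_iff)
    then show ?thesis by (auto simp: w_def)
  qed
  have "(\<Sum>k\<in>K. f (p k)) = (\<Sum>k\<in>K. \<Sum>j\<in>J. w k j * f (p k))"
    using 1 by (simp flip: sum_distrib_right)
  also have "\<dots> = (\<Sum>k\<in>K. \<Sum>j\<in>J. w k j * f (q j))"
    using 3 by (intro sum.cong) auto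
  also have "\<dots> = (\<Sum>j\<in>J. \<Sum>k\<in>K. w k j * f (q j))"
    by (rule sum.swap)
  also have "\<dots> = (\<Sum>j\<in>J. f (q j))"
    using 2 by (simp flip: sum_distrib_right)
  finally show ?thesis .
qed

section \<open>The variational functional and monotonicity of relative entropy\<close>

definition vform ::
  "'i set \<Rightarrow> ('i \<Rightarrow> 'i \<Rightarrow> complex) \<Rightarrow> ('i \<Rightarrow> 'i \<Rightarrow> complex) \<Rightarrow> real \<Rightarrow> ('i \<Rightarrow> 'i \<Rightarrow> complex) \<Rightarrow> real" where
  "vform I \<rho> \<sigma> t X = 2 * Re (\<Sum>x\<in>I. \<Sum>y\<in>I. cnj (X x y) * \<rho> x y)
     - Re (\<Sum>y\<in>I. \<Sum>x\<in>I. \<Sum>x'\<in>I. cnj (X x y) * \<sigma> x x' * X x' y)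
     - t * Re (\<Sum>x\<in>I. \<Sum>y\<in>I. \<Sum>y'\<in>I. X x y * \<rho> y y' * cnj (X x y'))"

text \<open>The maximum of \<open>vform\<close> over \<open>X\<close> in closed form, given the
  support inclusion. It is the quadratic form, at the vector \<rho>^(1/2), of the resolvent at -t of
  the relative modular operator Y \<mapsto> \<sigma> Y \<rho>^-1, whose eigenvalues are the ratios q
  / p.\<close>

definition resolvent_form ::
  "'i set \<Rightarrow> 'k set \<Rightarrow> ('k \<Rightarrow> real) \<Rightarrow> ('k \<Rightarrow> 'i \<Rightarrow> complex) \<Rightarrow> 'j set \<Rightarrow> ('j \<Rightarrow> real) \<Rightarrow> ('j \<Rightarrow> 'i \<Rightarrow> complex) \<Rightarrow> real \<Rightarrow> real"
  where "resolvent_form I K p u J q v t =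
    (\<Sum>j\<in>J. \<Sum>k\<in>K. (cmod (ip I (v j) (u k)))\<^sup>2 * (p k)\<^sup>2 / (q j + t * p k))"

lemma sum_Times: "(\<Sum>x\<in>A \<times> B. f x) = (\<Sum>a\<in>A. \<Sum>b\<in>B. f (a, b))"
  by (simp add: sum.cartesian_product case_prod_unfold)

text \<open>In the eigenbases the two penalty terms become weighted squared norms, ready for
  Bessel's inequality.\<close>

lemma vform_spec:
  assumes "spec I \<rho> K p u" "spec I \<sigma> J q v"
  shows "vform I \<rho> \<sigma> t X =
    2 * Re (\<Sum>k\<in>K. of_real (p k) * ip I (\<lambda>x. \<Sum>y\<in>I. X x y * u k y) (u k))
    - (\<Sum>j\<in>J. q j * sqn I (\<lambda>y. ip I (v j) (\<lambda>x. X x y)))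
    - t * (\<Sum>k\<in>K. p k * sqn I (\<lambda>x. \<Sum>y\<in>I. X x y * u k y))"
proof -
  have 1: "(\<Sum>x\<in>I. \<Sum>y\<in>I. cnj (X x y) * \<rho> x y) =
      (\<Sum>k\<in>K. of_real (p k) * ip I (\<lambda>x. \<Sum>y\<in>I. X x y * u k y) (u k))"
  proof -
    have "(\<Sum>x\<in>I. \<Sum>y\<in>I. cnj (X x y) * \<rho> x y) =
        (\<Sum>x\<in>I. \<Sum>y\<in>I. \<Sum>k\<in>K. of_real (p k) * (cnj (X x y * u k y) * u k x))"
      using assms(1) by (intro sum.cong) (auto simp: spec_def sum_distrib_left mult_ac)
    also have "\<dots> = (\<Sum>x\<in>I. \<Sum>k\<in>K. \<Sum>y\<in>I. of_real (p k) * (cnj (X x y * u k y) * u k x))"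
      by (intro sum.cong sum.swap) auto
    also have "\<dots> = (\<Sum>k\<in>K. \<Sum>x\<in>I. \<Sum>y\<in>I. of_real (p k) * (cnj (X x y * u k y) * u k x))"
      by (rule sum.swap)
    finally show ?thesis
      by (simp add: ip_def sum_distrib_left sum_distrib_right)
  qed
  have 2: "(\<Sum>y\<in>I. \<Sum>x\<in>I. \<Sum>x'\<in>I. cnj (X x y) * \<sigma> x x' * X x' y) =
      of_real (\<Sum>j\<in>J. q j * sqn I (\<lambda>y. ip I (v j) (\<lambda>x. X x y)))"
  proof -
    have "(\<Sum>y\<in>I. \<Sum>x\<in>I. \<Sum>x'\<in>I. cnj (X x y) * \<sigma> x x' * X x' y) =
        of_real (\<Sum>y\<in>I. \<Sum>j\<in>J. q j * (cmod (ip I (v j) (\<lambda>x. X x y)))\<^sup>2)"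
      unfolding of_real_sum[of _ I]
      by (intro sum.cong refl, fold spec_quadratic[OF assms(2)]) (simp add: quad_def)
    then show ?thesis
      by (subst (asm) sum.swap) (simp add: sqn_def sum_distrib_left)
  qed
  have 3: "(\<Sum>x\<in>I. \<Sum>y\<in>I. \<Sum>y'\<in>I. X x y * \<rho> y y' * cnj (X x y')) =
      of_real (\<Sum>k\<in>K. p k * sqn I (\<lambda>x. \<Sum>y\<in>I. X x y * u k y))"
  proof -
    have *: "cmod (ip I (u k) (\<lambda>y. cnj (X x y))) = cmod (\<Sum>y\<in>I. X x y * u k y)" for k x
      by (subst cmod_ip_commute) (simp add: ip_def)
    have "(\<Sum>x\<in>I. \<Sum>y\<in>I. \<Sum>y'\<in>I. X x y * \<rho> y y' * cnj (X x y')) =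
        of_real (\<Sum>x\<in>I. \<Sum>k\<in>K. p k * (cmod (\<Sum>y\<in>I. X x y * u k y))\<^sup>2)"
      unfolding of_real_sum[of _ I] *[symmetric]
      by (intro sum.cong refl, fold spec_quadratic[OF assms(1)]) (simp add: quad_def)
    then show ?thesis
      by (subst (asm) sum.swap) (simp add: sqn_def sum_distrib_left)
  qed
  show ?thesis unfolding vform_def 1 2 3 by simp
qed

text \<open>Completing the square; equality holds at x = p w / (q + t p), the source of the
  maximiser in \<open>vform_attained\<close>.\<close>

lemma weighted_square_bound:
  fixes w x :: complex and p q t :: real
  assumes "0 < q + t * p"
  shows "2 * (p * Re (w * cnj x)) - (q + t * p) * (cmod x)\<^sup>2 \<le> (cmod w)\<^sup>2 * p\<^sup>2 / (q + t * p)"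
proof -
  let ?d = "q + t * p"
  have "p * Re (w * cnj x) \<le> \<bar>p\<bar> * \<bar>Re (w * cnj x)\<bar>"
    by (metis abs_ge_self abs_mult)
  also have "\<dots> \<le> \<bar>p\<bar> * (cmod w * cmod x)"
    using abs_Re_le_cmod[of "w * cnj x"] by (intro mult_left_mono) (simp_all add: norm_mult)
  finally have "p * Re (w * cnj x) \<le> \<bar>p\<bar> * (cmod w * cmod x)" .
  moreover have "0 \<le> (?d * cmod x - \<bar>p\<bar> * cmod w)\<^sup>2" by simp
  then have "2 * (\<bar>p\<bar> * (cmod w * cmod x)) * ?d \<le> (?d * (cmod x)\<^sup>2) * ?d + (cmod w)\<^sup>2 * p\<^sup>2"
    by (simp add: power2_eq_square algebra_simps)
  then have "2 * (\<bar>p\<bar> * (cmod w * cmod x)) - ?d * (cmod x)\<^sup>2 \<le> (cmod w)\<^sup>2 * p\<^sup>2 / ?d"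
    using assms by (simp add: pos_le_divide_eq left_diff_distrib)
  ultimately show ?thesis by linarith
qed

text \<open>In the coordinates \<open>z j k\<close> = <v j, X u k> the functional splits into
  separate squares. Parts of \<open>X\<close> outside the two supports enter only the negative
  terms, so Bessel discards them; \<open>supp\<close> ensures that the linear term sees no such
  part.\<close>

lemma vform_le:
  assumes "finite I" "spec I \<rho> K p u" "spec I \<sigma> J q v" "0 \<le> t"
    and supp: "\<And>k x. k \<in> K \<Longrightarrow> x \<in> I \<Longrightarrow> u k x = (\<Sum>j\<in>J. ip I (v j) (u k) * v j x)"
  shows "vform I \<rho> \<sigma> t X \<le> resolvent_form I K p u J q v t"
proof -
  define Xu where "Xu k = (\<lambda>x. \<Sum>y\<in>I. X x y * u k y)" for k
  define z where "z j k = ip I (v j) (Xu k)" for j k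
  have fin: "finite K" "finite J" "ortho I K u" "ortho I J v" "\<And>k. k \<in> K \<Longrightarrow> 0 < p k" "\<And>j. j \<in> J \<Longrightarrow> 0 < q j"
    using assms by (auto simp: spec_def)
  have 1: "ip I (Xu k) (u k) = (\<Sum>j\<in>J. ip I (v j) (u k) * cnj (z j k))" if "k \<in> K" for k
  proof -
    have "ip I (Xu k) (u k) = ip I (Xu k) (\<lambda>x. \<Sum>j\<in>J. ip I (v j) (u k) * v j x)"
      unfolding ip_def[of I "Xu k"] using supp[OF that] by (intro sum.cong) auto
    then show ?thesis unfolding ip_sum_right by (simp add: z_def ip_cnj)
  qed
  have 2: "(\<Sum>k\<in>K. (cmod (z j k))\<^sup>2) \<le> sqn I (\<lambda>y. ip I (v j) (\<lambda>x. X x y))" for j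
  proof -
    have "z j k = (\<Sum>y\<in>I. ip I (v j) (\<lambda>x. X x y) * u k y)" for k
      unfolding z_def Xu_def ip_def sum_distrib_left sum_distrib_right
      by (subst sum.swap) (simp add: mult_ac)
    then have "cmod (z j k) = cmod (ip I (u k) (\<lambda>y. cnj (ip I (v j) (\<lambda>x. X x y))))" for k
      unfolding cmod_ip_commute[of I "u k"] by (simp add: ip_def[of I "\<lambda>y. cnj (ip I (v j) (\<lambda>x. X x y))"])
    moreover have "sqn I (\<lambda>y. cnj (ip I (v j) (\<lambda>x. X x y))) = sqn I (\<lambda>y. ip I (v j) (\<lambda>x. X x y))"
      by (simp add: sqn_def)
    ultimately show ?thesis
      using bessel[OF fin(1,3), of "\<lambda>y. cnj (ip I (v j) (\<lambda>x. X x y))"] by simp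
  qed
  have 3: "(\<Sum>j\<in>J. (cmod (z j k))\<^sup>2) \<le> sqn I (Xu k)" for k
    unfolding z_def by (rule bessel[OF fin(2,4)])
  have "vform I \<rho> \<sigma> t X \<le> 2 * (\<Sum>k\<in>K. \<Sum>j\<in>J. p k * Re (ip I (v j) (u k) * cnj (z j k)))
      - (\<Sum>j\<in>J. q j * (\<Sum>k\<in>K. (cmod (z j k))\<^sup>2)) - t * (\<Sum>k\<in>K. p k * (\<Sum>j\<in>J. (cmod (z j k))\<^sup>2))"
  proof -
    have "Re (\<Sum>k\<in>K. of_real (p k) * ip I (Xu k) (u k)) =
        (\<Sum>k\<in>K. \<Sum>j\<in>J. p k * Re (ip I (v j) (u k) * cnj (z j k)))"
      using 1 by (simp add: sum_distrib_left)
    moreover have "(\<Sum>j\<in>J. q j * (\<Sum>k\<in>K. (cmod (z j k))\<^sup>2)) \<le>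
        (\<Sum>j\<in>J. q j * sqn I (\<lambda>y. ip I (v j) (\<lambda>x. X x y)))"
      using 2 fin by (intro sum_mono mult_left_mono) (auto simp: less_imp_le)
    moreover have "t * (\<Sum>k\<in>K. p k * (\<Sum>j\<in>J. (cmod (z j k))\<^sup>2)) \<le> t * (\<Sum>k\<in>K. p k * sqn I (Xu k))"
      using 3 fin assms(4) by (intro sum_mono mult_left_mono) (auto simp: less_imp_le)
    ultimately show ?thesis
      unfolding vform_spec[OF assms(2,3)] Xu_def[symmetric] by linarith
  qed
  also have "\<dots> = (\<Sum>j\<in>J. \<Sum>k\<in>K. 2 * (p k * Re (ip I (v j) (u k) * cnj (z j k))) - (q j + t * p k) * (cmod (z j k))\<^sup>2)"
  proof -
    have "(\<Sum>k\<in>K. \<Sum>j\<in>J. p k * Re (ip I (v j) (u k) * cnj (z j k))) =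
        (\<Sum>j\<in>J. \<Sum>k\<in>K. p k * Re (ip I (v j) (u k) * cnj (z j k)))" by (rule sum.swap)
    moreover have "(\<Sum>k\<in>K. p k * (\<Sum>j\<in>J. (cmod (z j k))\<^sup>2)) = (\<Sum>j\<in>J. \<Sum>k\<in>K. p k * (cmod (z j k))\<^sup>2)"
      unfolding sum_distrib_left by (rule sum.swap)
    ultimately show ?thesis
      by (simp add: sum_subtractf sum_distrib_left sum.distrib distrib_right mult.assoc)
  qed
  also have "\<dots> \<le> resolvent_form I K p u J q v t"
    unfolding resolvent_form_def
    using fin assms(4) by (intro sum_mono weighted_square_bound add_pos_nonneg) (auto simp: less_imp_le)
  finally show ?thesis .
qed

lemma resolvent_term_identity:
  fixes d p w :: real
  assumes "d \<noteq> 0"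
  shows "2 * (p * (p / d * w)) - d * ((p / d)\<^sup>2 * w) = w * p\<^sup>2 / d"
  using assms by (simp add: power2_eq_square field_simps)

text \<open>The coordinates \<open>c j k\<close> are the optimal points of
  \<open>weighted_square_bound\<close>. Having an actual maximiser lets \<open>rel_ent_mono\<close>
  compare two suprema through a single lifted \<open>X\<close>.\<close>

lemma vform_attained:
  assumes "spec I \<rho> K p u" "spec I \<sigma> J q v" "0 \<le> t"
  shows "\<exists>X. vform I \<rho> \<sigma> t X = resolvent_form I K p u J q v t"
proof -
  have fin: "finite K" "finite J" "ortho I K u" "ortho I J v" "\<And>k. k \<in> K \<Longrightarrow> 0 < p k" "\<And>j. j \<in> J \<Longrightarrow> 0 < q j"
    using assms by (auto simp: spec_def)
  define w where "w j k = ip I (v j) (u k)" for j k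
  define c where "c j k = of_real (p k / (q j + t * p k)) * w j k" for j k
  define X where "X x y = (\<Sum>j\<in>J. \<Sum>k\<in>K. c j k * v j x * cnj (u k y))" for x y
  have X1: "(\<lambda>x. \<Sum>y\<in>I. X x y * u k y) = (\<lambda>x. \<Sum>j\<in>J. c j k * v j x)" if "k \<in> K" for k
  proof
    fix x
    have "(\<Sum>y\<in>I. X x y * u k y) = (\<Sum>j\<in>J. \<Sum>y\<in>I. \<Sum>l\<in>K. c j l * v j x * cnj (u l y) * u k y)"
      unfolding X_def sum_distrib_right by (rule sum.swap)
    also have "\<dots> = (\<Sum>j\<in>J. \<Sum>l\<in>K. \<Sum>y\<in>I. c j l * v j x * cnj (u l y) * u k y)"
      by (intro sum.cong refl sum.swap)
    also have "\<dots> = (\<Sum>j\<in>J. \<Sum>l\<in>K. c j l * v j x * ip I (u l) (u k))"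
      by (simp add: ip_def sum_distrib_left mult_ac)
    also have "\<dots> = (\<Sum>j\<in>J. \<Sum>l\<in>K. if l = k then c j k * v j x else 0)"
      using that by (intro sum.cong) (auto simp: orthoD[OF fin(3)])
    finally show "(\<Sum>y\<in>I. X x y * u k y) = (\<Sum>j\<in>J. c j k * v j x)"
      using that fin by simp
  qed
  have X2: "ip I (v j) (\<lambda>x. X x y) = cnj (\<Sum>k\<in>K. cnj (c j k) * u k y)" if "j \<in> J" for j y
  proof -
    have "(\<lambda>x. X x y) = (\<lambda>x. \<Sum>j\<in>J. (\<Sum>k\<in>K. c j k * cnj (u k y)) * v j x)"
      unfolding X_def by (simp add: sum_distrib_left sum_distrib_right mult_ac)
    then show ?thesis using ip_ortho_sum[OF fin(2,4) that, of "\<lambda>j. \<Sum>k\<in>K. c j k * cnj (u k y)"] by simp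
  qed
  have A: "ip I (\<lambda>x. \<Sum>y\<in>I. X x y * u k y) (u k) = (\<Sum>j\<in>J. cnj (c j k) * w j k)" if "k \<in> K" for k
    unfolding X1[OF that] ip_sum_left w_def ..
  have B: "sqn I (\<lambda>x. \<Sum>y\<in>I. X x y * u k y) = (\<Sum>j\<in>J. (cmod (c j k))\<^sup>2)" if "k \<in> K" for k
    unfolding X1[OF that] by (rule sqn_ortho_sum[OF fin(2,4)])
  have C: "sqn I (\<lambda>y. ip I (v j) (\<lambda>x. X x y)) = (\<Sum>k\<in>K. (cmod (c j k))\<^sup>2)" if "j \<in> J" for j
    unfolding X2[OF that] using sqn_ortho_sum[OF fin(1,3), of "\<lambda>k. cnj (c j k)"]
    by (simp add: sqn_def del: cnj_sum)
  have "vform I \<rho> \<sigma> t X = 2 * (\<Sum>k\<in>K. \<Sum>j\<in>J. p k * Re (cnj (c j k) * w j k))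
      - (\<Sum>j\<in>J. q j * (\<Sum>k\<in>K. (cmod (c j k))\<^sup>2)) - t * (\<Sum>k\<in>K. p k * (\<Sum>j\<in>J. (cmod (c j k))\<^sup>2))"
    unfolding vform_spec[OF assms(1,2)] using A B C by (simp add: sum_distrib_left)
  also have "\<dots> = (\<Sum>j\<in>J. \<Sum>k\<in>K. 2 * (p k * Re (cnj (c j k) * w j k)) - (q j + t * p k) * (cmod (c j k))\<^sup>2)"
  proof -
    have "(\<Sum>k\<in>K. \<Sum>j\<in>J. p k * Re (cnj (c j k) * w j k)) =
        (\<Sum>j\<in>J. \<Sum>k\<in>K. p k * Re (cnj (c j k) * w j k))" by (rule sum.swap)
    moreover have "(\<Sum>k\<in>K. p k * (\<Sum>j\<in>J. (cmod (c j k))\<^sup>2)) = (\<Sum>j\<in>J. \<Sum>k\<in>K. p k * (cmod (c j k))\<^sup>2)"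
      unfolding sum_distrib_left by (rule sum.swap)
    ultimately show ?thesis
      by (simp add: sum_subtractf sum_distrib_left sum.distrib distrib_right mult.assoc)
  qed
  also have "\<dots> = resolvent_form I K p u J q v t"
    unfolding resolvent_form_def
  proof (intro sum.cong refl)
    fix j k assume "j \<in> J" "k \<in> K"
    then have d: "0 < q j + t * p k" using fin assms(3) by (intro add_pos_nonneg) (auto simp: less_imp_le)
    have "cnj (c j k) * w j k = of_real (p k / (q j + t * p k) * (cmod (w j k))\<^sup>2)"
      unfolding c_def of_real_mult complex_norm_square by (simp add: mult_ac)
    then have "Re (cnj (c j k) * w j k) = p k / (q j + t * p k) * (cmod (w j k))\<^sup>2"
      by (simp only: Re_complex_of_real)
    moreover have "(cmod (c j k))\<^sup>2 = (p k / (q j + t * p k))\<^sup>2 * (cmod (w j k))\<^sup>2"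
      by (simp only: c_def norm_mult norm_of_real power_mult_distrib power2_abs)
    ultimately show "2 * (p k * Re (cnj (c j k) * w j k)) - (q j + t * p k) * (cmod (c j k))\<^sup>2 =
        (cmod (ip I (v j) (u k)))\<^sup>2 * (p k)\<^sup>2 / (q j + t * p k)"
      using resolvent_term_identity[of "q j + t * p k" "p k" "(cmod (w j k))\<^sup>2"] d
      by (simp add: w_def[symmetric])
  qed
  finally show ?thesis by blast
qed

lemma log_quotient:
  fixes p q :: real
  assumes "0 < p" "0 < q"
  shows "c * p * ln (q / p) = - (c * p * (ln p - ln q))"
  using assms by (simp add: ln_div algebra_simps)

text \<open>This is tr \<rho> (ln \<rho> - ln \<sigma>), in nats, under the support inclusion that
  the lemmas state as \<open>supp\<close>: then the squared overlaps with each \<open>u k\<close>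
  sum to 1.\<close>

definition rel_ent ::
  "'i set \<Rightarrow> 'k set \<Rightarrow> ('k \<Rightarrow> real) \<Rightarrow> ('k \<Rightarrow> 'i \<Rightarrow> complex) \<Rightarrow> 'j set \<Rightarrow> ('j \<Rightarrow> real) \<Rightarrow> ('j \<Rightarrow> 'i \<Rightarrow> complex) \<Rightarrow> real"
  where "rel_ent I K p u J q v =
    (\<Sum>j\<in>J. \<Sum>k\<in>K. (cmod (ip I (v j) (u k)))\<^sup>2 * p k * (ln (p k) - ln (q j)))"

lemma rel_ent_weights:
  assumes "spec I \<rho> K p u" "spec I \<sigma> J q v"
    and supp: "\<And>k x. k \<in> K \<Longrightarrow> x \<in> I \<Longrightarrow> u k x = (\<Sum>j\<in>J. ip I (v j) (u k) * v j x)"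
  shows "(\<Sum>j\<in>J. \<Sum>k\<in>K. (cmod (ip I (v j) (u k)))\<^sup>2 * f k) = sum f K"
proof -
  have "(\<Sum>j\<in>J. (cmod (ip I (v j) (u k)))\<^sup>2) = 1" if "k \<in> K" for k
    using assms(1,2) that support_weights[of J I v "u k", OF _ _ supp[OF that]]
    by (simp add: spec_def sqn_unit[of I K u])
  then show ?thesis by (subst sum.swap) (simp flip: sum_distrib_right)
qed

text \<open>Monotonicity of relative entropy, reduced to monotonicity of the quadratic forms whose
  integral over \<open>t\<close> it is.\<close>

lemma rel_ent_mono:
  assumes "finite I" "spec I \<rho> K p u" "spec I \<sigma> J q v"
    and supp: "\<And>k x. k \<in> K \<Longrightarrow> x \<in> I \<Longrightarrow> u k x = (\<Sum>j\<in>J. ip I (v j) (u k) * v j x)"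
    and "spec I' \<rho>' K' p' u'" "spec I' \<sigma>' J' q' v'"
    and supp': "\<And>k x. k \<in> K' \<Longrightarrow> x \<in> I' \<Longrightarrow> u' k x = (\<Sum>j\<in>J'. ip I' (v' j) (u' k) * v' j x)"
    and "sum p K = sum p' K'"
    and lift: "\<And>t X'. \<exists>X. vform I \<rho> \<sigma> t X = vform I' \<rho>' \<sigma>' t X'"
  shows "rel_ent I' K' p' u' J' q' v' \<le> rel_ent I K p u J q v"
proof -
  have fin: "finite K" "finite J" "\<And>k. k \<in> K \<Longrightarrow> 0 < p k" "\<And>j. j \<in> J \<Longrightarrow> 0 < q j"
    and fin': "finite K'" "finite J'" "\<And>k. k \<in> K' \<Longrightarrow> 0 < p' k" "\<And>j. j \<in> J' \<Longrightarrow> 0 < q' j"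
    using assms by (auto simp: spec_def)
  \<comment> \<open>The nodes \<open>x\<close> are the ratios q / p. With them a / (x + t) is a
    summand of \<open>resolvent_form\<close>, and a times - ln x is a summand of
    \<open>rel_ent\<close>.\<close>
  define a x where "a jk = (cmod (ip I (v (fst jk)) (u (snd jk))))\<^sup>2 * p (snd jk)"
    and "x jk = q (fst jk) / p (snd jk)" for jk
  define a' x' where "a' jk = (cmod (ip I' (v' (fst jk)) (u' (snd jk))))\<^sup>2 * p' (snd jk)"
    and "x' jk = q' (fst jk) / p' (snd jk)" for jk
  have F: "(\<Sum>jk\<in>J\<times>K. a jk / (x jk + t)) = resolvent_form I K p u J q v t" for t
    unfolding resolvent_form_def sum.cartesian_product
    using fin(3) by (intro sum.cong refl) (force simp: a_def x_def field_simps power2_eq_square)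
  have F': "(\<Sum>jk\<in>J'\<times>K'. a' jk / (x' jk + t)) = resolvent_form I' K' p' u' J' q' v' t" for t
    unfolding resolvent_form_def sum.cartesian_product
    using fin'(3) by (intro sum.cong refl) (force simp: a'_def x'_def field_simps power2_eq_square)
  have "sum a (J\<times>K) = sum p K"
    using rel_ent_weights[OF assms(2,3) supp, of p] by (simp add: a_def sum_Times)
  moreover have "sum a' (J'\<times>K') = sum p' K'"
    using rel_ent_weights[OF assms(5,6) supp', of p'] by (simp add: a'_def sum_Times)
  moreover have "resolvent_form I' K' p' u' J' q' v' t \<le> resolvent_form I K p u J q v t" if "0 < t" for t
  proof -
    obtain X' where "vform I' \<rho>' \<sigma>' t X' = resolvent_form I' K' p' u' J' q' v' t"
      using vform_attained[OF assms(5,6)] \<open>0 < t\<close> by fastforce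
    moreover obtain X where "vform I \<rho> \<sigma> t X = vform I' \<rho>' \<sigma>' t X'" using lift by blast
    ultimately show ?thesis
      using vform_le[OF assms(1-3) _ supp, of t X] \<open>0 < t\<close> by simp
  qed
  moreover have "\<forall>jk\<in>J\<times>K. 0 < x jk" "\<forall>jk\<in>J'\<times>K'. 0 < x' jk"
    using fin fin' by (auto simp: x_def x'_def)
  ultimately have "(\<Sum>jk\<in>J'\<times>K'. a' jk * - ln (x' jk)) \<le> (\<Sum>jk\<in>J\<times>K. a jk * - ln (x jk))"
    using fin fin' assms(8) by (intro log_from_resolvent) (simp_all add: F F')
  moreover have "(\<Sum>jk\<in>J\<times>K. a jk * - ln (x jk)) = rel_ent I K p u J q v"
    unfolding rel_ent_def sum.cartesian_product
    using fin by (intro sum.cong refl) (auto simp: a_def x_def log_quotient)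
  moreover have "(\<Sum>jk\<in>J'\<times>K'. a' jk * - ln (x' jk)) = rel_ent I' K' p' u' J' q' v'"
    unfolding rel_ent_def sum.cartesian_product
    using fin' by (intro sum.cong refl) (auto simp: a'_def x'_def log_quotient)
  ultimately show ?thesis by simp
qed

section \<open>Conditional entropy as relative entropy to the marginal\<close>

definition ptr1 :: "'b set \<Rightarrow> ('b \<times> 'c \<Rightarrow> 'b \<times> 'c \<Rightarrow> complex) \<Rightarrow> 'c \<Rightarrow> 'c \<Rightarrow> complex" where
  "ptr1 B \<rho> = (\<lambda>c c'. \<Sum>b\<in>B. \<rho> (b, c) (b, c'))"

text \<open>The reference operator 1 \<otimes> m. The identity is left unnormalised, so that the
  relative entropy to 1 \<otimes> \<rho>_C is exactly S(C) - S(BC), without a term in the dimension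
  of B.\<close>

definition one_tens :: "('c \<Rightarrow> 'c \<Rightarrow> complex) \<Rightarrow> 'b \<times> 'c \<Rightarrow> 'b \<times> 'c \<Rightarrow> complex" where
  "one_tens m = (\<lambda>(b, c) (b', c'). if b = b' then m c c' else 0)"

text \<open>The product of the basis vector \<open>b\<close> with \<open>v j\<close>; these vectors
  diagonalise \<open>one_tens\<close>.\<close>

definition slice_vec :: "('j \<Rightarrow> 'c \<Rightarrow> complex) \<Rightarrow> 'b \<times> 'j \<Rightarrow> 'b \<times> 'c \<Rightarrow> complex" where
  "slice_vec v = (\<lambda>(b, j) (b', c). if b' = b then v j c else 0)"

lemma ip_product: "ip (B \<times> C) z w = (\<Sum>b\<in>B. ip C (\<lambda>c. z (b, c)) (\<lambda>c. w (b, c)))"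
  by (simp add: ip_def sum.cartesian_product)

lemma ip_slice_vec:
  assumes "finite B" "b \<in> B"
  shows "ip (B \<times> C) (slice_vec v (b, j)) w = ip C (v j) (\<lambda>c. w (b, c))"
proof -
  have "ip (B \<times> C) (slice_vec v (b, j)) w = (\<Sum>b'\<in>B. if b' = b then ip C (v j) (\<lambda>c. w (b, c)) else 0)"
    unfolding ip_product by (intro sum.cong) (auto simp: slice_vec_def ip_def)
  then show ?thesis using assms by simp
qed

lemma ip_slice_vec_slice_vec:
  "ip C w (\<lambda>c. slice_vec v (b', j) (b, c)) = (if b = b' then ip C w (v j) else 0)"
  by (simp add: slice_vec_def ip_def)

lemma spec_one_tens:
  assumes "finite B" "spec C m J q v"
  shows "spec (B \<times> C) (one_tens m) (B \<times> J) (\<lambda>bj. q (snd bj)) (slice_vec v)"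
  unfolding spec_def
proof (intro conjI ballI)
  show "ortho (B \<times> C) (B \<times> J) (slice_vec v)"
    using assms by (auto simp: ortho_def ip_slice_vec ip_slice_vec_slice_vec spec_def)
  fix x y assume xy: "x \<in> B \<times> C" "y \<in> B \<times> C"
  then obtain b c b' c' where e: "x = (b, c)" "y = (b', c')" "b \<in> B" "c \<in> C" "b' \<in> B" "c' \<in> C" by auto
  have "(\<Sum>k\<in>B\<times>J. of_real (q (snd k)) * slice_vec v k x * cnj (slice_vec v k y)) =
      (\<Sum>i\<in>B. \<Sum>j\<in>J. of_real (q j) * slice_vec v (i, j) x * cnj (slice_vec v (i, j) y))"
    by (simp add: sum.cartesian_product case_prod_unfold)
  also have "\<dots> = (\<Sum>i\<in>B. if i = b then one_tens m x y else 0)"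
    using assms e by (intro sum.cong) (auto simp: slice_vec_def one_tens_def spec_def)
  finally show "one_tens m x y = (\<Sum>k\<in>B\<times>J. of_real (q (snd k)) * slice_vec v k x * cnj (slice_vec v k y))"
    using assms e by simp
qed (use assms in \<open>auto simp: spec_def\<close>)

text \<open>The marginal tested on \<open>z\<close> is the sum over \<open>b\<close> of \<rho>
  tested on e_b \<otimes> z.\<close>

lemma quad_ptr1:
  assumes "finite B" "finite C" "spec (B \<times> C) \<rho> K p u"
  shows "quad C (ptr1 B \<rho>) z = of_real (\<Sum>b\<in>B. \<Sum>k\<in>K. p k * (cmod (ip C z (\<lambda>c. u k (b, c))))\<^sup>2)"
proof -
  have "quad C (ptr1 B \<rho>) z = (\<Sum>c\<in>C. \<Sum>b\<in>B. \<Sum>c'\<in>C. cnj (z c) * \<rho> (b, c) (b, c') * z c')"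
    unfolding quad_def ptr1_def sum_distrib_left sum_distrib_right
    by (intro sum.cong refl sum.swap)
  also have "\<dots> = (\<Sum>b\<in>B. quad C (\<lambda>c c'. \<rho> (b, c) (b, c')) z)"
    unfolding quad_def by (rule sum.swap)
  also have "\<dots> = (\<Sum>b\<in>B. quad (B \<times> C) \<rho> (\<lambda>(b', c). if b' = b then z c else 0))"
  proof (intro sum.cong refl)
    fix b assume b: "b \<in> B"
    have "quad (B \<times> C) \<rho> (\<lambda>(b', c). if b' = b then z c else 0) =
        (\<Sum>i\<in>B. \<Sum>c\<in>C. \<Sum>i'\<in>B. \<Sum>c'\<in>C. if i' = b then (if i = b then cnj (z c) * \<rho> (i, c) (i', c') * z c' else 0) else 0)"
      unfolding quad_def sum_Times by (intro sum.cong refl) auto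
    also have "\<dots> = (\<Sum>i\<in>B. if i = b then quad C (\<lambda>c c'. \<rho> (b, c) (b, c')) z else 0)"
    proof (intro sum.cong refl)
      fix i assume "i \<in> B"
      have "(\<Sum>i'\<in>B. \<Sum>c'\<in>C. if i' = b then f c' i' else 0) = (\<Sum>c'\<in>C. f c' b)" for f :: "_ \<Rightarrow> _ \<Rightarrow> complex"
      proof -
        have "(\<Sum>i'\<in>B. \<Sum>c'\<in>C. if i' = b then f c' i' else 0) = (\<Sum>i'\<in>B. if i' = b then \<Sum>c'\<in>C. f c' b else 0)"
          by (intro sum.cong) auto
        then show ?thesis using b assms(1) by simp
      qed
      then show "(\<Sum>c\<in>C. \<Sum>i'\<in>B. \<Sum>c'\<in>C. if i' = b then (if i = b then cnj (z c) * \<rho> (i, c) (i', c') * z c' else 0) else 0)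
        = (if i = b then quad C (\<lambda>c c'. \<rho> (b, c) (b, c')) z else 0)"
        by (simp add: quad_def)
    qed
    finally show "quad C (\<lambda>c c'. \<rho> (b, c) (b, c')) z = quad (B \<times> C) \<rho> (\<lambda>(b', c). if b' = b then z c else 0)"
      using b assms(1) by simp
  qed
  also have "\<dots> = of_real (\<Sum>b\<in>B. \<Sum>k\<in>K. p k * (cmod (ip C z (\<lambda>c. u k (b, c))))\<^sup>2)"
    unfolding of_real_sum[of _ B]
  proof (intro sum.cong refl)
    fix b assume b: "b \<in> B"
    have "ip (B \<times> C) (\<lambda>(b', c). if b' = b then z c else 0) (u k) = ip C z (\<lambda>c. u k (b, c))" for k
      using ip_slice_vec[OF assms(1) b, of C "\<lambda>_. z" undefined "u k"] by (simp add: slice_vec_def)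
    then show "quad (B \<times> C) \<rho> (\<lambda>(b', c). if b' = b then z c else 0) =
        of_real (\<Sum>k\<in>K. p k * (cmod (ip C z (\<lambda>c. u k (b, c))))\<^sup>2)"
      by (simp add: spec_quadratic[OF assms(3)] cmod_ip_commute[of _ "u _"])
  qed
  finally show ?thesis .
qed

lemma quad_one_tens:
  assumes "finite B"
  shows "quad (B \<times> C) (one_tens m) z = (\<Sum>b\<in>B. quad C m (\<lambda>c. z (b, c)))"
proof -
  have "quad (B \<times> C) (one_tens m) z =
      (\<Sum>b\<in>B. \<Sum>c\<in>C. \<Sum>b'\<in>B. \<Sum>c'\<in>C. cnj (z (b, c)) * one_tens m (b, c) (b', c') * z (b', c'))"
    unfolding quad_def sum_Times ..
  also have "\<dots> = (\<Sum>b\<in>B. \<Sum>c\<in>C. \<Sum>b'\<in>B. if b' = b then \<Sum>c'\<in>C. cnj (z (b, c)) * m c c' * z (b, c') else 0)"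
    by (intro sum.cong refl) (auto simp: one_tens_def)
  finally show ?thesis using assms by (simp add: quad_def)
qed

text \<open>Cauchy-Schwarz over the |B| blocks of each eigenvector. This operator inequality \<rho>
  \<le> |B| (1 \<otimes> \<rho>_C) yields both the support inclusion and the lower bound on
  conditional entropy by the dimension of B.\<close>

lemma quad_le_one_tens:
  assumes "finite B" "finite C" "spec (B \<times> C) \<rho> K p u"
  shows "Re (quad (B \<times> C) \<rho> z) \<le> card B * Re (quad (B \<times> C) (one_tens (ptr1 B \<rho>)) z)"
proof -
  have p: "k \<in> K \<Longrightarrow> 0 \<le> p k" for k using assms(3) by (auto simp: spec_def less_imp_le)
  define g where "g b b' k = (cmod (ip C (\<lambda>c. z (b, c)) (\<lambda>c. u k (b', c))))\<^sup>2" for b b' k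
  have "(cmod (ip (B \<times> C) (u k) z))\<^sup>2 \<le> card B * (\<Sum>b\<in>B. \<Sum>b'\<in>B. g b b' k)" for k
  proof -
    have "cmod (ip (B \<times> C) (u k) z) \<le> (\<Sum>b\<in>B. cmod (ip C (\<lambda>c. z (b, c)) (\<lambda>c. u k (b, c))))"
      by (subst cmod_ip_commute, subst ip_product) (rule norm_sum)
    then have "(cmod (ip (B \<times> C) (u k) z))\<^sup>2 \<le> (\<Sum>b\<in>B. \<bar>1\<bar> * \<bar>cmod (ip C (\<lambda>c. z (b, c)) (\<lambda>c. u k (b, c)))\<bar>)\<^sup>2"
      by (simp add: power_mono)
    also have "\<dots> \<le> (\<Sum>b\<in>B. 1\<^sup>2) * (\<Sum>b\<in>B. g b b k)"
    proof -
      let ?a = "\<lambda>b. cmod (ip C (\<lambda>c. z (b, c)) (\<lambda>c. u k (b, c)))"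
      have "(\<Sum>b\<in>B. \<bar>1\<bar> * \<bar>?a b\<bar>)\<^sup>2 \<le> (L2_set (\<lambda>_. 1) B * L2_set ?a B)\<^sup>2"
        by (intro power_mono L2_set_mult_ineq sum_nonneg) simp
      then show ?thesis
        by (simp add: L2_set_def power_mult_distrib sum_nonneg g_def)
    qed
    \<comment> \<open>Adding the terms with \<open>b'\<close> different from \<open>b\<close> only
      increases the sum, and it completes the marginal: every block of \<open>z\<close> meets every
      block of \<open>u k\<close>.\<close>
    also have "\<dots> \<le> card B * (\<Sum>b\<in>B. \<Sum>b'\<in>B. g b b' k)"
      using assms(1) by (auto intro!: mult_left_mono sum_mono member_le_sum simp: g_def)
    finally show ?thesis .
  qed
  then have "(\<Sum>k\<in>K. p k * (cmod (ip (B \<times> C) (u k) z))\<^sup>2) \<le> (\<Sum>k\<in>K. p k * (card B * (\<Sum>b\<in>B. \<Sum>b'\<in>B. g b b' k)))"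
    by (intro sum_mono mult_left_mono p)
  also have "\<dots> = card B * (\<Sum>b\<in>B. \<Sum>b'\<in>B. \<Sum>k\<in>K. p k * g b b' k)"
  proof -
    have "(\<Sum>k\<in>K. p k * (\<Sum>b\<in>B. \<Sum>b'\<in>B. g b b' k)) = (\<Sum>b\<in>B. \<Sum>k\<in>K. \<Sum>b'\<in>B. p k * g b b' k)"
      unfolding sum_distrib_left by (rule sum.swap)
    also have "\<dots> = (\<Sum>b\<in>B. \<Sum>b'\<in>B. \<Sum>k\<in>K. p k * g b b' k)"
      by (intro sum.cong refl sum.swap)
    moreover have "(\<Sum>k\<in>K. p k * (card B * S k)) = card B * (\<Sum>k\<in>K. p k * S k)" for S :: "_ \<Rightarrow> real"
      by (simp add: sum_distrib_left mult.left_commute)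
    ultimately show ?thesis by simp
  qed
  finally show ?thesis
    by (simp add: spec_quadratic[OF assms(3)] quad_one_tens[OF assms(1)] quad_ptr1[OF assms] g_def)
qed

text \<open>By \<open>quad_le_one_tens\<close>, 1 \<otimes> \<rho>_C dominates the projector onto
  \<open>u k\<close> times p k / |B|, which is what \<open>spec_support\<close> asks for.\<close>

lemma support_one_tens:
  assumes "finite B" "finite C" "spec (B \<times> C) \<rho> K p u" "spec C (ptr1 B \<rho>) J q v"
    and "k \<in> K" "x \<in> B \<times> C"
  shows "u k x = (\<Sum>bj\<in>B\<times>J. ip (B \<times> C) (slice_vec v bj) (u k) * slice_vec v bj x)"
proof (rule spec_support[OF _ spec_one_tens[OF assms(1,4)] _ _ assms(6)])
  have B: "0 < card B" using assms by (auto simp: card_gt_0_iff)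
  then show "0 < p k / card B" using assms by (auto simp: spec_def)
  fix z
  have "p k * (cmod (ip (B \<times> C) (u k) z))\<^sup>2 \<le> (\<Sum>k\<in>K. p k * (cmod (ip (B \<times> C) (u k) z))\<^sup>2)"
    using assms by (intro member_le_sum) (auto simp: spec_def less_imp_le)
  also have "\<dots> \<le> card B * Re (quad (B \<times> C) (one_tens (ptr1 B \<rho>)) z)"
    using quad_le_one_tens[OF assms(1-3), of z] by (simp add: spec_quadratic[OF assms(3)])
  finally show "p k / card B * (cmod (ip (B \<times> C) z (u k)))\<^sup>2 \<le> Re (quad (B \<times> C) (one_tens (ptr1 B \<rho>)) z)"
    using B by (simp add: cmod_ip_commute[of _ z] field_simps)
qed (use assms in auto)

text \<open>The logarithm of 1 \<otimes> \<rho>_C sees only the marginal, so the cross term is tr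
  \<rho>_C ln \<rho>_C and the result is S(C) - S(BC).\<close>

lemma rel_ent_one_tens:
  assumes "finite B" "finite C" "spec (B \<times> C) \<rho> K p u" "spec C (ptr1 B \<rho>) J q v"
  shows "rel_ent (B \<times> C) K p u (B \<times> J) (\<lambda>bj. q (snd bj)) (slice_vec v) =
    (\<Sum>k\<in>K. p k * ln (p k)) - (\<Sum>j\<in>J. q j * ln (q j))"
proof -
  let ?w = "\<lambda>bj k. (cmod (ip (B \<times> C) (slice_vec v bj) (u k)))\<^sup>2"
  have fJ: "finite J" "ortho C J v" using assms by (auto simp: spec_def)
  have "rel_ent (B \<times> C) K p u (B \<times> J) (\<lambda>bj. q (snd bj)) (slice_vec v) =
      (\<Sum>bj\<in>B\<times>J. \<Sum>k\<in>K. ?w bj k * (p k * ln (p k))) - (\<Sum>bj\<in>B\<times>J. \<Sum>k\<in>K. ?w bj k * p k * ln (q (snd bj)))"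
    by (simp add: rel_ent_def right_diff_distrib sum_subtractf mult.assoc)
  also have "(\<Sum>bj\<in>B\<times>J. \<Sum>k\<in>K. ?w bj k * (p k * ln (p k))) = (\<Sum>k\<in>K. p k * ln (p k))"
    by (rule rel_ent_weights[OF assms(3) spec_one_tens[OF assms(1,4)] support_one_tens[OF assms]])
  also have "(\<Sum>bj\<in>B\<times>J. \<Sum>k\<in>K. ?w bj k * p k * ln (q (snd bj))) = (\<Sum>j\<in>J. q j * ln (q j))"
  proof -
    have "(\<Sum>bj\<in>B\<times>J. \<Sum>k\<in>K. ?w bj k * p k * ln (q (snd bj))) =
        (\<Sum>b\<in>B. \<Sum>j\<in>J. (\<Sum>k\<in>K. p k * (cmod (ip C (v j) (\<lambda>c. u k (b, c))))\<^sup>2) * ln (q j))"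
      unfolding sum_Times
      using assms(1) by (intro sum.cong refl) (auto simp: ip_slice_vec sum_distrib_right sum_distrib_left mult_ac)
    also have "\<dots> = (\<Sum>j\<in>J. (\<Sum>b\<in>B. \<Sum>k\<in>K. p k * (cmod (ip C (v j) (\<lambda>c. u k (b, c))))\<^sup>2) * ln (q j))"
      unfolding sum_distrib_right by (rule sum.swap)
    also have "\<dots> = (\<Sum>j\<in>J. q j * ln (q j))"
    proof (intro sum.cong refl)
      fix j assume j: "j \<in> J"
      \<comment> \<open>The total weight on \<open>v j\<close> is the expectation of the marginal in
        its own eigenvector, hence \<open>q j\<close>.\<close>
      have "complex_of_real (\<Sum>b\<in>B. \<Sum>k\<in>K. p k * (cmod (ip C (v j) (\<lambda>c. u k (b, c))))\<^sup>2) =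
          of_real (\<Sum>i\<in>J. q i * (cmod (ip C (v i) (v j)))\<^sup>2)"
        unfolding quad_ptr1[OF assms(1-3), symmetric] by (rule spec_quadratic[OF assms(4)])
      also have "(\<Sum>i\<in>J. q i * (cmod (ip C (v i) (v j)))\<^sup>2) = (\<Sum>i\<in>J. if i = j then q j else 0)"
        using j by (intro sum.cong) (auto simp: orthoD[OF fJ(2)])
      also have "\<dots> = q j" using j fJ by simp
      finally show "(\<Sum>b\<in>B. \<Sum>k\<in>K. p k * (cmod (ip C (v j) (\<lambda>c. u k (b, c))))\<^sup>2) * ln (q j) = q j * ln (q j)"
        by (simp only: of_real_eq_iff)
    qed
    finally show ?thesis .
  qed
  finally show ?thesis .
qed

section \<open>Spectral theorem\<close>

definition herm :: "'i set \<Rightarrow> ('i \<Rightarrow> 'i \<Rightarrow> complex) \<Rightarrow> bool" where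
  "herm I \<rho> \<longleftrightarrow> (\<forall>x\<in>I. \<forall>y\<in>I. cnj (\<rho> x y) = \<rho> y x)"

lemma hermD: "herm I \<rho> \<Longrightarrow> x \<in> I \<Longrightarrow> y \<in> I \<Longrightarrow> cnj (\<rho> x y) = \<rho> y x"
  by (simp add: herm_def)

definition app :: "'i set \<Rightarrow> ('i \<Rightarrow> 'i \<Rightarrow> complex) \<Rightarrow> ('i \<Rightarrow> complex) \<Rightarrow> 'i \<Rightarrow> complex" where
  "app I \<rho> v x = (\<Sum>y\<in>I. \<rho> x y * v y)"

lemma ip_app_herm:
  assumes "herm I \<rho>"
  shows "ip I (app I \<rho> u) v = ip I u (app I \<rho> v)"
proof -
  have "ip I (app I \<rho> u) v = (\<Sum>x\<in>I. \<Sum>y\<in>I. cnj (u y) * (\<rho> y x * v x))"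
    unfolding ip_def app_def cnj_sum sum_distrib_right
    by (intro sum.cong refl) (simp add: hermD[OF assms] mult_ac)
  also have "\<dots> = ip I u (app I \<rho> v)"
    unfolding ip_def app_def sum_distrib_left by (rule sum.swap)
  finally show ?thesis .
qed

lemma ip_scale_right: "ip I u (\<lambda>x. c * v x) = c * ip I u v"
  by (simp add: ip_def sum_distrib_left mult_ac)

lemma ip_scale_left: "ip I (\<lambda>x. c * u x) v = cnj c * ip I u v"
  by (simp add: ip_def sum_distrib_left mult_ac)

lemma ip_cong: "(\<And>x. x \<in> I \<Longrightarrow> u x = u' x) \<Longrightarrow> (\<And>x. x \<in> I \<Longrightarrow> v x = v' x) \<Longrightarrow> ip I u v = ip I u' v'"
  unfolding ip_def by (rule sum.cong) auto

lemma trace_mult_commute: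
  fixes A B :: "complex mat"
  assumes "A \<in> carrier_mat n n" "B \<in> carrier_mat n n"
  shows "(\<Sum>i<n. (A * B) $$ (i, i)) = (\<Sum>i<n. (B * A) $$ (i, i))"
proof -
  have "(\<Sum>i<n. (A * B) $$ (i, i)) = (\<Sum>i<n. \<Sum>j<n. A $$ (i, j) * B $$ (j, i))"
    using assms by (intro sum.cong) (auto simp: scalar_prod_def atLeast0LessThan)
  also have "\<dots> = (\<Sum>j<n. \<Sum>i<n. B $$ (j, i) * A $$ (i, j))"
    by (subst sum.swap) (simp add: mult.commute)
  also have "\<dots> = (\<Sum>i<n. (B * A) $$ (i, i))"
    using assms by (intro sum.cong) (auto simp: scalar_prod_def atLeast0LessThan)
  finally show ?thesis .
qed

text \<open>Schur triangularisation is a similarity, hence keeps the trace, and the diagonal of the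
  triangular matrix is the list \<open>as\<close>.\<close>

lemma trace_eq_eigenvalue_sum:
  fixes A :: "complex mat"
  assumes A: "A \<in> carrier_mat n n" and cp: "char_poly A = (\<Prod>a\<leftarrow>as. [:- a, 1:])"
  shows "(\<Sum>i<n. A $$ (i, i)) = sum_list as"
proof -
  obtain B P Q where BPQ: "schur_decomposition A as = (B, P, Q)" by (metis prod_cases3)
  from schur_decomposition[OF A cp BPQ] have sim: "similar_mat_wit A B P Q" and d: "diag_mat B = as" by auto
  note w = similar_mat_witD2[OF A sim]
  have "(\<Sum>i<n. A $$ (i, i)) = (\<Sum>i<n. (P * (B * Q)) $$ (i, i))"
    unfolding w(3) assoc_mult_mat[OF w(6) w(5) w(7)] ..
  also have "\<dots> = (\<Sum>i<n. (B * Q * P) $$ (i, i))"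
    using w by (intro trace_mult_commute) auto
  also have "B * Q * P = B"
    unfolding assoc_mult_mat[OF w(5) w(7) w(6)] w(2) by (rule right_mult_one_mat[OF w(5)])
  also have "(\<Sum>i<n. B $$ (i, i)) = sum_list as"
    using w(5) by (simp add: d[symmetric] diag_mat_def interv_sum_list_conv_sum_set_nat atLeast0LessThan)
  finally show ?thesis .
qed

text \<open>Shifting the known eigenvectors to a common eigenvalue \<open>s\<close>, chosen so that the trace differs
  from \<open>n s\<close>, leaves some eigenvalue different from \<open>s\<close>; its eigenvector is orthogonal to the
  known ones.\<close>

lemma next_eigenvector:
  fixes \<rho> :: "nat \<Rightarrow> nat \<Rightarrow> complex" and d :: "nat \<Rightarrow> real"
  assumes h: "herm {..<n} \<rho>" and "m < n" and u: "ortho {..<n} {..<m} u"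
    and ev: "\<And>k x. k < m \<Longrightarrow> x < n \<Longrightarrow> app {..<n} \<rho> (u k) x = of_real (d k) * u k x"
  shows "\<exists>(e::real) v. sqn {..<n} v = 1 \<and> (\<forall>k<m. ip {..<n} (u k) v = 0) \<and>
    (\<forall>x<n. app {..<n} \<rho> v x = of_real e * v x)"
proof -
  let ?I = "{..<n}"
  define c where "c = (\<Sum>x<n. Re (\<rho> x x)) - (\<Sum>k<m. d k)"
  \<comment> \<open>The shifted matrix \<open>M\<close> has trace c + m s. If all n eigenvalues were
    s, the trace would be n s, forcing s = c / (n - m); the added 1 excludes this.\<close>
  define s where "s = c / (real n - real m) + 1"
  define M where "M x y = \<rho> x y - (\<Sum>k<m. of_real (d k - s) * u k x * cnj (u k y))" for x y
  define A where "A = mat n n (\<lambda>(x, y). M x y)"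
  have A: "A \<in> carrier_mat n n" by (simp add: A_def)
  have real_diag: "\<rho> x x = of_real (Re (\<rho> x x))" if "x < n" for x
    using hermD[OF h, of x x] that by (simp add: complex_eq_iff)
  have trA: "(\<Sum>i<n. A $$ (i, i)) = of_real (c + real m * s)"
  proof -
    have "(\<Sum>i<n. A $$ (i, i)) = (\<Sum>x<n. \<rho> x x) - (\<Sum>x<n. \<Sum>k<m. of_real (d k - s) * (cnj (u k x) * u k x))"
      by (simp add: A_def M_def sum_subtractf mult_ac)
    also have "(\<Sum>x<n. \<Sum>k<m. of_real (d k - s) * (cnj (u k x) * u k x)) = (\<Sum>k<m. of_real (d k - s) * ip ?I (u k) (u k))"
      by (subst sum.swap) (simp add: ip_def sum_distrib_left)
    also have "\<dots> = (\<Sum>k<m. of_real (d k - s))"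
      using u by (intro sum.cong) (auto simp: orthoD)
    also have "(\<Sum>x<n. \<rho> x x) = of_real (\<Sum>x<n. Re (\<rho> x x))"
      unfolding of_real_sum using real_diag by (intro sum.cong) auto
    finally show ?thesis by (simp add: c_def sum_subtractf)
  qed
  obtain as where as: "char_poly A = (\<Prod>a\<leftarrow>as. [:- a, 1:])" "length as = n"
    using char_poly_factorized[OF A] by blast
  have "\<exists>e\<in>set as. e \<noteq> of_real s"
  proof (rule ccontr)
    assume "\<not> ?thesis"
    then have "as = replicate n (of_real s)"
      using as(2) by (auto intro: replicate_eqI)
    then have "complex_of_real (c + real m * s) = of_real (real n * s)"
      using trace_eq_eigenvalue_sum[OF A as(1)] trA by (simp add: sum_list_replicate)
    then have "c = (real n - real m) * s" by (simp only: of_real_eq_iff) (simp add: left_diff_distrib)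
    also have "\<dots> = c + (real n - real m)"
      using \<open>m < n\<close> by (simp add: s_def distrib_left)
    finally show False using \<open>m < n\<close> by simp
  qed
  then obtain e where e: "e \<in> set as" "e \<noteq> of_real s" by blast
  have "poly (char_poly A) e = 0"
    unfolding as(1) poly_prod_list using e(1) by (auto simp: prod_list_zero_iff image_iff)
  then obtain w where w: "eigenvector A w e"
    using eigenvalue_root_char_poly[OF A] by (auto simp: eigenvalue_def)
  then have wc: "w \<in> carrier_vec n" "w \<noteq> 0\<^sub>v n" "A *\<^sub>v w = e \<cdot>\<^sub>v w"
    using A by (auto simp: eigenvector_def)
  define z where "z x = w $ x" for x
  have Mz: "app ?I M z x = e * z x" if "x < n" for x
  proof -
    have "(A *\<^sub>v w) $ x = (\<Sum>y<n. M x y * z y)"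
      using wc(1) that by (simp add: A_def scalar_prod_def z_def atLeast0LessThan)
    then show ?thesis using wc that by (simp add: app_def z_def)
  qed
  have Mz': "app ?I M z x = app ?I \<rho> z x - (\<Sum>k<m. (of_real (d k - s) * ip ?I (u k) z) * u k x)" for x
  proof -
    have "(\<Sum>y<n. \<Sum>k<m. of_real (d k - s) * u k x * cnj (u k y) * z y) =
        (\<Sum>k<m. (of_real (d k - s) * ip ?I (u k) z) * u k x)"
      by (subst sum.swap) (simp add: ip_def sum_distrib_left sum_distrib_right mult_ac)
    then show ?thesis by (simp add: app_def M_def left_diff_distrib sum_subtractf sum_distrib_right)
  qed
  have orth: "ip ?I (u k) z = 0" if "k < m" for k
  proof -
    \<comment> \<open>\<open>M\<close> has eigenvalue \<open>s\<close> on every \<open>u k\<close>,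
      so (e - s) times the overlap must vanish.\<close>
    have "e * ip ?I (u k) z = ip ?I (u k) (app ?I M z)"
      unfolding ip_scale_right[symmetric] using Mz by (intro ip_cong) auto
    also have "\<dots> = ip ?I (u k) (app ?I \<rho> z) - of_real (d k - s) * ip ?I (u k) z"
      unfolding Mz' ip_diff_right using ip_ortho_sum[OF _ u, of k] that by simp
    also have "ip ?I (u k) (app ?I \<rho> z) = ip ?I (\<lambda>x. of_real (d k) * u k x) z"
      unfolding ip_app_herm[OF h, symmetric] using ev[OF that] by (intro ip_cong) auto
    also have "\<dots> = of_real (d k) * ip ?I (u k) z" by (simp add: ip_scale_left)
    finally have "(e - of_real s) * ip ?I (u k) z = 0" by (simp add: algebra_simps)
    then show ?thesis using e(2) by simp
  qed
  have rz: "app ?I \<rho> z x = e * z x" if "x < n" for x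
    using Mz[OF that] Mz'[of x] orth by simp
  have "sqn ?I z \<noteq> 0"
    using wc(1,2) by (auto simp: sqn_eq_0 z_def intro: eq_vecI)
  then have pos: "0 < sqn ?I z" using sqn_nonneg[of ?I z] by linarith
  have "e * ip ?I z z = ip ?I z (app ?I \<rho> z)"
    unfolding ip_scale_right[symmetric] using rz by (intro ip_cong) auto
  also have "\<dots> = ip ?I (\<lambda>x. e * z x) z"
    unfolding ip_app_herm[OF h, symmetric] using rz by (intro ip_cong) auto
  finally have "e = cnj e" using pos by (simp add: ip_scale_left ip_self)
  then have er: "e = of_real (Re e)" by (simp add: complex_eq_iff)
  define v where "v = (\<lambda>x. of_real (1 / sqrt (sqn ?I z)) * z x)"
  have "sqn ?I v = 1"
  proof -
    have "sqn ?I v = (1 / sqrt (sqn ?I z))\<^sup>2 * sqn ?I z"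
      by (simp only: sqn_def v_def norm_mult norm_of_real power_mult_distrib power2_abs sum_distrib_left)
    then show ?thesis using pos by (simp add: power_divide)
  qed
  moreover have "\<forall>k<m. ip ?I (u k) v = 0" unfolding v_def ip_scale_right by (simp add: orth)
  moreover have "\<forall>x<n. app ?I \<rho> v x = of_real (Re e) * v x"
  proof (intro allI impI)
    fix x assume "x < n"
    have "app ?I \<rho> v x = of_real (1 / sqrt (sqn ?I z)) * app ?I \<rho> z x"
      by (simp add: app_def v_def sum_distrib_left mult_ac)
    then show "app ?I \<rho> v x = of_real (Re e) * v x"
      using rz[OF \<open>x < n\<close>] by (simp add: v_def er[symmetric])
  qed
  ultimately show ?thesis by blast
qed

lemma eigenfamily:
  assumes "herm {..<n} \<rho>" "m \<le> n"
  shows "\<exists>(d::nat \<Rightarrow> real) u. ortho {..<n} {..<m} u \<and>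
    (\<forall>k<m. \<forall>x<n. app {..<n} \<rho> (u k) x = of_real (d k) * u k x)"
  using assms(2)
proof (induction m)
  case 0
  then show ?case by (auto simp: ortho_def)
next
  case (Suc m)
  then obtain d u where u: "ortho {..<n} {..<m} u"
    and ev: "\<And>k x. k < m \<Longrightarrow> x < n \<Longrightarrow> app {..<n} \<rho> (u k) x = of_real (d k) * u k x" by auto
  from next_eigenvector[OF assms(1) _ u ev] Suc.prems obtain e v where
    v: "sqn {..<n} v = 1" "\<forall>k<m. ip {..<n} (u k) v = 0" "\<forall>x<n. app {..<n} \<rho> v x = of_real e * v x"
    by auto
  have v': "ip {..<n} v (u k) = 0" if "k < m" for k
    using v(2) that by (metis ip_cnj complex_cnj_zero)
  have "ip {..<n} v v = 1" using v(1) by (simp add: ip_self)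
  then have "ortho {..<n} {..<Suc m} (u(m := v))"
    using u v(2) v' by (auto simp: ortho_def less_Suc_eq)
  moreover have "\<forall>k<Suc m. \<forall>x<n. app {..<n} \<rho> ((u(m := v)) k) x = of_real ((d(m := e)) k) * (u(m := v)) k x"
    using ev v(3) by (auto simp: less_Suc_eq)
  ultimately show ?case by blast
qed

text \<open>By counting: the Bessel defects of the basis vectors are nonnegative and sum to card I -
  card K = 0. So Bessel is an equality at each basis vector, and its expansion in the
  \<open>u k\<close> is exact.\<close>

lemma ortho_complete:
  assumes "finite I" "finite K" "ortho I K u" "card K = card I" "x \<in> I" "y \<in> I"
  shows "(\<Sum>k\<in>K. u k x * cnj (u k y)) = (if x = y then 1 else 0)"
proof -
  define e where "e z x = (if x = z then 1 else 0 :: complex)" for z x :: 'a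
  have ipe: "ip I (u k) (e z) = cnj (u k z)" if "z \<in> I" for k z
    using assms(1) that by (simp add: ip_def e_def if_distrib cong: if_cong)
  have sqe: "sqn I (e z) = 1" if "z \<in> I" for z
    using assms(1) that by (simp add: sqn_def e_def if_distrib[of "\<lambda>c. (cmod c)\<^sup>2"] cong: if_cong)
  have le: "(\<Sum>k\<in>K. (cmod (u k z))\<^sup>2) \<le> 1" if "z \<in> I" for z
    using bessel[OF assms(2,3), of "e z"] by (simp add: ipe[OF that] sqe[OF that])
  have "(\<Sum>z\<in>I. 1 - (\<Sum>k\<in>K. (cmod (u k z))\<^sup>2)) = real (card I) - (\<Sum>k\<in>K. sqn I (u k))"
    by (simp add: sum_subtractf sqn_def) (rule sum.swap)
  also have "(\<Sum>k\<in>K. sqn I (u k)) = card K"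
    using sqn_unit[OF assms(3)] by simp
  finally have "(\<Sum>z\<in>I. 1 - (\<Sum>k\<in>K. (cmod (u k z))\<^sup>2)) = 0"
    using assms(4) by simp
  then have "\<forall>z\<in>I. 1 - (\<Sum>k\<in>K. (cmod (u k z))\<^sup>2) = 0"
    using assms(1) le by (subst (asm) sum_nonneg_eq_0_iff) auto
  then have "sqn I (\<lambda>x. e y x - (\<Sum>k\<in>K. ip I (u k) (e y) * u k x)) = 0"
    using sqn_bessel_defect[OF assms(2,3), of "e y"] assms(6) by (simp add: ipe sqe)
  then show ?thesis
    using assms by (simp add: sqn_eq_0 ipe e_def mult.commute split: if_splits)
qed

theorem hermitian_diagonalization:
  fixes \<rho> :: "nat \<Rightarrow> nat \<Rightarrow> complex"
  assumes "herm {..<n} \<rho>"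
  obtains d :: "nat \<Rightarrow> real" and u where "ortho {..<n} {..<n} u"
    "\<And>x y. x < n \<Longrightarrow> y < n \<Longrightarrow> \<rho> x y = (\<Sum>k<n. of_real (d k) * u k x * cnj (u k y))"
proof -
  obtain d u where u: "ortho {..<n} {..<n} u"
    and ev: "\<And>k x. k < n \<Longrightarrow> x < n \<Longrightarrow> app {..<n} \<rho> (u k) x = of_real (d k) * u k x"
    using eigenfamily[OF assms, of n] by auto
  show ?thesis
  proof (rule that[OF u])
    fix x y assume xy: "x < n" "y < n"
    have "\<rho> x y = (\<Sum>z<n. \<rho> x z * (\<Sum>k<n. u k z * cnj (u k y)))"
    proof -
      have "(\<Sum>z<n. \<rho> x z * (\<Sum>k<n. u k z * cnj (u k y))) = (\<Sum>z<n. if z = y then \<rho> x y else 0)"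
        using ortho_complete[OF _ _ u refl] xy by (intro sum.cong) auto
      then show ?thesis using xy by simp
    qed
    also have "\<dots> = (\<Sum>k<n. (\<Sum>z<n. \<rho> x z * u k z) * cnj (u k y))"
      unfolding sum_distrib_left sum_distrib_right by (subst sum.swap) (simp add: mult_ac)
    also have "\<dots> = (\<Sum>k<n. of_real (d k) * u k x * cnj (u k y))"
      using ev xy by (simp add: app_def)
    finally show "\<rho> x y = (\<Sum>k<n. of_real (d k) * u k x * cnj (u k y))" .
  qed
qed

text \<open>Ties \<open>trace_fun\<close>, defined through the roots of the characteristic
  polynomial, to any orthonormal diagonalisation: the matrix of eigenvectors is unitary, so
  \<open>A\<close> is similar to the diagonal matrix of the \<open>d k\<close>.\<close>

lemma trace_fun_diagonal:
  assumes A: "A \<in> carrier_mat n n" and u: "ortho {..<n} {..<n} u"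
    and dec: "\<And>x y. x < n \<Longrightarrow> y < n \<Longrightarrow> A $$ (x, y) = (\<Sum>k<n. of_real (d k) * u k x * cnj (u k y))"
  shows "trace_fun f A = (\<Sum>k<n. f (d k))"
proof -
  define U where "U = mat n n (\<lambda>(x, k). u k x)"
  define V where "V = mat n n (\<lambda>(k, x). cnj (u k x))"
  define D where "D = mat n n (\<lambda>(i, j). if i = j then complex_of_real (d i) else 0)"
  have c: "U \<in> carrier_mat n n" "V \<in> carrier_mat n n" "D \<in> carrier_mat n n"
    by (auto simp: U_def V_def D_def)
  have VU: "V * U = 1\<^sub>m n"
    using u by (intro eq_matI) (auto simp: U_def V_def scalar_prod_def atLeast0LessThan ortho_def ip_def)
  have UV: "U * V = 1\<^sub>m n" by (rule mat_mult_left_right_inverse[OF c(2,1) VU])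
  have "U * D * V = A"
  proof (rule eq_matI)
    fix x y assume "x < dim_row A" "y < dim_col A"
    then have xy: "x < n" "y < n" using A by auto
    have UD: "(U * D) $$ (x, k) = u k x * of_real (d k)" if "k < n" for k
      using xy that by (simp add: U_def D_def scalar_prod_def if_distrib cong: if_cong)
    have entry: "(W * V) $$ (x, y) = (\<Sum>k<n. W $$ (x, k) * V $$ (k, y))" if "W \<in> carrier_mat n n" for W
      using that c(2) xy by (simp add: scalar_prod_def atLeast0LessThan)
    have "(U * D * V) $$ (x, y) = (\<Sum>k<n. (U * D) $$ (x, k) * V $$ (k, y))"
      by (rule entry) (use c in simp)
    also have "\<dots> = A $$ (x, y)"
      using UD xy by (simp add: dec V_def mult_ac)
    finally show "(U * D * V) $$ (x, y) = A $$ (x, y)" .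
  qed (use A c in auto)
  then have "similar_mat A D"
    using similar_mat_witI[OF UV VU _ A c(3,1,2)] by (auto simp: similar_mat_def)
  then have "char_poly A = char_poly D" by (rule char_poly_similar)
  also have "\<dots> = (\<Prod>a\<leftarrow>diag_mat D. [:- a, 1:])"
    by (rule char_poly_upper_triangular[OF c(3)]) (auto simp: upper_triangular_def D_def)
  finally have cp: "char_poly A = (\<Prod>a\<leftarrow>diag_mat D. [:- a, 1:])" .
  have roots: "proots (\<Prod>a\<leftarrow>as. [:- a, 1:]) = mset as" for as :: "complex list"
  proof (induction as)
    case (Cons a as)
    have "(\<Prod>a\<leftarrow>as. [:- a, 1:]) \<noteq> 0" by (auto simp: prod_list_zero_iff)
    then show ?case using Cons by (simp add: proots_mult del: mult_pCons_left)
  qed simp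
  have diag: "diag_mat D = map (\<lambda>i. complex_of_real (d i)) [0..<n]"
    by (auto simp: diag_mat_def D_def)
  show ?thesis
    unfolding trace_fun_def cp roots diag by (simp add: multiset.map_comp comp_def sum_unfold_sum_mset atLeast0LessThan)
qed

section \<open>Positive kernels and their entropy\<close>

definition pos :: "'i set \<Rightarrow> ('i \<Rightarrow> 'i \<Rightarrow> complex) \<Rightarrow> bool" where
  "pos I \<rho> \<longleftrightarrow> (\<forall>v. 0 \<le> quad I \<rho> v)"

lemma of_real_nonneg_complex: "0 \<le> complex_of_real r \<longleftrightarrow> 0 \<le> r"
  by (simp add: less_eq_complex_def)

lemma quad_cong:
  "(\<And>x y. x \<in> I \<Longrightarrow> y \<in> I \<Longrightarrow> \<rho> x y = \<sigma> x y) \<Longrightarrow> (\<And>x. x \<in> I \<Longrightarrow> v x = w x) \<Longrightarrow> quad I \<rho> v = quad I \<sigma> w"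
  unfolding quad_def by (intro sum.cong) auto

lemma pos_cong: "(\<And>x y. x \<in> I \<Longrightarrow> y \<in> I \<Longrightarrow> \<rho> x y = \<sigma> x y) \<Longrightarrow> pos I \<rho> = pos I \<sigma>"
  unfolding pos_def using quad_cong[of I \<rho> \<sigma>] by metis

lemma pos_spec_imp: "spec I \<rho> K p u \<Longrightarrow> pos I \<rho>"
  unfolding pos_def spec_quadratic of_real_nonneg_complex by (auto simp: spec_def less_imp_le intro!: sum_nonneg)

lemma pos_zero: "pos I (\<lambda>_ _. 0)"
  by (simp add: pos_def quad_def)

lemma pos_add: "pos I \<rho> \<Longrightarrow> pos I \<sigma> \<Longrightarrow> pos I (\<lambda>x y. \<rho> x y + \<sigma> x y)"
proof -
  have "quad I (\<lambda>x y. \<rho> x y + \<sigma> x y) v = quad I \<rho> v + quad I \<sigma> v" for v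
    by (simp add: quad_def distrib_left distrib_right sum.distrib)
  then show "pos I \<rho> \<Longrightarrow> pos I \<sigma> \<Longrightarrow> pos I (\<lambda>x y. \<rho> x y + \<sigma> x y)"
    by (simp add: pos_def)
qed

lemma pos_sum: "(\<And>i. i \<in> S \<Longrightarrow> pos I (\<rho> i)) \<Longrightarrow> pos I (\<lambda>x y. \<Sum>i\<in>S. \<rho> i x y)"
  by (induction S rule: infinite_finite_induct) (simp_all add: pos_zero pos_add)

lemma pos_sandwich:
  assumes "pos I \<rho>"
  shows "pos J (\<lambda>x y. \<Sum>a\<in>I. \<Sum>b\<in>I. V x a * \<rho> a b * cnj (V y b))"
proof -
  have "quad J (\<lambda>x y. \<Sum>a\<in>I. \<Sum>b\<in>I. V x a * \<rho> a b * cnj (V y b)) v = quad I \<rho> (\<lambda>a. \<Sum>x\<in>J. cnj (V x a) * v x)" for v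
  proof -
    have "quad J (\<lambda>x y. \<Sum>a\<in>I. \<Sum>b\<in>I. V x a * \<rho> a b * cnj (V y b)) v =
        (\<Sum>x\<in>J. \<Sum>y\<in>J. \<Sum>a\<in>I. \<Sum>b\<in>I. (cnj (v x) * V x a) * \<rho> a b * (cnj (V y b) * v y))"
      by (simp add: quad_def sum_distrib_left sum_distrib_right mult_ac)
    also have "\<dots> = (\<Sum>x\<in>J. \<Sum>a\<in>I. \<Sum>y\<in>J. \<Sum>b\<in>I. (cnj (v x) * V x a) * \<rho> a b * (cnj (V y b) * v y))"
      by (intro sum.cong refl sum.swap)
    also have "\<dots> = (\<Sum>a\<in>I. \<Sum>x\<in>J. \<Sum>y\<in>J. \<Sum>b\<in>I. (cnj (v x) * V x a) * \<rho> a b * (cnj (V y b) * v y))"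
      by (rule sum.swap)
    also have "\<dots> = (\<Sum>a\<in>I. \<Sum>x\<in>J. \<Sum>b\<in>I. \<Sum>y\<in>J. (cnj (v x) * V x a) * \<rho> a b * (cnj (V y b) * v y))"
      by (intro sum.cong refl sum.swap)
    also have "\<dots> = (\<Sum>a\<in>I. \<Sum>b\<in>I. \<Sum>x\<in>J. \<Sum>y\<in>J. (cnj (v x) * V x a) * \<rho> a b * (cnj (V y b) * v y))"
      by (intro sum.cong refl sum.swap)
    finally show ?thesis
      by (simp add: quad_def sum_distrib_left sum_distrib_right mult_ac)
  qed
  then show ?thesis using assms by (simp add: pos_def)
qed

text \<open>A sandwich with the 0/1 matrix of \<open>f\<close>. It serves for relabelling, for
  restriction to a block and for fixing one coordinate of a product index.\<close>

lemma pos_pullback: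
  assumes "pos I \<rho>" "finite I" "f ` J \<subseteq> I"
  shows "pos J (\<lambda>x y. \<rho> (f x) (f y))"
proof -
  have "(\<Sum>a\<in>I. \<Sum>b\<in>I. (if a = f x then 1 else 0) * \<rho> a b * cnj (if b = f y then 1 else 0)) = \<rho> (f x) (f y)"
    if "x \<in> J" "y \<in> J" for x y
  proof -
    have "(\<Sum>a\<in>I. \<Sum>b\<in>I. (if a = f x then 1 else 0) * \<rho> a b * cnj (if b = f y then 1 else 0)) =
        (\<Sum>a\<in>I. if a = f x then \<rho> a (f y) else 0)"
      using assms that by (intro sum.cong refl) (auto simp: if_distrib cong: if_cong)
    then show ?thesis using assms that by auto
  qed
  then show ?thesis
    using pos_sandwich[OF assms(1), of J "\<lambda>x a. if a = f x then 1 else 0"] by (subst (asm) pos_cong) auto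
qed

text \<open>Polarisation: the form is real at e_x + e_y and at e_x + i e_y, which matches the
  imaginary and the real parts of the two entries respectively.\<close>

lemma pos_herm:
  assumes "finite I" "pos I \<rho>"
  shows "herm I \<rho>"
  unfolding herm_def
proof (intro ballI)
  fix x y assume xy: "x \<in> I" "y \<in> I"
  have real: "Im (quad I \<rho> v) = 0" for v
    using assms(2) by (auto simp: pos_def less_eq_complex_def)
  have one: "quad I \<rho> (\<lambda>z. if z = x then 1 else 0) = \<rho> x x" if "x \<in> I" for x
  proof -
    have "quad I \<rho> (\<lambda>z. if z = x then 1 else 0) = (\<Sum>a\<in>I. if a = x then \<rho> x x else 0)"
      unfolding quad_def using assms(1) that by (intro sum.cong refl) (auto simp: if_distrib cong: if_cong)
    then show ?thesis using assms(1) that by simp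
  qed
  show "cnj (\<rho> x y) = \<rho> y x"
  proof (cases "x = y")
    case True
    then show ?thesis using real[of "\<lambda>z. if z = x then 1 else 0"] one[OF xy(1)] by (simp add: complex_eq_iff)
  next
    case False
    have two: "quad I \<rho> (\<lambda>z. if z = x then 1 else if z = y then c else 0) =
        \<rho> x x + \<rho> x y * c + cnj c * \<rho> y x + cnj c * \<rho> y y * c" for c
    proof -
      have s: "(\<Sum>a\<in>I. g a) = g x + g y" if "\<And>a. a \<noteq> x \<Longrightarrow> a \<noteq> y \<Longrightarrow> g a = 0" for g :: "_ \<Rightarrow> complex"
      proof -
        have "(\<Sum>a\<in>I. g a) = (\<Sum>a\<in>{x, y}. g a)"
          using assms(1) xy that by (intro sum.mono_neutral_right) auto
        then show ?thesis using False by simp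
      qed
      show ?thesis
        unfolding quad_def by (subst s; simp; (subst s; simp)+; use False in \<open>simp add: algebra_simps\<close>)
    qed
    have "Im (\<rho> x x) = 0" "Im (\<rho> y y) = 0"
      using real[of "\<lambda>z. if z = x then 1 else 0"] real[of "\<lambda>z. if z = y then 1 else 0"] one xy by auto
    then show ?thesis
      using real[of "\<lambda>z. if z = x then 1 else if z = y then 1 else 0"]
        real[of "\<lambda>z. if z = x then 1 else if z = y then \<i> else 0"]
      unfolding two by (simp add: complex_eq_iff)
  qed
qed

text \<open>Outside the image of \<open>f\<close> the kernel is zero, which only adds the eigenvalue
  0, and \<open>spec\<close> does not list that one. So the same \<open>p\<close> serves on the
  larger space.\<close>

lemma spec_transport:
  assumes "spec I \<rho> K p u" "inj_on f I" "finite J" "f ` I \<subseteq> J"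
    and "\<And>a b. a \<in> I \<Longrightarrow> b \<in> I \<Longrightarrow> \<tau> (f a) (f b) = \<rho> a b"
    and "\<And>x y. x \<in> J - f ` I \<Longrightarrow> y \<in> J \<Longrightarrow> \<tau> x y = 0 \<and> \<tau> y x = 0"
  shows "spec J \<tau> K p (\<lambda>k x. if x \<in> f ` I then u k (inv_into I f x) else 0)"
proof -
  let ?u = "\<lambda>k x. if x \<in> f ` I then u k (inv_into I f x) else 0"
  have ip: "ip J (?u k) (?u l) = ip I (u k) (u l)" for k l
  proof -
    have "ip J (?u k) (?u l) = ip (f ` I) (?u k) (?u l)"
      unfolding ip_def using assms(3,4) by (intro sum.mono_neutral_right) auto
    also have "\<dots> = ip I (u k) (u l)"
      unfolding ip_def sum.reindex[OF assms(2)] using assms(2) by (intro sum.cong) auto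
    finally show ?thesis .
  qed
  have "\<tau> x y = (\<Sum>k\<in>K. of_real (p k) * ?u k x * cnj (?u k y))" if "x \<in> J" "y \<in> J" for x y
  proof (cases "x \<in> f ` I \<and> y \<in> f ` I")
    case True
    then obtain a b where "a \<in> I" "b \<in> I" "x = f a" "y = f b" by auto
    then show ?thesis using assms(1,2,5) by (simp add: spec_def)
  next
    case False
    then show ?thesis using assms(6) that by auto
  qed
  then show ?thesis using assms(1) unfolding spec_def ortho_def ip by blast
qed

lemma diagonal_spec:
  fixes \<rho> :: "nat \<Rightarrow> nat \<Rightarrow> complex" and d :: "nat \<Rightarrow> real"
  assumes pos: "pos {..<n} \<rho>" and u: "ortho {..<n} {..<n} u"
    and dec: "\<And>x y. x < n \<Longrightarrow> y < n \<Longrightarrow> \<rho> x y = (\<Sum>k<n. of_real (d k) * u k x * cnj (u k y))"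
  shows "\<And>k. k < n \<Longrightarrow> 0 \<le> d k" and "spec {..<n} \<rho> {k. k < n \<and> 0 < d k} d u"
proof -
  show d: "0 \<le> d k" if k: "k < n" for k
  proof -
    have "quad {..<n} \<rho> (u k) = (\<Sum>x<n. \<Sum>l<n. of_real (d l) * (cnj (u k x) * u l x) * ip {..<n} (u l) (u k))"
    proof -
      have "quad {..<n} \<rho> (u k) = (\<Sum>x<n. \<Sum>y<n. \<Sum>l<n. of_real (d l) * (cnj (u k x) * u l x) * (cnj (u l y) * u k y))"
        unfolding quad_def using dec by (intro sum.cong refl) (auto simp: sum_distrib_left sum_distrib_right mult_ac)
      also have "\<dots> = (\<Sum>x<n. \<Sum>l<n. \<Sum>y<n. of_real (d l) * (cnj (u k x) * u l x) * (cnj (u l y) * u k y))"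
        by (intro sum.cong refl sum.swap)
      finally show ?thesis by (simp add: ip_def sum_distrib_left)
    qed
    also have "\<dots> = (\<Sum>x<n. \<Sum>l<n. if l = k then of_real (d k) * (cnj (u k x) * u k x) else 0)"
      using k u by (intro sum.cong refl) (auto simp: orthoD)
    also have "\<dots> = of_real (d k) * ip {..<n} (u k) (u k)"
      using k by (simp add: ip_def sum_distrib_left)
    also have "\<dots> = of_real (d k)" using k u by (simp add: orthoD)
    finally show ?thesis using pos unfolding pos_def by (metis of_real_nonneg_complex)
  qed
  show "spec {..<n} \<rho> {k. k < n \<and> 0 < d k} d u"
    unfolding spec_def
  proof (intro conjI ballI)
    show "ortho {..<n} {k. k < n \<and> 0 < d k} u" using u by (auto simp: ortho_def)
    fix x y assume "x \<in> {..<n}" "y \<in> {..<n}"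
    then have "\<rho> x y = (\<Sum>k<n. of_real (d k) * u k x * cnj (u k y))" using dec by simp
    also have "\<dots> = (\<Sum>k\<in>{k. k < n \<and> 0 < d k}. of_real (d k) * u k x * cnj (u k y))"
      using d by (intro sum.mono_neutral_right) (auto simp: le_less)
    finally show "\<rho> x y = (\<Sum>k\<in>{k. k < n \<and> 0 < d k}. of_real (d k) * u k x * cnj (u k y))" .
  qed auto
qed

text \<open>An enumeration of \<open>I\<close> reduces the claim to kernels indexed by naturals, and
  \<open>spec_transport\<close> brings the eigenvectors back.\<close>

theorem pos_imp_spec:
  assumes "finite I" "pos I \<rho>"
  shows "\<exists>(K::nat set) p u. spec I \<rho> K p u"
proof -
  obtain h where h: "bij_betw h {..<card I} I"
    using ex_bij_betw_nat_finite[OF assms(1)] by (auto simp: atLeast0LessThan)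
  then have hI: "inj_on h {..<card I}" "h ` {..<card I} = I" by (auto simp: bij_betw_def)
  let ?\<rho> = "\<lambda>x y. \<rho> (h x) (h y)"
  have pos: "pos {..<card I} ?\<rho>" by (rule pos_pullback[OF assms(2,1)]) (simp add: hI)
  obtain d u where u: "ortho {..<card I} {..<card I} u"
    and dec: "\<And>x y. x < card I \<Longrightarrow> y < card I \<Longrightarrow> ?\<rho> x y = (\<Sum>k<card I. of_real (d k) * u k x * cnj (u k y))"
    by (rule hermitian_diagonalization[OF pos_herm[OF finite_lessThan pos]]) blast
  have "spec {..<card I} ?\<rho> {k. k < card I \<and> 0 < d k} d u"
    by (rule diagonal_spec(2)[OF pos u dec])
  from spec_transport[OF this hI(1) assms(1), of \<rho>] hI(2) show ?thesis by blast
qed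

text \<open>Entropy in nats, of possibly unnormalised kernels. By \<open>spec_unique\<close> the
  choice does not matter. The labels are naturals because a definition cannot quantify over types;
  \<open>ent_eq\<close> then admits every label type.\<close>

definition ent :: "'i set \<Rightarrow> ('i \<Rightarrow> 'i \<Rightarrow> complex) \<Rightarrow> real" where
  "ent I \<rho> = (SOME s. \<exists>(K::nat set) p u. spec I \<rho> K p u \<and> s = - (\<Sum>k\<in>K. p k * ln (p k)))"

lemma ent_eq:
  assumes "finite I" "spec I \<rho> K p u"
  shows "ent I \<rho> = - (\<Sum>k\<in>K. p k * ln (p k))"
proof -
  let ?P = "\<lambda>s. \<exists>(K::nat set) p u. spec I \<rho> K p u \<and> s = - (\<Sum>k\<in>K. p k * ln (p k))"
  have "?P (ent I \<rho>)"
    unfolding ent_def using pos_imp_spec[OF assms(1) pos_spec_imp[OF assms(2)]] by (intro someI_ex[of ?P]) blast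
  then obtain J :: "nat set" and q v where "spec I \<rho> J q v" "ent I \<rho> = - (\<Sum>k\<in>J. q k * ln (q k))"
    by blast
  then show ?thesis using spec_unique[OF assms(1) assms(2), of J q v "\<lambda>x. x * ln x"] by simp
qed

lemma spec_cong:
  "(\<And>x y. x \<in> I \<Longrightarrow> y \<in> I \<Longrightarrow> \<rho> x y = \<sigma> x y) \<Longrightarrow> spec I \<rho> K p u = spec I \<sigma> K p u"
  by (auto simp: spec_def)

lemma ent_cong:
  assumes "\<And>x y. x \<in> I \<Longrightarrow> y \<in> I \<Longrightarrow> \<rho> x y = \<sigma> x y"
  shows "ent I \<rho> = ent I \<sigma>"
proof -
  have "spec I \<rho> K p u = spec I \<sigma> K p u" for K :: "nat set" and p u
    by (rule spec_cong[OF assms])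
  then show ?thesis by (simp only: ent_def)
qed

lemma ent_embed:
  assumes "finite I" "pos I \<rho>" "inj_on f I" "finite J" "f ` I \<subseteq> J"
    and "\<And>a b. a \<in> I \<Longrightarrow> b \<in> I \<Longrightarrow> \<tau> (f a) (f b) = \<rho> a b"
    and "\<And>x y. x \<in> J - f ` I \<Longrightarrow> y \<in> J \<Longrightarrow> \<tau> x y = 0 \<and> \<tau> y x = 0"
  shows "ent J \<tau> = ent I \<rho>"
proof -
  obtain K :: "nat set" and p u where s: "spec I \<rho> K p u" using pos_imp_spec[OF assms(1,2)] by blast
  from ent_eq[OF assms(1) s] ent_eq[OF assms(4) spec_transport[OF s assms(3-7)]] show ?thesis by simp
qed

lemma ent_reindex:
  assumes "finite I" "pos I \<rho>" "bij_betw f J I"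
  shows "ent J (\<lambda>x y. \<rho> (f x) (f y)) = ent I \<rho>"
proof -
  have f: "inj_on f J" "f ` J = I" and "finite J"
    using assms bij_betw_finite by (auto simp: bij_betw_def)
  have "ent I \<rho> = ent J (\<lambda>x y. \<rho> (f x) (f y))"
    using f assms \<open>finite J\<close> by (intro ent_embed pos_pullback[OF assms(2,1), of f]) auto
  then show ?thesis by simp
qed

text \<open>The images of the eigenvectors under \<open>V\<close> are orthonormal again and carry
  the same eigenvalues.\<close>

lemma ent_isometry:
  assumes "finite I" "finite J" "pos I \<rho>"
    and V: "\<And>a b. a \<in> I \<Longrightarrow> b \<in> I \<Longrightarrow> (\<Sum>x\<in>J. cnj (V x a) * V x b) = (if a = b then 1 else 0)"
  shows "ent J (\<lambda>x y. \<Sum>a\<in>I. \<Sum>b\<in>I. V x a * \<rho> a b * cnj (V y b)) = ent I \<rho>"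
proof -
  obtain K :: "nat set" and p u where s: "spec I \<rho> K p u" using pos_imp_spec[OF assms(1,3)] by blast
  let ?w = "\<lambda>k x. \<Sum>a\<in>I. V x a * u k a"
  have ip: "ip J (?w k) (?w l) = ip I (u k) (u l)" for k l
  proof -
    have "ip J (?w k) (?w l) = (\<Sum>x\<in>J. \<Sum>a\<in>I. \<Sum>b\<in>I. cnj (u k a) * u l b * (cnj (V x a) * V x b))"
      unfolding ip_def cnj_sum sum_product by (simp add: mult_ac)
    also have "\<dots> = (\<Sum>a\<in>I. \<Sum>x\<in>J. \<Sum>b\<in>I. cnj (u k a) * u l b * (cnj (V x a) * V x b))"
      by (rule sum.swap)
    also have "\<dots> = (\<Sum>a\<in>I. \<Sum>b\<in>I. cnj (u k a) * u l b * (\<Sum>x\<in>J. cnj (V x a) * V x b))"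
      unfolding sum_distrib_left by (intro sum.cong refl sum.swap)
    also have "\<dots> = (\<Sum>a\<in>I. \<Sum>b\<in>I. if b = a then cnj (u k a) * u l a else 0)"
      using V by (intro sum.cong refl) auto
    finally show ?thesis using assms(1) by (simp add: ip_def)
  qed
  have "spec J (\<lambda>x y. \<Sum>a\<in>I. \<Sum>b\<in>I. V x a * \<rho> a b * cnj (V y b)) K p ?w"
    unfolding spec_def ortho_def ip
  proof (intro conjI ballI)
    fix x y
    have "(\<Sum>a\<in>I. \<Sum>b\<in>I. V x a * \<rho> a b * cnj (V y b)) =
        (\<Sum>a\<in>I. \<Sum>b\<in>I. \<Sum>k\<in>K. of_real (p k) * ((V x a * u k a) * (cnj (V y b) * cnj (u k b))))"
      using s by (intro sum.cong refl) (auto simp: spec_def sum_distrib_left sum_distrib_right mult_ac)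
    also have "\<dots> = (\<Sum>a\<in>I. \<Sum>k\<in>K. \<Sum>b\<in>I. of_real (p k) * ((V x a * u k a) * (cnj (V y b) * cnj (u k b))))"
      by (intro sum.cong refl sum.swap)
    also have "\<dots> = (\<Sum>k\<in>K. \<Sum>a\<in>I. \<Sum>b\<in>I. of_real (p k) * ((V x a * u k a) * (cnj (V y b) * cnj (u k b))))"
      by (rule sum.swap)
    also have "\<dots> = (\<Sum>k\<in>K. of_real (p k) * (?w k x * cnj (?w k y)))"
      by (simp only: cnj_sum complex_cnj_mult sum_product) (simp only: sum_distrib_left)
    finally show "(\<Sum>a\<in>I. \<Sum>b\<in>I. V x a * \<rho> a b * cnj (V y b)) = (\<Sum>k\<in>K. of_real (p k) * ?w k x * cnj (?w k y))"
      by (simp only: mult.assoc)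
  qed (use s in \<open>auto simp: spec_def ortho_def\<close>)
  from ent_eq[OF assms(2) this] ent_eq[OF assms(1) s] show ?thesis by simp
qed

section \<open>Strong subadditivity\<close>

lemma pos_ptr1:
  assumes "finite B" "finite C" "pos (B \<times> C) \<rho>"
  shows "pos C (ptr1 B \<rho>)"
  unfolding ptr1_def
proof (rule pos_sum)
  fix b assume "b \<in> B"
  then show "pos C (\<lambda>c c'. \<rho> (b, c) (b, c'))"
    using assms by (intro pos_pullback[OF assms(3), of "\<lambda>c. (b, c)"]) auto
qed

definition ptr3 :: "'r set \<Rightarrow> ('b \<times> 'c \<times> 'r \<Rightarrow> 'b \<times> 'c \<times> 'r \<Rightarrow> complex) \<Rightarrow> 'b \<times> 'c \<Rightarrow> 'b \<times> 'c \<Rightarrow> complex" where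
  "ptr3 R \<tau> = (\<lambda>s s'. \<Sum>r\<in>R. \<tau> (fst s, snd s, r) (fst s', snd s', r))"

lemma pos_ptr3:
  assumes "finite B" "finite C" "finite R" "pos (B \<times> C \<times> R) \<tau>"
  shows "pos (B \<times> C) (ptr3 R \<tau>)"
  unfolding ptr3_def
proof (rule pos_sum)
  fix r assume "r \<in> R"
  then show "pos (B \<times> C) (\<lambda>s s'. \<tau> (fst s, snd s, r) (fst s', snd s', r))"
    using assms by (intro pos_pullback[OF assms(4), of "\<lambda>s. (fst s, snd s, r)"]) auto
qed

lemma sum_Times3: "(\<Sum>x\<in>B \<times> C \<times> R. f x) = (\<Sum>s\<in>B \<times> C. \<Sum>r\<in>R. f (fst s, snd s, r))"
  by (simp add: sum_Times)

text \<open>Operators that act as the identity on \<open>R\<close> see a kernel only through its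
  partial trace over \<open>R\<close>.\<close>

lemma ptr3_sandwich:
  fixes F G :: "'b \<times> 'c \<Rightarrow> 'b \<times> 'c \<Rightarrow> complex"
  assumes "finite R"
  shows "(\<Sum>s''\<in>B \<times> C. \<Sum>r''\<in>R. \<Sum>s\<in>B \<times> C. \<Sum>r\<in>R. \<Sum>s'\<in>B \<times> C. \<Sum>r'\<in>R.
        if r' = r'' then (if r = r'' then F s'' s * \<mu> (fst s, snd s, r) (fst s', snd s', r') * G s'' s' else 0) else 0) =
      (\<Sum>s''\<in>B \<times> C. \<Sum>s\<in>B \<times> C. \<Sum>s'\<in>B \<times> C. F s'' s * ptr3 R \<mu> s s' * G s'' s')"
proof -
  let ?S = "B \<times> C"
  let ?e = "\<lambda>s r. (fst s, snd s, r)"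
  have "(\<Sum>s''\<in>?S. \<Sum>r''\<in>R. \<Sum>s\<in>?S. \<Sum>r\<in>R. \<Sum>s'\<in>?S. \<Sum>r'\<in>R.
        if r' = r'' then (if r = r'' then F s'' s * \<mu> (?e s r) (?e s' r') * G s'' s' else 0) else 0) =
      (\<Sum>s''\<in>?S. \<Sum>r''\<in>R. \<Sum>s\<in>?S. \<Sum>r\<in>R.
        if r = r'' then (\<Sum>s'\<in>?S. F s'' s * \<mu> (?e s r'') (?e s' r'') * G s'' s') else 0)"
    using assms by (intro sum.cong refl) auto
  also have "\<dots> = (\<Sum>s''\<in>?S. \<Sum>r''\<in>R. \<Sum>s\<in>?S. \<Sum>s'\<in>?S. F s'' s * \<mu> (?e s r'') (?e s' r'') * G s'' s')"
    using assms by simp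
  also have "\<dots> = (\<Sum>s''\<in>?S. \<Sum>s\<in>?S. \<Sum>r''\<in>R. \<Sum>s'\<in>?S. F s'' s * \<mu> (?e s r'') (?e s' r'') * G s'' s')"
    by (intro sum.cong refl sum.swap)
  also have "\<dots> = (\<Sum>s''\<in>?S. \<Sum>s\<in>?S. \<Sum>s'\<in>?S. \<Sum>r''\<in>R. F s'' s * \<mu> (?e s r'') (?e s' r'') * G s'' s')"
    by (intro sum.cong refl sum.swap)
  finally show ?thesis by (simp add: ptr3_def sum_distrib_left sum_distrib_right)
qed

lemma vform_lift:
  assumes "finite R"
  shows "vform (B \<times> C \<times> R) \<rho> \<sigma> t (\<lambda>(b, c, r) (b', c', r'). if r = r' then X (b, c) (b', c') else 0) =
    vform (B \<times> C) (ptr3 R \<rho>) (ptr3 R \<sigma>) t X"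
proof -
  let ?S = "B \<times> C"
  let ?X = "\<lambda>(b, c, r) (b', c', r'). if r = r' then X (b, c) (b', c') else 0"
  let ?e = "\<lambda>s r. (fst s, snd s, r)"
  have X: "?X (?e s r) (?e s' r') = (if r = r' then X s s' else 0)" for s r s' r' by simp
  have 1: "(\<Sum>x\<in>B \<times> C \<times> R. \<Sum>y\<in>B \<times> C \<times> R. cnj (?X x y) * \<rho> x y) =
      (\<Sum>s\<in>?S. \<Sum>s'\<in>?S. cnj (X s s') * ptr3 R \<rho> s s')"
  proof -
    have "(\<Sum>x\<in>B \<times> C \<times> R. \<Sum>y\<in>B \<times> C \<times> R. cnj (?X x y) * \<rho> x y) =
        (\<Sum>s\<in>?S. \<Sum>r\<in>R. \<Sum>s'\<in>?S. \<Sum>r'\<in>R. if r' = r then cnj (X s s') * \<rho> (?e s r) (?e s' r) else 0)"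
      unfolding sum_Times3 X by (intro sum.cong refl) auto
    also have "\<dots> = (\<Sum>s\<in>?S. \<Sum>r\<in>R. \<Sum>s'\<in>?S. cnj (X s s') * \<rho> (?e s r) (?e s' r))"
      using assms by simp
    also have "\<dots> = (\<Sum>s\<in>?S. \<Sum>s'\<in>?S. \<Sum>r\<in>R. cnj (X s s') * \<rho> (?e s r) (?e s' r))"
      by (intro sum.cong refl sum.swap)
    finally show ?thesis by (simp add: ptr3_def sum_distrib_left)
  qed
  have 2: "(\<Sum>y\<in>B \<times> C \<times> R. \<Sum>x\<in>B \<times> C \<times> R. \<Sum>x'\<in>B \<times> C \<times> R. cnj (?X x y) * \<sigma> x x' * ?X x' y) =
      (\<Sum>s''\<in>?S. \<Sum>s\<in>?S. \<Sum>s'\<in>?S. cnj (X s s'') * ptr3 R \<sigma> s s' * X s' s'')"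
    unfolding ptr3_sandwich[where F = "\<lambda>s'' s. cnj (X s s'')" and G = "\<lambda>s'' s'. X s' s''", OF assms, symmetric] sum_Times3 X
    by (intro sum.cong refl) auto
  have 3: "(\<Sum>x\<in>B \<times> C \<times> R. \<Sum>y\<in>B \<times> C \<times> R. \<Sum>y'\<in>B \<times> C \<times> R. ?X x y * \<rho> y y' * cnj (?X x y')) =
      (\<Sum>s''\<in>?S. \<Sum>s\<in>?S. \<Sum>s'\<in>?S. X s'' s * ptr3 R \<rho> s s' * cnj (X s'' s'))"
    unfolding ptr3_sandwich[where F = X and G = "\<lambda>s'' s'. cnj (X s'' s')", OF assms, symmetric] sum_Times3 X
    by (intro sum.cong refl) auto
  show ?thesis unfolding vform_def 1 2 3 ..
qed

text \<open>Monotonicity under tracing out R, applied to \<open>\<tau>\<close> against 1_B \<otimes>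
  \<tau>_CR. Both relative entropies are negative conditional entropies of B, given CR and given C,
  so the claim is that further conditioning cannot raise the entropy of B.\<close>

theorem strong_subadditivity:
  assumes fin: "finite B" "finite C" "finite R" and pos: "pos (B \<times> C \<times> R) \<tau>"
  shows "ent (B \<times> C \<times> R) \<tau> + ent C (ptr1 B (ptr3 R \<tau>)) \<le> ent (B \<times> C) (ptr3 R \<tau>) + ent (C \<times> R) (ptr1 B \<tau>)"
proof -
  note fins = fin finite_cartesian_product[OF fin(2,3)] finite_cartesian_product[OF fin(1,2)]
  have posBC: "pos (B \<times> C) (ptr3 R \<tau>)" by (rule pos_ptr3[OF fin pos])
  obtain K :: "nat set" and p u where s1: "spec (B \<times> C \<times> R) \<tau> K p u"
    using pos_imp_spec[OF _ pos] fins by blast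
  obtain J :: "nat set" and q v where s2: "spec (C \<times> R) (ptr1 B \<tau>) J q v"
    using pos_imp_spec[OF _ pos_ptr1[OF fin(1) _ pos]] fins by blast
  obtain K' :: "nat set" and p' u' where s3: "spec (B \<times> C) (ptr3 R \<tau>) K' p' u'"
    using pos_imp_spec[OF _ posBC] fins by blast
  obtain J' :: "nat set" and q' v' where s4: "spec C (ptr1 B (ptr3 R \<tau>)) J' q' v'"
    using pos_imp_spec[OF _ pos_ptr1[OF fin(1,2) posBC]] fins by blast
  have tr: "sum p K = sum p' K'"
  proof -
    have "(\<Sum>x\<in>B \<times> C \<times> R. \<tau> x x) = (\<Sum>s\<in>B \<times> C. ptr3 R \<tau> s s)"
      unfolding sum_Times3 by (simp add: ptr3_def)
    then show ?thesis unfolding spec_trace[OF s1] spec_trace[OF s3] by (simp only: of_real_eq_iff)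
  qed
  \<comment> \<open>The reference operators match: tracing out R from 1_B \<otimes> \<tau>_CR gives
    the reference operator of the reduced state.\<close>
  have one: "ptr3 R (one_tens (ptr1 B \<tau>)) = one_tens (ptr1 B (ptr3 R \<tau>))"
  proof (intro ext)
    fix x y
    show "ptr3 R (one_tens (ptr1 B \<tau>)) x y = one_tens (ptr1 B (ptr3 R \<tau>)) x y"
      by (cases x, cases y) (simp add: ptr3_def one_tens_def ptr1_def, rule impI, rule sum.swap)
  qed
  have "rel_ent (B \<times> C) K' p' u' (B \<times> J') (\<lambda>bj. q' (snd bj)) (slice_vec v') \<le>
      rel_ent (B \<times> C \<times> R) K p u (B \<times> J) (\<lambda>bj. q (snd bj)) (slice_vec v)"
  proof (rule rel_ent_mono[OF _ s1 spec_one_tens[OF fin(1) s2] support_one_tens[OF fin(1) _ s1 s2]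
        s3 spec_one_tens[OF fin(1) s4] support_one_tens[OF fin(1,2) s3 s4] tr])
    fix t X'
    show "\<exists>X. vform (B \<times> C \<times> R) \<tau> (one_tens (ptr1 B \<tau>)) t X =
        vform (B \<times> C) (ptr3 R \<tau>) (one_tens (ptr1 B (ptr3 R \<tau>))) t X'"
      using vform_lift[OF fin(3), of B C \<tau> "one_tens (ptr1 B \<tau>)" t X'] unfolding one by blast
  qed (use fins in auto)
  then show ?thesis
    unfolding rel_ent_one_tens[OF fin(1,2) s3 s4] rel_ent_one_tens[OF fin(1) fins(4) s1 s2]
    using ent_eq[OF _ s1] ent_eq[OF _ s2] ent_eq[OF _ s3] ent_eq[OF _ s4] fins by simp
qed

section \<open>Entropy inequalities\<close>

definition tr :: "'i set \<Rightarrow> ('i \<Rightarrow> 'i \<Rightarrow> complex) \<Rightarrow> real" where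
  "tr I \<rho> = Re (\<Sum>x\<in>I. \<rho> x x)"

lemma tr_spec: "spec I \<rho> K p u \<Longrightarrow> tr I \<rho> = sum p K"
  by (simp add: tr_def spec_trace del: of_real_sum)

lemma tr_add: "tr I (\<lambda>x y. \<rho> x y + \<sigma> x y) = tr I \<rho> + tr I \<sigma>"
  by (simp add: tr_def sum.distrib)

lemma tr_ptr1: "tr C (ptr1 B \<rho>) = tr (B \<times> C) \<rho>"
  unfolding tr_def ptr1_def sum_Times by (subst sum.swap) simp

text \<open>Operator monotonicity of the logarithm is avoided: ln r \<le> r - 1 at r = p / (c q)
  reduces the claim to p k times \<open>s k\<close> being at most c, where \<open>s k\<close> is the
  expectation of the inverse of \<sigma> in \<open>u k\<close>.\<close>

lemma rel_ent_le:
  assumes "spec I \<rho> K p u" "spec I \<sigma> J q v"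
    and supp: "\<And>k x. k \<in> K \<Longrightarrow> x \<in> I \<Longrightarrow> u k x = (\<Sum>j\<in>J. ip I (v j) (u k) * v j x)"
    and "0 < c" and dom: "\<And>z. Re (quad I \<rho> z) \<le> c * Re (quad I \<sigma> z)"
  shows "rel_ent I K p u J q v \<le> sum p K * ln c"
proof -
  have fin: "finite K" "finite J" "ortho I K u" "ortho I J v" "\<And>k. k \<in> K \<Longrightarrow> 0 < p k" "\<And>j. j \<in> J \<Longrightarrow> 0 < q j"
    using assms by (auto simp: spec_def)
  define w where "w j k = (cmod (ip I (v j) (u k)))\<^sup>2" for j k
  define s where "s k = (\<Sum>j\<in>J. w j k / q j)" for k
  have s: "p k * s k \<le> c" if k: "k \<in> K" for k
  proof -
    \<comment> \<open>\<open>z\<close> is \<sigma>^-1 applied to \<open>u k\<close>. Then <z,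
      \<sigma> z> = <u k, z> = s k, so \<open>dom\<close> at \<open>z\<close> implies p s^2 \<le> c
      s.\<close>
    define z where "z = (\<lambda>x. \<Sum>j\<in>J. (ip I (v j) (u k) / of_real (q j)) * v j x)"
    have ipz: "ip I (v j) z = ip I (v j) (u k) / of_real (q j)" if "j \<in> J" for j
      unfolding z_def by (rule ip_ortho_sum[OF fin(2,4) that])
    have s0: "0 \<le> s k"
      using fin(6) unfolding s_def w_def by (intro sum_nonneg divide_nonneg_pos) auto
    have "Re (quad I \<sigma> z) = s k"
      unfolding spec_quadratic[OF assms(2)] Re_complex_of_real s_def
      using fin(6) by (intro sum.cong refl) (force simp: ipz w_def norm_divide power2_eq_square)
    moreover have "ip I (u k) z = of_real (s k)"
      unfolding z_def ip_sum_right s_def of_real_sum w_def of_real_divide complex_norm_square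
      by (simp add: ip_cnj)
    then have "p k * (s k)\<^sup>2 \<le> Re (quad I \<rho> z)"
      unfolding spec_quadratic[OF assms(1)] Re_complex_of_real
      using member_le_sum[of k K "\<lambda>k. p k * (cmod (ip I (u k) z))\<^sup>2"] fin k by (auto simp: less_imp_le)
    ultimately have "(p k * s k) * s k \<le> c * s k"
      using dom[of z] by (simp add: power2_eq_square mult.assoc)
    then show ?thesis using s0 \<open>0 < c\<close> by (cases "s k = 0") (auto simp: le_less)
  qed
  have w1: "(\<Sum>j\<in>J. w j k) = 1" if "k \<in> K" for k
    using support_weights[OF fin(2,4) supp[OF that]] sqn_unit[OF fin(3) that] by (simp add: w_def)
  have term_bound: "w j k * p k * (ln (p k) - ln (q j)) \<le> w j k / q j * ((p k)\<^sup>2 / c) + w j k * (p k * ln c - p k)"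
    if "j \<in> J" "k \<in> K" for j k
  proof -
    have pq: "0 < p k" "0 < q j" using fin that by auto
    have "ln (p k) - ln (q j) = ln (p k / (c * q j)) + ln c"
      using pq \<open>0 < c\<close> by (simp add: ln_div ln_mult)
    also have "\<dots> \<le> p k / (c * q j) - 1 + ln c"
      using pq \<open>0 < c\<close> by (intro add_right_mono ln_le_minus_one) simp
    finally have "w j k * p k * (ln (p k) - ln (q j)) \<le> w j k * p k * (p k / (c * q j) - 1 + ln c)"
      using pq by (intro mult_left_mono) (auto simp: w_def)
    also have "\<dots> = w j k / q j * ((p k)\<^sup>2 / c) + w j k * (p k * ln c - p k)"
      by (simp add: power2_eq_square algebra_simps)
    finally show ?thesis .
  qed
  have "rel_ent I K p u J q v \<le> (\<Sum>j\<in>J. \<Sum>k\<in>K. w j k / q j * ((p k)\<^sup>2 / c) + w j k * (p k * ln c - p k))"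
    unfolding rel_ent_def w_def[symmetric] by (intro sum_mono term_bound)
  also have "\<dots> = (\<Sum>k\<in>K. s k * ((p k)\<^sup>2 / c) + (p k * ln c - p k))"
    unfolding s_def
    by (subst sum.swap, intro sum.cong refl)
      (simp only: sum.distrib sum_distrib_right[symmetric] w1 mult_1_left)
  also have "\<dots> \<le> (\<Sum>k\<in>K. p k * ln c)"
  proof (rule sum_mono)
    fix k assume k: "k \<in> K"
    have "s k * ((p k)\<^sup>2 / c) = (p k * s k) * p k / c" by (simp add: power2_eq_square)
    also have "\<dots> \<le> c * p k / c"
      using s[OF k] fin(5)[OF k] \<open>0 < c\<close> by (intro divide_right_mono mult_right_mono) auto
    finally show "s k * ((p k)\<^sup>2 / c) + (p k * ln c - p k) \<le> p k * ln c" using \<open>0 < c\<close> by simp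
  qed
  finally show ?thesis by (simp add: sum_distrib_right)
qed

text \<open>Klein's inequality for unnormalised operators, from ln r \<le> r - 1 at r = q / (c p).
  The squared overlaps with a fixed \<open>v j\<close> sum to at most 1 by Bessel, so the terms in q
  total at most (sum q) / c.\<close>

lemma rel_ent_ge:
  assumes "spec I \<rho> K p u" "spec I \<sigma> J q v"
    and supp: "\<And>k x. k \<in> K \<Longrightarrow> x \<in> I \<Longrightarrow> u k x = (\<Sum>j\<in>J. ip I (v j) (u k) * v j x)"
    and "0 < c" "sum q J \<le> c * sum p K"
  shows "- (sum p K * ln c) \<le> rel_ent I K p u J q v"
proof -
  have fin: "finite K" "finite J" "ortho I K u" "ortho I J v" "\<And>k. k \<in> K \<Longrightarrow> 0 < p k" "\<And>j. j \<in> J \<Longrightarrow> 0 < q j"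
    using assms by (auto simp: spec_def)
  define w where "w j k = (cmod (ip I (v j) (u k)))\<^sup>2" for j k
  have w1: "(\<Sum>j\<in>J. w j k) = 1" if "k \<in> K" for k
    using support_weights[OF fin(2,4) supp[OF that]] sqn_unit[OF fin(3) that] by (simp add: w_def)
  have w2: "(\<Sum>k\<in>K. w j k) \<le> 1" if "j \<in> J" for j
    using bessel[OF fin(1,3), of "v j"] sqn_unit[OF fin(4) that]
    by (simp add: w_def cmod_ip_commute[of I "v j"])
  have term_bound: "w j k * (p k - p k * ln c) - w j k * (q j / c) \<le> w j k * p k * (ln (p k) - ln (q j))"
    if "j \<in> J" "k \<in> K" for j k
  proof -
    have pq: "0 < p k" "0 < q j" using fin that by auto
    have "ln (q j) - ln (p k) = ln (q j / (c * p k)) + ln c"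
      using pq \<open>0 < c\<close> by (simp add: ln_div ln_mult)
    also have "\<dots> \<le> q j / (c * p k) - 1 + ln c"
      using pq \<open>0 < c\<close> by (intro add_right_mono ln_le_minus_one) simp
    finally have "1 - ln c - q j / (c * p k) \<le> ln (p k) - ln (q j)" by simp
    then have "w j k * p k * (1 - ln c - q j / (c * p k)) \<le> w j k * p k * (ln (p k) - ln (q j))"
      using pq by (intro mult_left_mono) (auto simp: w_def)
    moreover have "w j k * p k * (1 - ln c - q j / (c * p k)) = w j k * (p k - p k * ln c) - w j k * (q j / c)"
      using pq by (simp add: algebra_simps)
    ultimately show ?thesis by simp
  qed
  have "(\<Sum>j\<in>J. \<Sum>k\<in>K. w j k * (q j / c)) = (\<Sum>j\<in>J. (\<Sum>k\<in>K. w j k) * (q j / c))"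
    by (simp only: sum_distrib_right)
  also have "\<dots> \<le> (\<Sum>j\<in>J. 1 * (q j / c))"
    using w2 fin(6) \<open>0 < c\<close> by (intro sum_mono mult_right_mono) (auto simp: less_imp_le)
  also have "\<dots> \<le> sum p K"
    using assms(4,5) by (simp add: pos_divide_le_eq mult.commute flip: sum_divide_distrib)
  finally have "- (sum p K * ln c) \<le> (\<Sum>k\<in>K. p k - p k * ln c) - (\<Sum>j\<in>J. \<Sum>k\<in>K. w j k * (q j / c))"
    by (simp add: sum_subtractf sum_distrib_right)
  also have "(\<Sum>k\<in>K. p k - p k * ln c) = (\<Sum>j\<in>J. \<Sum>k\<in>K. w j k * (p k - p k * ln c))"
    using w1 by (subst sum.swap) (simp flip: sum_distrib_right)
  also have "\<dots> - (\<Sum>j\<in>J. \<Sum>k\<in>K. w j k * (q j / c)) \<le> rel_ent I K p u J q v"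
    unfolding rel_ent_def w_def[symmetric] sum_subtractf[symmetric] by (intro sum_mono term_bound)
  finally show ?thesis .
qed

text \<open>The constant is left open because two values are used: c = |B| in general, and c = 1 for
  a classical flag, whose conditional entropy is thus nonnegative.\<close>

lemma cond_ent_ge:
  assumes "finite B" "finite C" "pos (B \<times> C) \<rho>" "0 < c"
    and dom: "\<And>z. Re (quad (B \<times> C) \<rho> z) \<le> c * Re (quad (B \<times> C) (one_tens (ptr1 B \<rho>)) z)"
  shows "- (tr (B \<times> C) \<rho> * ln c) \<le> ent (B \<times> C) \<rho> - ent C (ptr1 B \<rho>)"
proof -
  have fin: "finite (B \<times> C)" using assms by simp
  obtain K :: "nat set" and p u where s1: "spec (B \<times> C) \<rho> K p u" using pos_imp_spec[OF fin assms(3)] by blast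
  obtain J :: "nat set" and q v where s2: "spec C (ptr1 B \<rho>) J q v"
    using pos_imp_spec[OF assms(2) pos_ptr1[OF assms(1-3)]] by blast
  from rel_ent_le[OF s1 spec_one_tens[OF assms(1) s2] support_one_tens[OF assms(1,2) s1 s2] assms(4) dom]
  show ?thesis
    unfolding rel_ent_one_tens[OF assms(1,2) s1 s2] tr_spec[OF s1] ent_eq[OF fin s1] ent_eq[OF assms(2) s2] by simp
qed

lemma cond_ent_ge_card:
  assumes "finite B" "finite C" "pos (B \<times> C) \<rho>" "B \<noteq> {}"
  shows "- (tr (B \<times> C) \<rho> * ln (card B)) \<le> ent (B \<times> C) \<rho> - ent C (ptr1 B \<rho>)"
proof -
  obtain K :: "nat set" and p u where s1: "spec (B \<times> C) \<rho> K p u" using pos_imp_spec[OF _ assms(3)] assms by blast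
  show ?thesis
    using assms by (intro cond_ent_ge quad_le_one_tens[OF assms(1,2) s1]) (auto simp: card_gt_0_iff)
qed

text \<open>Klein's inequality against 1 \<otimes> \<rho>_C, whose trace is |B| times that of
  \<rho>.\<close>

lemma cond_ent_le_card:
  assumes "finite B" "finite C" "pos (B \<times> C) \<rho>" "B \<noteq> {}"
  shows "ent (B \<times> C) \<rho> - ent C (ptr1 B \<rho>) \<le> tr (B \<times> C) \<rho> * ln (card B)"
proof -
  have fin: "finite (B \<times> C)" using assms by simp
  obtain K :: "nat set" and p u where s1: "spec (B \<times> C) \<rho> K p u" using pos_imp_spec[OF fin assms(3)] by blast
  obtain J :: "nat set" and q v where s2: "spec C (ptr1 B \<rho>) J q v"
    using pos_imp_spec[OF assms(2) pos_ptr1[OF assms(1-3)]] by blast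
  have "sum q J = sum p K"
    using tr_spec[OF s2] tr_spec[OF s1] by (simp add: tr_ptr1)
  then have "(\<Sum>bj\<in>B \<times> J. q (snd bj)) \<le> real (card B) * sum p K" by (simp add: sum_Times)
  from rel_ent_ge[OF s1 spec_one_tens[OF assms(1) s2] support_one_tens[OF assms(1,2) s1 s2] _ this]
  show ?thesis
    using assms(1,4)
    unfolding rel_ent_one_tens[OF assms(1,2) s1 s2] tr_spec[OF s1] ent_eq[OF fin s1] ent_eq[OF assms(2) s2]
    by (simp add: card_gt_0_iff)
qed

text \<open>The eigenvalue list is the disjoint union of the two lists. As the blocks are not
  normalised, no mixing term appears.\<close>

lemma ent_direct_sum:
  assumes "finite I1" "finite I2" "pos I1 \<rho>1" "pos I2 \<rho>2" "inj_on f1 I1" "inj_on f2 I2"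
    and J: "J = f1 ` I1 \<union> f2 ` I2" "f1 ` I1 \<inter> f2 ` I2 = {}"
    and t1: "\<And>a b. a \<in> I1 \<Longrightarrow> b \<in> I1 \<Longrightarrow> \<tau> (f1 a) (f1 b) = \<rho>1 a b"
    and t2: "\<And>a b. a \<in> I2 \<Longrightarrow> b \<in> I2 \<Longrightarrow> \<tau> (f2 a) (f2 b) = \<rho>2 a b"
    and t0: "\<And>a b. a \<in> I1 \<Longrightarrow> b \<in> I2 \<Longrightarrow> \<tau> (f1 a) (f2 b) = 0 \<and> \<tau> (f2 b) (f1 a) = 0"
  shows "ent J \<tau> = ent I1 \<rho>1 + ent I2 \<rho>2" "pos J \<tau>"
proof -
  have finJ: "finite J" using assms by simp
  obtain K1 :: "nat set" and p1 u1 where s1: "spec I1 \<rho>1 K1 p1 u1" using pos_imp_spec[OF assms(1,3)] by blast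
  obtain K2 :: "nat set" and p2 u2 where s2: "spec I2 \<rho>2 K2 p2 u2" using pos_imp_spec[OF assms(2,4)] by blast
  define \<tau>1 where "\<tau>1 x y = (if x \<in> f1 ` I1 \<and> y \<in> f1 ` I1 then \<tau> x y else 0)" for x y
  define \<tau>2 where "\<tau>2 x y = (if x \<in> f2 ` I2 \<and> y \<in> f2 ` I2 then \<tau> x y else 0)" for x y
  define v1 where "v1 = (\<lambda>k x. if x \<in> f1 ` I1 then u1 k (inv_into I1 f1 x) else 0)"
  define v2 where "v2 = (\<lambda>k x. if x \<in> f2 ` I2 then u2 k (inv_into I2 f2 x) else 0)"
  have r1: "spec J \<tau>1 K1 p1 v1"
    unfolding v1_def using assms by (intro spec_transport[OF s1]) (auto simp: \<tau>1_def)
  have r2: "spec J \<tau>2 K2 p2 v2"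
    unfolding v2_def using assms by (intro spec_transport[OF s2]) (auto simp: \<tau>2_def)
  have dec: "\<tau> x y = \<tau>1 x y + \<tau>2 x y" if "x \<in> J" "y \<in> J" for x y
  proof -
    have "x \<in> f1 ` I1 \<and> x \<notin> f2 ` I2 \<or> x \<in> f2 ` I2 \<and> x \<notin> f1 ` I1" "y \<in> f1 ` I1 \<and> y \<notin> f2 ` I2 \<or> y \<in> f2 ` I2 \<and> y \<notin> f1 ` I1"
      using that J by auto
    then show ?thesis using t0 by (auto simp: \<tau>1_def \<tau>2_def)
  qed
  have "v1 k x = 0 \<or> v2 l x = 0" for k l x
    using J(2) by (simp add: v1_def v2_def disjoint_iff)
  then have cross: "ip J (v1 k) (v2 l) = 0" "ip J (v2 l) (v1 k) = 0" for k l
    unfolding ip_def by (intro sum.neutral ballI; force)+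
  have s: "spec J \<tau> (K1 <+> K2) (case_sum p1 p2) (case_sum v1 v2)"
    unfolding spec_def
  proof (intro conjI ballI)
    show "ortho J (K1 <+> K2) (case_sum v1 v2)"
    proof -
      have "ortho J K1 v1" "ortho J K2 v2" using r1 r2 by (auto simp: spec_def)
      then show ?thesis
        unfolding ortho_def[of J "K1 <+> K2"] by (intro ballI) (elim PlusE; simp add: cross orthoD)
    qed
    fix x y assume "x \<in> J" "y \<in> J"
    then show "\<tau> x y = (\<Sum>k\<in>K1 <+> K2. of_real (case_sum p1 p2 k) * case_sum v1 v2 k x * cnj (case_sum v1 v2 k y))"
      using r1 r2 dec by (simp add: sum.Plus spec_def)
  qed (use r1 r2 in \<open>auto simp: spec_def\<close>)
  have "finite K1" "finite K2" using s1 s2 by (auto simp: spec_def)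
  then show "ent J \<tau> = ent I1 \<rho>1 + ent I2 \<rho>2"
    using ent_eq[OF finJ s] ent_eq[OF assms(1) s1] ent_eq[OF assms(2) s2] by (simp add: sum.Plus)
  show "pos J \<tau>" by (rule pos_spec_imp[OF s])
qed

text \<open>The bounds on the entropy of a one-bit flag conditioned on the system.\<close>

lemma ent_add:
  assumes "finite S" "pos S \<rho>" "pos S \<sigma>"
  shows "ent S (\<lambda>x y. \<rho> x y + \<sigma> x y) \<le> ent S \<rho> + ent S \<sigma>"
    and "ent S \<rho> + ent S \<sigma> \<le> ent S (\<lambda>x y. \<rho> x y + \<sigma> x y) + (tr S \<rho> + tr S \<sigma>) * ln 2"
proof -
  let ?B = "UNIV :: bool set"
  define \<tau> where "\<tau> = (\<lambda>(r, s) (r', s'). if r = r' then (if r then \<rho> s s' else \<sigma> s s') else 0)"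
  have 1: "ent (?B \<times> S) \<tau> = ent S \<rho> + ent S \<sigma>" and pos: "pos (?B \<times> S) \<tau>"
    using assms by (intro ent_direct_sum[of S S \<rho> \<sigma> "Pair True" "Pair False"];
        force simp: \<tau>_def inj_on_def UNIV_bool)+
  have 2: "ptr1 ?B \<tau> = (\<lambda>x y. \<rho> x y + \<sigma> x y)"
    by (auto simp: ptr1_def \<tau>_def UNIV_bool fun_eq_iff add.commute)
  have 3: "tr (?B \<times> S) \<tau> = tr S \<rho> + tr S \<sigma>"
    by (simp add: tr_ptr1[symmetric] 2 tr_add)
  \<comment> \<open>Each block of the flagged state is below \<rho> + \<sigma>, so domination holds
    with the factor 1 instead of the general factor 2.\<close>
  have dom: "Re (quad (?B \<times> S) \<tau> z) \<le> 1 * Re (quad (?B \<times> S) (one_tens (ptr1 ?B \<tau>)) z)" for z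
  proof -
    let ?z = "\<lambda>r s. z (r, s)"
    have q: "0 \<le> Re (quad S \<rho> v)" "0 \<le> Re (quad S \<sigma> v)" for v
      using assms by (auto simp: pos_def less_eq_complex_def)
    have "quad (?B \<times> S) \<tau> z = quad S \<rho> (?z True) + quad S \<sigma> (?z False)"
      by (simp add: quad_def sum_Times UNIV_bool \<tau>_def)
    moreover have "quad (?B \<times> S) (one_tens (ptr1 ?B \<tau>)) z =
        quad S \<rho> (?z True) + quad S \<sigma> (?z True) + (quad S \<rho> (?z False) + quad S \<sigma> (?z False))"
      unfolding quad_one_tens[OF finite_UNIV] 2
      by (simp add: UNIV_bool) (simp add: quad_def distrib_left distrib_right sum.distrib)
    ultimately show ?thesis using q[of "?z True"] q[of "?z False"] by simp
  qed
  show "ent S (\<lambda>x y. \<rho> x y + \<sigma> x y) \<le> ent S \<rho> + ent S \<sigma>"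
  proof -
    have "- (tr (?B \<times> S) \<tau> * ln 1) \<le> ent (?B \<times> S) \<tau> - ent S (ptr1 ?B \<tau>)"
      by (rule cond_ent_ge[OF _ assms(1) pos _ dom]) simp_all
    then show ?thesis by (simp add: 1 2)
  qed
  show "ent S \<rho> + ent S \<sigma> \<le> ent S (\<lambda>x y. \<rho> x y + \<sigma> x y) + (tr S \<rho> + tr S \<sigma>) * ln 2"
    using cond_ent_le_card[OF finite_UNIV assms(1) pos] by (simp add: 1 2 3)
qed

section \<open>Conditional mutual information\<close>

type_synonym ('a, 'b, 'e) kern3 = "'a \<times> 'b \<times> 'e \<Rightarrow> 'a \<times> 'b \<times> 'e \<Rightarrow> complex"

definition mAE :: "'b set \<Rightarrow> ('a, 'b, 'e) kern3 \<Rightarrow> 'a \<times> 'e \<Rightarrow> 'a \<times> 'e \<Rightarrow> complex" where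
  "mAE B \<rho> = (\<lambda>(x, z) (x', z'). \<Sum>y\<in>B. \<rho> (x, y, z) (x', y, z'))"

text \<open>In nats, and meant for unnormalised kernels too: the continuity estimate applies it to
  operators of trace \<epsilon>.\<close>

definition CMI :: "'a set \<Rightarrow> 'b set \<Rightarrow> 'e set \<Rightarrow> ('a, 'b, 'e) kern3 \<Rightarrow> real" where
  "CMI A B E \<rho> = ent (A \<times> E) (mAE B \<rho>) + ent (B \<times> E) (ptr1 A \<rho>)
     - ent (A \<times> B \<times> E) \<rho> - ent E (ptr1 B (ptr1 A \<rho>))"

lemma pos_mAE:
  assumes "finite A" "finite B" "finite E" "pos (A \<times> B \<times> E) \<rho>"
  shows "pos (A \<times> E) (mAE B \<rho>)"
  unfolding mAE_def case_prod_unfold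
proof (rule pos_sum)
  fix y assume "y \<in> B"
  then show "pos (A \<times> E) (\<lambda>s s'. \<rho> (fst s, y, snd s) (fst s', y, snd s'))"
    using assms by (intro pos_pullback[OF assms(4), of "\<lambda>s. (fst s, y, snd s)"]) auto
qed

lemma ptr1_mAE: "ptr1 A (mAE B \<rho>) = ptr1 B (ptr1 A \<rho>)"
  unfolding ptr1_def mAE_def by (intro ext) (simp, rule sum.swap)

lemma tr_mAE: "tr (A \<times> E) (mAE B \<rho>) = tr (A \<times> B \<times> E) \<rho>"
  using tr_ptr1[of E A "mAE B \<rho>"] tr_ptr1[of E B "ptr1 A \<rho>"] tr_ptr1[of "B \<times> E" A \<rho>]
  by (simp add: ptr1_mAE)

text \<open>Strong subadditivity with E as the middle system, hence the reordering
  \<open>f\<close>.\<close>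

lemma CMI_nonneg:
  assumes "finite A" "finite B" "finite E" "pos (A \<times> B \<times> E) \<rho>"
  shows "0 \<le> CMI A B E \<rho>"
proof -
  define f where "f = (\<lambda>(x, z, y). (x, y, z) :: 'a \<times> 'b \<times> 'c)"
  define \<tau> where "\<tau> = (\<lambda>s s'. \<rho> (f s) (f s'))"
  have bij: "bij_betw f (A \<times> E \<times> B) (A \<times> B \<times> E)"
    by (rule bij_betwI[where g = "\<lambda>(x, y, z). (x, z, y)"]) (auto simp: f_def)
  have pos: "pos (A \<times> E \<times> B) \<tau>"
    unfolding \<tau>_def using assms by (intro pos_pullback[OF assms(4)]) (auto simp: f_def)
  have 1: "ent (A \<times> E \<times> B) \<tau> = ent (A \<times> B \<times> E) \<rho>"
    unfolding \<tau>_def using assms by (intro ent_reindex bij) auto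
  have 2: "ptr3 B \<tau> = mAE B \<rho>" by (auto simp: ptr3_def mAE_def \<tau>_def f_def fun_eq_iff)
  have "ptr1 A \<tau> = (\<lambda>s s'. ptr1 A \<rho> (prod.swap s) (prod.swap s'))"
    by (auto simp: ptr1_def \<tau>_def f_def fun_eq_iff)
  moreover have "ent (E \<times> B) (\<lambda>s s'. ptr1 A \<rho> (prod.swap s) (prod.swap s')) = ent (B \<times> E) (ptr1 A \<rho>)"
  proof (rule ent_reindex)
    show "bij_betw prod.swap (E \<times> B) (B \<times> E)" by (rule bij_betwI[where g = prod.swap]) auto
  qed (use assms pos_ptr1[of A "B \<times> E" \<rho>] in auto)
  ultimately show ?thesis
    using strong_subadditivity[OF assms(1,3,2) pos] by (simp add: CMI_def 1 2 ptr1_mAE)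
qed

text \<open>Exchanges Alice and Bob. Local facts are proved for Alice, who holds the first factor,
  and are conjugated with \<open>swp\<close> for Bob.\<close>

definition swp :: "('a, 'b, 'e) kern3 \<Rightarrow> ('b, 'a, 'e) kern3" where
  "swp \<rho> = (\<lambda>(y, x, z) (y', x', z'). \<rho> (x, y, z) (x', y', z'))"

lemma pos_swp:
  assumes "finite A" "finite B" "finite E" "pos (A \<times> B \<times> E) \<rho>"
  shows "pos (B \<times> A \<times> E) (swp \<rho>)"
proof -
  have "pos (B \<times> A \<times> E) (\<lambda>s s'. \<rho> (fst (snd s), fst s, snd (snd s)) (fst (snd s'), fst s', snd (snd s')))"
    using assms by (intro pos_pullback[OF assms(4), of "\<lambda>s. (fst (snd s), fst s, snd (snd s))"]) auto
  then show ?thesis by (simp add: swp_def case_prod_unfold)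
qed

lemma CMI_swp:
  assumes "finite A" "finite B" "finite E" "pos (A \<times> B \<times> E) \<rho>"
  shows "CMI B A E (swp \<rho>) = CMI A B E \<rho>"
proof -
  let ?f = "\<lambda>s. (fst (snd s), fst s, snd (snd s))"
  have "ent (B \<times> A \<times> E) (\<lambda>s s'. \<rho> (?f s) (?f s')) = ent (A \<times> B \<times> E) \<rho>"
  proof (rule ent_reindex)
    show "bij_betw ?f (B \<times> A \<times> E) (A \<times> B \<times> E)" by (rule bij_betwI[where g = ?f]) auto
  qed (use assms in auto)
  moreover have "mAE A (swp \<rho>) = ptr1 A \<rho>" "ptr1 B (swp \<rho>) = mAE B \<rho>"
    "(\<lambda>s s'. \<rho> (?f s) (?f s')) = swp \<rho>"
    by (auto simp: mAE_def ptr1_def swp_def fun_eq_iff)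
  ultimately show ?thesis by (simp add: CMI_def ptr1_mAE)
qed

lemma CMI_reindex:
  assumes "finite A" "finite B" "finite E" "pos (A \<times> B \<times> E) \<rho>"
    and fA: "bij_betw f A' A" and fB: "bij_betw g B' B" and fE: "bij_betw h E' E"
  shows "CMI A' B' E' (\<lambda>(x, y, z) (x', y', z'). \<rho> (f x, g y, h z) (f x', g y', h z')) = CMI A B E \<rho>"
proof -
  let ?\<rho> = "\<lambda>(x, y, z) (x', y', z'). \<rho> (f x, g y, h z) (f x', g y', h z')"
  have 1: "ent (A' \<times> B' \<times> E') ?\<rho> = ent (A \<times> B \<times> E) \<rho>"
  proof -
    have "ent (A' \<times> B' \<times> E') (\<lambda>s s'. \<rho> (map_prod f (map_prod g h) s) (map_prod f (map_prod g h) s')) = ent (A \<times> B \<times> E) \<rho>"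
      using assms by (intro ent_reindex bij_betw_map_prod) auto
    then show ?thesis by (simp add: case_prod_unfold map_prod_def)
  qed
  have 2: "ent (A' \<times> E') (mAE B' ?\<rho>) = ent (A \<times> E) (mAE B \<rho>)"
  proof -
    have "ent (A' \<times> E') (\<lambda>s s'. mAE B \<rho> (map_prod f h s) (map_prod f h s')) = ent (A \<times> E) (mAE B \<rho>)"
      using assms by (intro ent_reindex bij_betw_map_prod pos_mAE) auto
    moreover have "mAE B' ?\<rho> = (\<lambda>s s'. mAE B \<rho> (map_prod f h s) (map_prod f h s'))"
    proof (intro ext, clarify)
      fix x z x' z'
      show "mAE B' ?\<rho> (x, z) (x', z') = mAE B \<rho> (map_prod f h (x, z)) (map_prod f h (x', z'))"
        using sum.reindex_bij_betw[OF fB, of "\<lambda>y. \<rho> (f x, y, h z) (f x', y, h z')"] by (simp add: mAE_def)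
    qed
    ultimately show ?thesis by simp
  qed
  have p: "ptr1 A' ?\<rho> = (\<lambda>s s'. ptr1 A \<rho> (map_prod g h s) (map_prod g h s'))"
  proof (intro ext, clarify)
    fix y z y' z'
    show "ptr1 A' ?\<rho> (y, z) (y', z') = ptr1 A \<rho> (map_prod g h (y, z)) (map_prod g h (y', z'))"
      using sum.reindex_bij_betw[OF fA, of "\<lambda>x. \<rho> (x, g y, h z) (x, g y', h z')"] by (simp add: ptr1_def)
  qed
  have 3: "ent (B' \<times> E') (ptr1 A' ?\<rho>) = ent (B \<times> E) (ptr1 A \<rho>)"
    unfolding p using assms by (intro ent_reindex bij_betw_map_prod pos_ptr1) auto
  have "ptr1 B' (ptr1 A' ?\<rho>) = (\<lambda>s s'. ptr1 B (ptr1 A \<rho>) (h s) (h s'))"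
  proof (intro ext)
    fix z z'
    show "ptr1 B' (ptr1 A' ?\<rho>) z z' = ptr1 B (ptr1 A \<rho>) (h z) (h z')"
      unfolding p
      using sum.reindex_bij_betw[OF fB, of "\<lambda>y. ptr1 A \<rho> (y, h z) (y, h z')"] by (simp add: ptr1_def[of B'] ptr1_def[of B])
  qed
  then have 4: "ent E' (ptr1 B' (ptr1 A' ?\<rho>)) = ent E (ptr1 B (ptr1 A \<rho>))"
    using assms by (simp add: ent_reindex[OF _ _ fE] pos_ptr1)
  show ?thesis by (simp add: CMI_def 1 2 3 4)
qed

lemma ptr1_add: "ptr1 B (\<lambda>x y. \<rho> x y + \<sigma> x y) = (\<lambda>x y. ptr1 B \<rho> x y + ptr1 B \<sigma> x y)"
  by (simp add: ptr1_def sum.distrib)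

lemma mAE_add: "mAE B (\<lambda>x y. \<rho> x y + \<sigma> x y) = (\<lambda>x y. mAE B \<rho> x y + mAE B \<sigma> x y)"
  by (simp add: mAE_def sum.distrib case_prod_unfold)

text \<open>By \<open>ent_add\<close> each of the four entropies falls short of additivity by
  between 0 and ln 2 times the total trace, which all marginals share. Two of them enter with plus
  and two with minus, hence the factor 2.\<close>

lemma CMI_add:
  assumes fin: "finite A" "finite B" "finite E" and pos: "pos (A \<times> B \<times> E) \<rho>" "pos (A \<times> B \<times> E) \<sigma>"
  shows "\<bar>CMI A B E (\<lambda>x y. \<rho> x y + \<sigma> x y) - CMI A B E \<rho> - CMI A B E \<sigma>\<bar>
    \<le> 2 * (tr (A \<times> B \<times> E) \<rho> + tr (A \<times> B \<times> E) \<sigma>) * ln 2"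
proof -
  have fins: "finite (A \<times> B \<times> E)" "finite (A \<times> E)" "finite (B \<times> E)" using fin by auto
  note p1 = pos_mAE[OF fin pos(1)] pos_mAE[OF fin pos(2)]
  note p2 = pos_ptr1[OF fin(1) fins(3) pos(1)] pos_ptr1[OF fin(1) fins(3) pos(2)]
  note p3 = pos_ptr1[OF fin(2,3) p2(1)] pos_ptr1[OF fin(2,3) p2(2)]
  show ?thesis
    using ent_add[OF fins(1) pos] ent_add[OF fins(2) p1] ent_add[OF fins(3) p2] ent_add[OF fin(3) p3]
    unfolding CMI_def mAE_add ptr1_add tr_ptr1 tr_mAE mult.assoc abs_le_iff by linarith
qed

text \<open>The value is S(A|E) - S(A|BE), and each term is at most ln |A| in size per unit of
  trace. The dimension of E does not occur, which is essential because Eve's space is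
  arbitrary.\<close>

lemma CMI_le:
  assumes fin: "finite A" "finite B" "finite E" and pos: "pos (A \<times> B \<times> E) \<rho>" and "A \<noteq> {}"
  shows "CMI A B E \<rho> \<le> 2 * tr (A \<times> B \<times> E) \<rho> * ln (card A)"
  using cond_ent_ge_card[OF fin(1) _ pos \<open>A \<noteq> {}\<close>] cond_ent_le_card[OF fin(1,3) pos_mAE[OF fin pos] \<open>A \<noteq> {}\<close>] fin
  by (simp add: CMI_def ptr1_mAE tr_mAE)

text \<open>\<open>CMI_add\<close> on the two sides of \<rho> + N = \<sigma> + P costs 2 (1 +
  \<epsilon>) ln 2 each; the value at \<open>P\<close> is nonnegative and the value at
  \<open>N\<close> is at most 2 \<epsilon> ln |A|.\<close>

lemma CMI_continuity:
  assumes fin: "finite A" "finite B" "finite E" and "A \<noteq> {}"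
    and pos: "pos (A \<times> B \<times> E) \<rho>" "pos (A \<times> B \<times> E) \<sigma>" "pos (A \<times> B \<times> E) N" "pos (A \<times> B \<times> E) P"
    and eq: "\<And>x y. x \<in> A \<times> B \<times> E \<Longrightarrow> y \<in> A \<times> B \<times> E \<Longrightarrow> \<rho> x y + N x y = \<sigma> x y + P x y"
    and t: "tr (A \<times> B \<times> E) \<rho> = 1" "tr (A \<times> B \<times> E) \<sigma> = 1" "tr (A \<times> B \<times> E) N = \<epsilon>" "tr (A \<times> B \<times> E) P = \<epsilon>"
  shows "CMI A B E \<sigma> - 2 * \<epsilon> * ln (card A) - 4 * (1 + \<epsilon>) * ln 2 \<le> CMI A B E \<rho>"
proof -
  have "CMI A B E (\<lambda>x y. \<rho> x y + N x y) = CMI A B E (\<lambda>x y. \<sigma> x y + P x y)"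
  proof -
    have "ent (A \<times> B \<times> E) (\<lambda>x y. \<rho> x y + N x y) = ent (A \<times> B \<times> E) (\<lambda>x y. \<sigma> x y + P x y)"
      using eq by (rule ent_cong)
    moreover have "ent (A \<times> E) (mAE B (\<lambda>x y. \<rho> x y + N x y)) = ent (A \<times> E) (mAE B (\<lambda>x y. \<sigma> x y + P x y))"
      using eq by (intro ent_cong) (clarify, simp only: mAE_def prod.case, intro sum.cong refl eq, auto)
    moreover have "ent (B \<times> E) (ptr1 A (\<lambda>x y. \<rho> x y + N x y)) = ent (B \<times> E) (ptr1 A (\<lambda>x y. \<sigma> x y + P x y))"
      using eq by (intro ent_cong) (clarify, simp only: ptr1_def, intro sum.cong refl eq, auto)
    moreover have "ent E (ptr1 B (ptr1 A (\<lambda>x y. \<rho> x y + N x y))) = ent E (ptr1 B (ptr1 A (\<lambda>x y. \<sigma> x y + P x y)))"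
      using eq by (intro ent_cong) (simp only: ptr1_def, intro sum.cong refl eq, auto)
    ultimately show ?thesis by (simp add: CMI_def)
  qed
  then show ?thesis
    using CMI_add[OF fin pos(1,3)] CMI_add[OF fin pos(2,4)] CMI_nonneg[OF fin pos(4)]
      CMI_le[OF fin pos(3) \<open>A \<noteq> {}\<close>] by (simp add: t abs_le_iff algebra_simps)
qed

section \<open>Channels\<close>

text \<open>A channel is given by the matrix entries \<open>W y y' x x' = \<langle>y| \<Lambda>(|x\<rangle>\<langle>x'|) |y'\<rangle>\<close>; the first condition is the
  Kraus form.\<close>

definition chan :: "'i set \<Rightarrow> 'j set \<Rightarrow> ('j \<Rightarrow> 'j \<Rightarrow> 'i \<Rightarrow> 'i \<Rightarrow> complex) \<Rightarrow> bool" where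
  "chan I J W \<longleftrightarrow>
     (\<exists>(m::nat) K. \<forall>x\<in>I. \<forall>x'\<in>I. \<forall>y\<in>J. \<forall>y'\<in>J. W y y' x x' = (\<Sum>r<m. K r y x * cnj (K r y' x'))) \<and>
     (\<forall>x\<in>I. \<forall>x'\<in>I. (\<Sum>y\<in>J. W y y x x') = (if x = x' then 1 else 0))"

lemma chan_kraus:
  assumes "chan I J W"
  obtains m :: nat and K
  where "\<And>x x' y y'. x \<in> I \<Longrightarrow> x' \<in> I \<Longrightarrow> y \<in> J \<Longrightarrow> y' \<in> J \<Longrightarrow> W y y' x x' = (\<Sum>r<m. K r y x * cnj (K r y' x'))"
proof -
  from assms obtain m :: nat and K
    where "\<forall>x\<in>I. \<forall>x'\<in>I. \<forall>y\<in>J. \<forall>y'\<in>J. W y y' x x' = (\<Sum>r<m. K r y x * cnj (K r y' x'))"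
    unfolding chan_def by (elim conjE exE)
  then show thesis by (intro that[of K m]) simp
qed

lemma chan_trace:
  "chan I J W \<Longrightarrow> x \<in> I \<Longrightarrow> x' \<in> I \<Longrightarrow> (\<Sum>y\<in>J. W y y x x') = (if x = x' then 1 else 0)"
  unfolding chan_def by blast

definition act1 :: "'i set \<Rightarrow> ('j \<Rightarrow> 'j \<Rightarrow> 'i \<Rightarrow> 'i \<Rightarrow> complex) \<Rightarrow> ('i \<times> 's \<Rightarrow> 'i \<times> 's \<Rightarrow> complex) \<Rightarrow> 'j \<times> 's \<Rightarrow> 'j \<times> 's \<Rightarrow> complex"
  where "act1 I W \<rho> = (\<lambda>(x, s) (x', s'). \<Sum>u\<in>I. \<Sum>v\<in>I. W x x' u v * \<rho> (u, s) (v, s'))"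

definition actE :: "'e set \<Rightarrow> ('f \<Rightarrow> 'f \<Rightarrow> 'e \<Rightarrow> 'e \<Rightarrow> complex) \<Rightarrow> ('a, 'b, 'e) kern3 \<Rightarrow> ('a, 'b, 'f) kern3" where
  "actE E W \<rho> = (\<lambda>(x, y, z) (x', y', z'). \<Sum>u\<in>E. \<Sum>v\<in>E. W z z' u v * \<rho> (x, y, u) (x', y', v))"

lemma sum_delta_product:
  fixes F :: "'i \<times> 's \<Rightarrow> complex"
  assumes "finite S" "s \<in> S"
  shows "(\<Sum>a\<in>I \<times> S. (if s = snd a then k (fst a) else 0) * F a) = (\<Sum>u\<in>I. k u * F (u, s))"
proof -
  have "(\<Sum>a\<in>I \<times> S. (if s = snd a then k (fst a) else 0) * F a) = (\<Sum>u\<in>I. \<Sum>s'\<in>S. if s' = s then k u * F (u, s) else 0)"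
    unfolding sum_Times by (intro sum.cong refl) auto
  then show ?thesis using assms by simp
qed

text \<open>Conjugation by the Stinespring operator, the sum over r of K r \<otimes> e_r. The
  environment register \<open>r\<close> goes last, where \<open>ptr3\<close> removes it.\<close>

definition dilate :: "'i set \<Rightarrow> (nat \<Rightarrow> 'j \<Rightarrow> 'i \<Rightarrow> complex) \<Rightarrow> ('i \<times> 's \<Rightarrow> 'i \<times> 's \<Rightarrow> complex) \<Rightarrow> 'j \<times> 's \<times> nat \<Rightarrow> 'j \<times> 's \<times> nat \<Rightarrow> complex"
  where "dilate I K \<rho> = (\<lambda>(x, s, r) (x', s', r'). \<Sum>u\<in>I. \<Sum>v\<in>I. K r x u * \<rho> (u, s) (v, s') * cnj (K r' x' v))"

lemma dilate_sandwich:
  assumes "finite I" "finite S" "s \<in> S" "s' \<in> S"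
  shows "(\<Sum>a\<in>I \<times> S. \<Sum>b\<in>I \<times> S. (if s = snd a then K r x (fst a) else 0) * \<rho> a b * cnj (if s' = snd b then K r' x' (fst b) else 0)) =
    dilate I K \<rho> (x, s, r) (x', s', r')"
proof -
  have "(\<Sum>a\<in>I \<times> S. \<Sum>b\<in>I \<times> S. (if s = snd a then K r x (fst a) else 0) * \<rho> a b * cnj (if s' = snd b then K r' x' (fst b) else 0)) =
      (\<Sum>a\<in>I \<times> S. (if s = snd a then K r x (fst a) else 0) * (\<Sum>b\<in>I \<times> S. (if s' = snd b then cnj (K r' x' (fst b)) else 0) * \<rho> a b))"
    unfolding sum_distrib_left by (intro sum.cong refl) auto
  also have "\<dots> = (\<Sum>u\<in>I. K r x u * (\<Sum>v\<in>I. cnj (K r' x' v) * \<rho> (u, s) (v, s')))"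
    using assms by (simp add: sum_delta_product[where k = "\<lambda>v. cnj (K r' x' v)"] sum_delta_product[where k = "K r x"])
  finally show ?thesis by (simp add: dilate_def sum_distrib_left mult_ac)
qed

text \<open>Trace preservation says that the stacked Kraus operators form an isometry
  \<open>V\<close>, so the dilated kernel keeps the positive eigenvalues of
  \<open>\<rho>\<close>.\<close>

lemma dilate_props:
  fixes \<rho> :: "'i \<times> 's \<Rightarrow> 'i \<times> 's \<Rightarrow> complex" and K :: "nat \<Rightarrow> 'j \<Rightarrow> 'i \<Rightarrow> complex"
  assumes "finite I" "finite J" "finite S" "pos (I \<times> S) \<rho>"
    and W: "\<And>x x' y y'. x \<in> I \<Longrightarrow> x' \<in> I \<Longrightarrow> y \<in> J \<Longrightarrow> y' \<in> J \<Longrightarrow> W y y' x x' = (\<Sum>r<m. K r y x * cnj (K r y' x'))"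
    and TP: "\<And>x x'. x \<in> I \<Longrightarrow> x' \<in> I \<Longrightarrow> (\<Sum>y\<in>J. W y y x x') = (if x = x' then 1 else 0)"
  shows "pos (J \<times> S \<times> {..<m}) (dilate I K \<rho>)"
    and "ent (J \<times> S \<times> {..<m}) (dilate I K \<rho>) = ent (I \<times> S) \<rho>"
proof -
  define V where "V = (\<lambda>(t :: 'j \<times> 's \<times> nat) (a :: 'i \<times> 's). if fst (snd t) = snd a then K (snd (snd t)) (fst t) (fst a) else 0 :: complex)"
  let ?\<tau> = "\<lambda>t t'. \<Sum>a\<in>I \<times> S. \<Sum>b\<in>I \<times> S. V t a * \<rho> a b * cnj (V t' b)"
  have eq: "?\<tau> t t' = dilate I K \<rho> t t'" if "t \<in> J \<times> S \<times> {..<m}" "t' \<in> J \<times> S \<times> {..<m}" for t t'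
    using that assms(1,3) by (cases t, cases t') (auto simp: V_def dilate_sandwich)
  have "pos (J \<times> S \<times> {..<m}) ?\<tau>" by (rule pos_sandwich[OF assms(4)])
  then show "pos (J \<times> S \<times> {..<m}) (dilate I K \<rho>)" using pos_cong[of _ ?\<tau> "dilate I K \<rho>"] eq by blast
  have iso: "(\<Sum>t\<in>J \<times> S \<times> {..<m}. cnj (V t a) * V t b) = (if a = b then 1 else 0)" if ab: "a \<in> I \<times> S" "b \<in> I \<times> S" for a b
  proof -
    obtain u s v s' where e: "a = (u, s)" "b = (v, s')" "u \<in> I" "v \<in> I" "s \<in> S" "s' \<in> S" using ab by auto
    have "(\<Sum>t\<in>J \<times> S \<times> {..<m}. cnj (V t a) * V t b) =
        (\<Sum>y\<in>J. \<Sum>s''\<in>S. if s'' = s then (if s = s' then \<Sum>r<m. cnj (K r y u) * K r y v else 0) else 0)"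
      unfolding sum_Times by (intro sum.cong refl) (auto simp: V_def e)
    also have "\<dots> = (if s = s' then \<Sum>y\<in>J. \<Sum>r<m. cnj (K r y u) * K r y v else 0)"
      using e assms(3) by simp
    also have "(\<Sum>y\<in>J. \<Sum>r<m. cnj (K r y u) * K r y v) = (\<Sum>y\<in>J. W y y v u)"
      using e W by (intro sum.cong refl) (auto simp: mult.commute)
    also have "\<dots> = (if u = v then 1 else 0)" using TP[of v u] e by auto
    finally show ?thesis by (simp add: e)
  qed
  have "ent (J \<times> S \<times> {..<m}) (dilate I K \<rho>) = ent (J \<times> S \<times> {..<m}) ?\<tau>" by (intro ent_cong) (simp add: eq)
  also have "\<dots> = ent (I \<times> S) \<rho>" using assms by (intro ent_isometry iso) auto
  finally show "ent (J \<times> S \<times> {..<m}) (dilate I K \<rho>) = ent (I \<times> S) \<rho>" .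
qed

lemma act1_dilate:
  assumes W: "\<And>x x' y y'. x \<in> I \<Longrightarrow> x' \<in> I \<Longrightarrow> y \<in> J \<Longrightarrow> y' \<in> J \<Longrightarrow> W y y' x x' = (\<Sum>r<m. K r y x * cnj (K r y' x'))"
    and "y \<in> J" "y' \<in> J"
  shows "act1 I W \<rho> (y, s) (y', s') = (\<Sum>r<m. dilate I K \<rho> (y, s, r) (y', s', r))"
proof -
  have "act1 I W \<rho> (y, s) (y', s') = (\<Sum>u\<in>I. \<Sum>v\<in>I. \<Sum>r<m. K r y u * \<rho> (u, s) (v, s') * cnj (K r y' v))"
    unfolding act1_def prod.case using assms(2,3)
    by (intro sum.cong refl) (simp add: W sum_distrib_left sum_distrib_right mult_ac)
  also have "\<dots> = (\<Sum>u\<in>I. \<Sum>r<m. \<Sum>v\<in>I. K r y u * \<rho> (u, s) (v, s') * cnj (K r y' v))"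
    by (intro sum.cong refl sum.swap)
  also have "\<dots> = (\<Sum>r<m. \<Sum>u\<in>I. \<Sum>v\<in>I. K r y u * \<rho> (u, s) (v, s') * cnj (K r y' v))"
    by (rule sum.swap)
  finally show ?thesis by (simp add: dilate_def)
qed

lemma pos_act1:
  assumes fin: "finite I" "finite J" "finite S" and pos: "pos (I \<times> S) \<rho>" and "chan I J W"
  shows "pos (J \<times> S) (act1 I W \<rho>)"
proof -
  obtain m :: nat and K where W: "\<And>x x' y y'. x \<in> I \<Longrightarrow> x' \<in> I \<Longrightarrow> y \<in> J \<Longrightarrow> y' \<in> J \<Longrightarrow> W y y' x x' = (\<Sum>r<m. K r y x * cnj (K r y' x'))"
    by (rule chan_kraus[OF assms(5)]) (rule that)
  note TP = chan_trace[OF assms(5)]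
  have "pos (J \<times> S) (ptr3 {..<m} (dilate I K \<rho>))"
    using fin by (intro pos_ptr3 dilate_props(1)[where K = K and m = m and W = W, OF fin pos W TP]) auto
  then show ?thesis
    by (subst (asm) pos_cong[of _ _ "act1 I W \<rho>"])
      (auto simp: ptr3_def act1_dilate[where K = K and m = m and W = W and I = I and J = J, OF W])
qed

lemma sum_swap12:
  fixes f :: "'a \<Rightarrow> 'b \<Rightarrow> 'c \<Rightarrow> complex"
  shows "(\<Sum>x\<in>A. \<Sum>u\<in>B. \<Sum>v\<in>C. f x u v) = (\<Sum>u\<in>B. \<Sum>v\<in>C. \<Sum>x\<in>A. f x u v)"
proof -
  have "(\<Sum>x\<in>A. \<Sum>u\<in>B. \<Sum>v\<in>C. f x u v) = (\<Sum>u\<in>B. \<Sum>x\<in>A. \<Sum>v\<in>C. f x u v)" by (rule sum.swap)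
  also have "\<dots> = (\<Sum>u\<in>B. \<Sum>v\<in>C. \<Sum>x\<in>A. f x u v)" by (intro sum.cong refl sum.swap)
  finally show ?thesis .
qed

text \<open>No signalling: an operation of Alice leaves the entropies of BE and of E in
  \<open>CMI\<close> untouched.\<close>

lemma ptr1_act1:
  assumes "finite I" "chan I J W"
  shows "ptr1 J (act1 I W \<rho>) = ptr1 I \<rho>"
proof (intro ext)
  fix s s'
  have "ptr1 J (act1 I W \<rho>) s s' = (\<Sum>u\<in>I. \<Sum>v\<in>I. \<Sum>y\<in>J. W y y u v * \<rho> (u, s) (v, s'))"
    unfolding ptr1_def act1_def prod.case by (rule sum_swap12)
  also have "\<dots> = (\<Sum>u\<in>I. \<Sum>v\<in>I. (\<Sum>y\<in>J. W y y u v) * \<rho> (u, s) (v, s'))"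
    by (simp only: sum_distrib_right)
  also have "\<dots> = (\<Sum>u\<in>I. \<Sum>v\<in>I. if v = u then \<rho> (u, s) (u, s') else 0)"
    using assms(2) by (intro sum.cong refl) (auto simp: chan_def)
  finally show "ptr1 J (act1 I W \<rho>) s s' = ptr1 I \<rho> s s'"
    using assms(1) by (simp add: ptr1_def)
qed

text \<open>Let R be the environment of the dilated channel. Strong subadditivity for B, A'E, R
  bounds S(A'E) - S(A'BE) by S(A'ER) - S(A'BER), and since the dilation is isometric the last two
  are S(AE) and S(ABE).\<close>

theorem CMI_act1_le:
  assumes fin: "finite A" "finite A'" "finite B" "finite E" and pos: "pos (A \<times> B \<times> E) \<rho>" and ch: "chan A A' W"
  shows "CMI A' B E (act1 A W \<rho>) \<le> CMI A B E \<rho>"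
proof -
  obtain m :: nat and K where W: "\<And>x x' y y'. x \<in> A \<Longrightarrow> x' \<in> A \<Longrightarrow> y \<in> A' \<Longrightarrow> y' \<in> A' \<Longrightarrow> W y y' x x' = (\<Sum>r<m. K r y x * cnj (K r y' x'))"
    by (rule chan_kraus[OF ch]) (rule that)
  note TP = chan_trace[OF ch]
  let ?R = "{..<m}"
  \<comment> \<open>Moves B to the front and keeps the environment last, the order of
    \<open>strong_subadditivity\<close>.\<close>
  define f where "f = (\<lambda>(y, (x, z), r). (x, (y, z), r) :: 'b \<times> ('c \<times> 'd) \<times> nat)"
  define \<tau> where "\<tau> = (\<lambda>t t'. dilate A K \<rho> (f t) (f t'))"
  have finBE: "finite (B \<times> E)" using fin by simp
  note d1 = dilate_props[where K = K and m = m and W = W, OF fin(1,2) finBE pos W TP]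
  note d2 = dilate_props[where K = K and m = m and W = W, OF fin(1,2,4) pos_mAE[OF fin(1,3,4) pos] W TP]
  have bij: "bij_betw f (B \<times> (A' \<times> E) \<times> ?R) (A' \<times> (B \<times> E) \<times> ?R)"
    by (rule bij_betwI[where g = "\<lambda>(x, (y, z), r). (y, (x, z), r)"]) (auto simp: f_def)
  have finD: "finite (A' \<times> (B \<times> E) \<times> ?R)" using fin by simp
  have posT: "pos (B \<times> (A' \<times> E) \<times> ?R) \<tau>"
    unfolding \<tau>_def using bij by (intro pos_pullback[OF d1(1) finD]) (auto simp: bij_betw_def)
  have e1: "ent (B \<times> (A' \<times> E) \<times> ?R) \<tau> = ent (A \<times> B \<times> E) \<rho>"
    unfolding \<tau>_def using ent_reindex[OF finD d1(1) bij] d1(2) by (rule trans)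
  have "ptr3 ?R \<tau> (y, (x, z)) (y', (x', z')) = act1 A W \<rho> (x, y, z) (x', y', z')"
    if "x \<in> A'" "x' \<in> A'" for x y z x' y' z'
    by (simp add: ptr3_def \<tau>_def f_def act1_dilate[where K = K and m = m and W = W and I = A and J = A', OF W that])
  then have p3: "ptr3 ?R \<tau> t t' = (\<lambda>t t'. act1 A W \<rho> (fst (snd t), fst t, snd (snd t)) (fst (snd t'), fst t', snd (snd t'))) t t'"
    if "t \<in> B \<times> A' \<times> E" "t' \<in> B \<times> A' \<times> E" for t t'
    using that by auto
  have posA: "pos (A' \<times> B \<times> E) (act1 A W \<rho>)" by (rule pos_act1[OF fin(1,2) finBE pos ch])
  have e2: "ent (B \<times> A' \<times> E) (ptr3 ?R \<tau>) = ent (A' \<times> B \<times> E) (act1 A W \<rho>)"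
  proof -
    let ?g = "\<lambda>t. (fst (snd t), fst t, snd (snd t))"
    have "ent (B \<times> A' \<times> E) (ptr3 ?R \<tau>) = ent (B \<times> A' \<times> E) (\<lambda>t t'. act1 A W \<rho> (?g t) (?g t'))"
      by (rule ent_cong) (rule p3)
    also have "\<dots> = ent (A' \<times> B \<times> E) (act1 A W \<rho>)"
    proof (rule ent_reindex)
      show "bij_betw ?g (B \<times> A' \<times> E) (A' \<times> B \<times> E)"
        by (rule bij_betwI[where g = "\<lambda>t. (fst (snd t), fst t, snd (snd t))"]) auto
    qed (use fin posA in auto)
    finally show ?thesis .
  qed
  have e3: "ent (A' \<times> E) (ptr1 B (ptr3 ?R \<tau>)) = ent (A' \<times> E) (mAE B (act1 A W \<rho>))"
    using p3 by (intro ent_cong) (auto simp: ptr1_def mAE_def intro!: sum.cong)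
  have p1: "ptr1 B \<tau> = (\<lambda>t t'. dilate A K (mAE B \<rho>) (fst (fst t), snd (fst t), snd t) (fst (fst t'), snd (fst t'), snd t'))"
  proof (intro ext)
    fix t t' :: "('b \<times> 'd) \<times> nat"
    obtain x z r x' z' r' where e: "t = ((x, z), r)" "t' = ((x', z'), r')" by (metis prod.collapse)
    show "ptr1 B \<tau> t t' = dilate A K (mAE B \<rho>) (fst (fst t), snd (fst t), snd t) (fst (fst t'), snd (fst t'), snd t')"
    proof -
      have "ptr1 B \<tau> ((x, z), r) ((x', z'), r') =
          (\<Sum>u\<in>A. \<Sum>v\<in>A. \<Sum>y\<in>B. K r x u * \<rho> (u, y, z) (v, y, z') * cnj (K r' x' v))"
        unfolding ptr1_def \<tau>_def f_def dilate_def prod.case by (rule sum_swap12)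
      then show ?thesis
        unfolding e by (simp add: dilate_def mAE_def sum_distrib_left sum_distrib_right)
    qed
  qed
  have e4: "ent ((A' \<times> E) \<times> ?R) (ptr1 B \<tau>) = ent (A \<times> E) (mAE B \<rho>)"
  proof -
    have "ent ((A' \<times> E) \<times> ?R) (ptr1 B \<tau>) = ent (A' \<times> E \<times> ?R) (dilate A K (mAE B \<rho>))"
      unfolding p1
    proof (rule ent_reindex)
      show "bij_betw (\<lambda>t. (fst (fst t), snd (fst t), snd t)) ((A' \<times> E) \<times> ?R) (A' \<times> E \<times> ?R)"
        by (rule bij_betwI[where g = "\<lambda>(x, z, r). ((x, z), r)"]) auto
    qed (use fin d2 in auto)
    then show ?thesis using d2(2) by simp
  qed
  have "ent (B \<times> (A' \<times> E) \<times> ?R) \<tau> + ent (A' \<times> E) (ptr1 B (ptr3 ?R \<tau>)) \<le>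
      ent (B \<times> A' \<times> E) (ptr3 ?R \<tau>) + ent ((A' \<times> E) \<times> ?R) (ptr1 B \<tau>)"
    using fin by (intro strong_subadditivity posT) auto
  then show ?thesis
    unfolding e1 e2 e3 e4 CMI_def ptr1_act1[OF fin(1) ch] by simp
qed

lemma sum_swap22:
  fixes F :: "'a \<Rightarrow> 'b \<Rightarrow> 'c \<Rightarrow> 'd \<Rightarrow> complex"
  shows "(\<Sum>a\<in>A. \<Sum>b\<in>B. \<Sum>u\<in>C. \<Sum>v\<in>D. F a b u v) = (\<Sum>u\<in>C. \<Sum>v\<in>D. \<Sum>a\<in>A. \<Sum>b\<in>B. F a b u v)"
proof -
  have "(\<Sum>a\<in>A. \<Sum>b\<in>B. \<Sum>u\<in>C. \<Sum>v\<in>D. F a b u v) = (\<Sum>a\<in>A. \<Sum>u\<in>C. \<Sum>v\<in>D. \<Sum>b\<in>B. F a b u v)"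
    by (intro sum.cong refl sum_swap12)
  also have "\<dots> = (\<Sum>u\<in>C. \<Sum>v\<in>D. \<Sum>a\<in>A. \<Sum>b\<in>B. F a b u v)" by (rule sum_swap12)
  finally show ?thesis .
qed

lemma actE_act1: "actE E W (act1 A G \<rho>) = act1 A G (actE E W \<rho>)"
proof (intro ext, clarify)
  fix x y z x' y' z'
  have "actE E W (act1 A G \<rho>) (x, y, z) (x', y', z') =
      (\<Sum>a\<in>E. \<Sum>b\<in>E. \<Sum>u\<in>A. \<Sum>v\<in>A. W z z' a b * (G x x' u v * \<rho> (u, y, a) (v, y', b)))"
    by (simp add: actE_def act1_def sum_distrib_left)
  also have "\<dots> = (\<Sum>u\<in>A. \<Sum>v\<in>A. \<Sum>a\<in>E. \<Sum>b\<in>E. W z z' a b * (G x x' u v * \<rho> (u, y, a) (v, y', b)))"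
    by (rule sum_swap22)
  finally show "actE E W (act1 A G \<rho>) (x, y, z) (x', y', z') = act1 A G (actE E W \<rho>) (x, y, z) (x', y', z')"
    by (simp add: actE_def act1_def sum_distrib_left mult.left_commute)
qed

text \<open>A cyclic shift that brings E to the front. Three shifts restore the order, so facts on
  \<open>act1\<close> carry over to \<open>actE\<close>.\<close>

definition rot :: "('a, 'b, 'e) kern3 \<Rightarrow> ('e, 'a, 'b) kern3" where
  "rot \<rho> = (\<lambda>(z, x, y) (z', x', y'). \<rho> (x, y, z) (x', y', z'))"

lemma pos_rot:
  assumes "finite A" "finite B" "finite E" "pos (A \<times> B \<times> E) \<rho>"
  shows "pos (E \<times> A \<times> B) (rot \<rho>)"
proof -
  have "pos (E \<times> A \<times> B) (\<lambda>s s'. \<rho> (fst (snd s), snd (snd s), fst s) (fst (snd s'), snd (snd s'), fst s'))"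
    using assms by (intro pos_pullback[OF assms(4), of "\<lambda>s. (fst (snd s), snd (snd s), fst s)"]) auto
  then show ?thesis by (simp add: rot_def case_prod_unfold)
qed

lemma actE_rot: "actE E W \<rho> = rot (rot (act1 E W (rot \<rho>)))"
  by (auto simp: actE_def rot_def act1_def fun_eq_iff)

lemma pos_actE:
  assumes "finite A" "finite B" "finite E" "finite F" "pos (A \<times> B \<times> E) \<rho>" "chan E F W"
  shows "pos (A \<times> B \<times> F) (actE E W \<rho>)"
  unfolding actE_rot using assms
  by (intro pos_rot[of B F A] pos_rot[of F A B] pos_act1[of E F "A \<times> B"] pos_rot[of A B E]) auto

lemma tr_act1:
  assumes "finite I" "chan I J W"
  shows "tr (J \<times> S) (act1 I W \<rho>) = tr (I \<times> S) \<rho>"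
  unfolding tr_ptr1[symmetric] ptr1_act1[OF assms] ..

lemma tr_actE:
  assumes "finite E" "chan E F W"
  shows "tr (A \<times> B \<times> F) (actE E W \<rho>) = tr (A \<times> B \<times> E) \<rho>"
proof -
  have r: "tr (B' \<times> F' \<times> A') (rot \<rho>') = tr (F' \<times> A' \<times> B') \<rho>'" for A' B' F' and \<rho>' :: "('x, 'y, 'z) kern3"
    unfolding tr_def sum_Times rot_def prod.case by (rule arg_cong[of _ _ Re], rule sum_swap12)
  show ?thesis unfolding actE_rot r tr_act1[OF assms] ..
qed

text \<open>Kraus operators may be labelled by any finite set here, while \<open>chan\<close> asks
  for an initial segment of the naturals.\<close>

lemma chanI:
  assumes "finite R"
    and W: "\<And>x x' y y'. x \<in> I \<Longrightarrow> x' \<in> I \<Longrightarrow> y \<in> J \<Longrightarrow> y' \<in> J \<Longrightarrow> W y y' x x' = (\<Sum>r\<in>R. K r y x * cnj (K r y' x'))"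
    and TP: "\<And>x x'. x \<in> I \<Longrightarrow> x' \<in> I \<Longrightarrow> (\<Sum>y\<in>J. W y y x x') = (if x = x' then 1 else 0)"
  shows "chan I J W"
proof -
  obtain h where h: "bij_betw h {..<card R} R"
    using ex_bij_betw_nat_finite[OF assms(1)] by (auto simp: atLeast0LessThan)
  have "W y y' x x' = (\<Sum>r<card R. K (h r) y x * cnj (K (h r) y' x'))"
    if "x \<in> I" "x' \<in> I" "y \<in> J" "y' \<in> J" for x x' y y'
    using W[OF that] sum.reindex_bij_betw[OF h, of "\<lambda>r. K r y x * cnj (K r y' x')"] by simp
  then show ?thesis
    unfolding chan_def using TP by (intro conjI exI[of _ "card R"] exI[of _ "\<lambda>r. K (h r)"]) auto
qed

lemma chan_reindex:
  assumes "chan E F W" "bij_betw h F' F" "bij_betw k E' E"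
  shows "chan E' F' (\<lambda>f f' z z'. W (h f) (h f') (k z) (k z'))"
proof -
  obtain m :: nat and K where W: "\<And>x x' y y'. x \<in> E \<Longrightarrow> x' \<in> E \<Longrightarrow> y \<in> F \<Longrightarrow> y' \<in> F \<Longrightarrow> W y y' x x' = (\<Sum>r<m. K r y x * cnj (K r y' x'))"
    by (rule chan_kraus[OF assms(1)]) (rule that)
  have hk: "\<And>f. f \<in> F' \<Longrightarrow> h f \<in> F" "\<And>z. z \<in> E' \<Longrightarrow> k z \<in> E" "inj_on k E'"
    using assms by (auto simp: bij_betw_def)
  show ?thesis
  proof (rule chanI[where R = "{..<m}" and K = "\<lambda>r f z. K r (h f) (k z)"])
    fix x x' assume "x \<in> E'" "x' \<in> E'"
    then show "(\<Sum>y\<in>F'. W (h y) (h y) (k x) (k x')) = (if x = x' then 1 else 0)"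
      using sum.reindex_bij_betw[OF assms(2), of "\<lambda>y. W y y (k x) (k x')"] hk chan_trace[OF assms(1)]
      by (simp add: inj_on_eq_iff)
  qed (simp_all add: W hk)
qed

lemma chan_id: "finite E \<Longrightarrow> chan E E (\<lambda>f f' z z'. if f = z \<and> f' = z' then 1 else 0)"
  by (rule chanI[where R = "{()}" and K = "\<lambda>_ f z. if f = z then 1 else 0"]) auto

section \<open>Achievable values of the intrinsic information\<close>

text \<open>A bound reached by one channel of Eve rather than the infimum: every later claim then
  amounts to exhibiting a channel. Output sets of naturals suffice, since \<open>achI\<close>
  relabels any finite output set.\<close>

definition ach :: "'a set \<Rightarrow> 'b set \<Rightarrow> 'e set \<Rightarrow> ('a, 'b, 'e) kern3 \<Rightarrow> real \<Rightarrow> bool" where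
  "ach A B E \<rho> c \<longleftrightarrow> (\<exists>(J::nat set) W. finite J \<and> chan E J W \<and> CMI A B J (actE E W \<rho>) \<le> c)"

lemma achI:
  assumes fin: "finite A" "finite B" "finite E" "finite F" and pos: "pos (A \<times> B \<times> E) \<rho>"
    and W: "chan E F W" and le: "CMI A B F (actE E W \<rho>) \<le> c"
  shows "ach A B E \<rho> c"
proof -
  obtain h where h: "bij_betw h {..<card F} F"
    using ex_bij_betw_nat_finite[OF fin(4)] by (auto simp: atLeast0LessThan)
  let ?W = "\<lambda>f f'. W (h f) (h f')"
  have "chan E {..<card F} ?W" by (rule chan_reindex[OF W h bij_betw_id[unfolded id_def]])
  moreover have "CMI A B {..<card F} (actE E ?W \<rho>) = CMI A B F (actE E W \<rho>)"
  proof -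
    have "actE E ?W \<rho> = (\<lambda>(x, y, z) (x', y', z'). actE E W \<rho> (id x, id y, h z) (id x', id y', h z'))"
      by (auto simp: actE_def fun_eq_iff)
    then show ?thesis
      using CMI_reindex[OF fin(1,2,4) pos_actE[OF fin pos W] bij_betw_id bij_betw_id h] by simp
  qed
  ultimately show ?thesis using le unfolding ach_def by (metis finite_lessThan)
qed

lemma achE:
  assumes "ach A B E \<rho> c"
  obtains J :: "nat set" and W where "finite J" "chan E J W" "CMI A B J (actE E W \<rho>) \<le> c"
  using assms unfolding ach_def by blast

lemma actE_cong:
  assumes "\<And>s s'. s \<in> A \<times> B \<times> E \<Longrightarrow> s' \<in> A \<times> B \<times> E \<Longrightarrow> \<rho> s s' = \<sigma> s s'"
    and "t \<in> A \<times> B \<times> F" "t' \<in> A \<times> B \<times> F"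
  shows "actE E W \<rho> t t' = actE E W \<sigma> t t'"
  using assms(2,3) by (auto simp: actE_def assms(1) intro!: sum.cong)

lemma CMI_cong:
  assumes "\<And>s s'. s \<in> A \<times> B \<times> E \<Longrightarrow> s' \<in> A \<times> B \<times> E \<Longrightarrow> \<rho> s s' = \<sigma> s s'"
  shows "CMI A B E \<rho> = CMI A B E \<sigma>"
proof -
  have 1: "ent (A \<times> B \<times> E) \<rho> = ent (A \<times> B \<times> E) \<sigma>"
    using assms by (rule ent_cong)
  have 2: "ent (A \<times> E) (mAE B \<rho>) = ent (A \<times> E) (mAE B \<sigma>)"
    by (intro ent_cong) (clarify, simp only: mAE_def prod.case, intro sum.cong refl assms, auto)
  have 3: "ent (B \<times> E) (ptr1 A \<rho>) = ent (B \<times> E) (ptr1 A \<sigma>)"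
    by (intro ent_cong) (clarify, simp only: ptr1_def, intro sum.cong refl assms, auto)
  have 4: "ent E (ptr1 B (ptr1 A \<rho>)) = ent E (ptr1 B (ptr1 A \<sigma>))"
    by (intro ent_cong) (simp only: ptr1_def, intro sum.cong refl assms, auto)
  show ?thesis by (simp add: CMI_def 1 2 3 4)
qed

lemma ach_cong:
  assumes "\<And>s s'. s \<in> A \<times> B \<times> E \<Longrightarrow> s' \<in> A \<times> B \<times> E \<Longrightarrow> \<rho> s s' = \<sigma> s s'"
  shows "ach A B E \<rho> c = ach A B E \<sigma> c"
proof -
  have "CMI A B J (actE E W \<rho>) = CMI A B J (actE E W \<sigma>)" for J :: "nat set" and W
    by (intro CMI_cong actE_cong[OF assms])
  then show ?thesis by (simp add: ach_def)
qed

lemma ach_act1: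
  assumes fin: "finite A" "finite A'" "finite B" "finite E" and pos: "pos (A \<times> B \<times> E) \<rho>"
    and "chan A A' G" "ach A B E \<rho> c"
  shows "ach A' B E (act1 A G \<rho>) c"
proof -
  obtain J :: "nat set" and W where J: "finite J" "chan E J W" "CMI A B J (actE E W \<rho>) \<le> c"
    using assms(7) by (rule achE)
  have "CMI A' B J (actE E W (act1 A G \<rho>)) \<le> CMI A B J (actE E W \<rho>)"
    unfolding actE_act1
    by (rule CMI_act1_le[OF fin(1-3) J(1) pos_actE[OF fin(1,3,4) J(1) pos J(2)] assms(6)])
  then show ?thesis using J unfolding ach_def by (meson order_trans)
qed

lemma actE_swp: "actE E W (swp \<rho>) = swp (actE E W \<rho>)"
  by (auto simp: actE_def swp_def fun_eq_iff)

lemma ach_swp: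
  assumes fin: "finite A" "finite B" "finite E" and pos: "pos (A \<times> B \<times> E) \<rho>" and "ach A B E \<rho> c"
  shows "ach B A E (swp \<rho>) c"
proof -
  obtain J :: "nat set" and W where J: "finite J" "chan E J W" "CMI A B J (actE E W \<rho>) \<le> c"
    using assms(5) by (rule achE)
  have "CMI B A J (actE E W (swp \<rho>)) = CMI A B J (actE E W \<rho>)"
    unfolding actE_swp by (rule CMI_swp[OF fin(1,2) J(1) pos_actE[OF fin J(1) pos J(2)]])
  then show ?thesis using J unfolding ach_def by metis
qed

text \<open>Passes between product index sets and numbered basis vectors; Eve's channel is
  relabelled along \<open>h\<close>.\<close>

lemma ach_reindex:
  assumes fin: "finite A" "finite B" "finite E" and pos: "pos (A \<times> B \<times> E) \<rho>"
    and bij: "bij_betw f A' A" "bij_betw g B' B" "bij_betw h E' E" and "ach A B E \<rho> c"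
  shows "ach A' B' E' (\<lambda>(x, y, z) (x', y', z'). \<rho> (f x, g y, h z) (f x', g y', h z')) c"
proof -
  let ?\<rho> = "\<lambda>(x, y, z) (x', y', z'). \<rho> (f x, g y, h z) (f x', g y', h z')"
  obtain J :: "nat set" and W where J: "finite J" "chan E J W" "CMI A B J (actE E W \<rho>) \<le> c"
    using assms(8) by (rule achE)
  let ?W = "\<lambda>w w' z z'. W w w' (h z) (h z')"
  have ch: "chan E' J ?W" by (rule chan_reindex[OF J(2) bij_betw_id[unfolded id_def] bij(3)])
  have "actE E' ?W ?\<rho> (x, y, w) (x', y', w') = actE E W \<rho> (f x, g y, w) (f x', g y', w')" for x y w x' y' w'
    using sum.reindex_bij_betw[OF bij(3), of "\<lambda>v. W w w' (h _) v * \<rho> (f x, g y, h _) (f x', g y', v)"]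
      sum.reindex_bij_betw[OF bij(3), of "\<lambda>u. \<Sum>v\<in>E'. W w w' u (h v) * \<rho> (f x, g y, u) (f x', g y', h v)"]
      sum.reindex_bij_betw[OF bij(3), of "\<lambda>v. W w w' u v * \<rho> (f x, g y, u) (f x', g y', v)" for u]
    by (simp add: actE_def)
  then have "actE E' ?W ?\<rho> = (\<lambda>(x, y, z) (x', y', z'). actE E W \<rho> (f x, g y, id z) (f x', g y', id z'))"
    by (simp add: fun_eq_iff)
  then have "CMI A' B' J (actE E' ?W ?\<rho>) = CMI A B J (actE E W \<rho>)"
    using CMI_reindex[OF fin(1,2) J(1) pos_actE[OF fin J(1) pos J(2)] bij(1,2) bij_betw_id] by simp
  then show ?thesis using J ch unfolding ach_def by metis
qed

lemma pos_reindex3: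
  assumes fin: "finite A" "finite B" "finite E" and pos: "pos (A \<times> B \<times> E) \<rho>"
    and "f ` A' \<subseteq> A" "g ` B' \<subseteq> B" "h ` E' \<subseteq> E"
  shows "pos (A' \<times> B' \<times> E') (\<lambda>(x, y, z) (x', y', z'). \<rho> (f x, g y, h z) (f x', g y', h z'))"
proof -
  have "pos (A' \<times> B' \<times> E') (\<lambda>s s'. \<rho> (map_prod f (map_prod g h) s) (map_prod f (map_prod g h) s'))"
    using assms by (intro pos_pullback[OF pos]) auto
  then show ?thesis by (simp add: map_prod_def case_prod_unfold)
qed

section \<open>Public communication\<close>

text \<open>\<open>g x\<close> is the message contained in Alice's index. The condition on
  \<open>g x'\<close> makes her register classical; \<open>c\<close> and \<open>d\<close> are the
  copies received by Bob and Eve.\<close>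

definition pub :: "('a \<Rightarrow> nat) \<Rightarrow> ('a, 'b, 'e) kern3 \<Rightarrow> ('a, 'b \<times> nat, 'e \<times> nat) kern3" where
  "pub g \<rho> = (\<lambda>(x, (y, c), (z, d)) (x', (y', c'), (z', d')).
     if c = g x \<and> d = g x \<and> c' = g x \<and> d' = g x \<and> g x' = g x then \<rho> (x, y, z) (x', y', z') else 0)"

definition dephase :: "('a \<Rightarrow> nat) \<Rightarrow> 'a \<Rightarrow> 'a \<Rightarrow> 'a \<Rightarrow> 'a \<Rightarrow> complex" where
  "dephase g = (\<lambda>x x' u v. if u = x \<and> v = x' \<and> g x = g x' then 1 else 0)"

lemma chan_dephase:
  assumes "finite A" "g ` A \<subseteq> {..<k}"
  shows "chan A A (dephase g)"
proof (rule chanI[where R = "{..<k}" and K = "\<lambda>r x u. if u = x \<and> g x = r then 1 else 0"])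
  fix u v x x' assume "u \<in> A" "v \<in> A" "x \<in> A" "x' \<in> A"
  then have "g x < k" using assms by auto
  have "(\<Sum>r<k. (if u = x \<and> g x = r then 1 else 0) * cnj (if v = x' \<and> g x' = r then 1 else 0)) =
      (\<Sum>r<k. if r = g x then (if u = x \<and> v = x' \<and> g x = g x' then 1 else 0) else 0 :: complex)"
    by (intro sum.cong) auto
  then show "dephase g x x' u v = (\<Sum>r<k. (if u = x \<and> g x = r then 1 else 0) * cnj (if v = x' \<and> g x' = r then 1 else 0))"
    using \<open>g x < k\<close> by (simp add: dephase_def)
next
  fix u v assume "u \<in> A" "v \<in> A"
  have "(\<Sum>y\<in>A. dephase g y y u v) = (\<Sum>y\<in>A. if y = u then (if u = v then 1 else 0) else 0)"
    by (intro sum.cong) (auto simp: dephase_def)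
  then show "(\<Sum>y\<in>A. dephase g y y u v) = (if u = v then 1 else 0)"
    using assms(1) \<open>u \<in> A\<close> by simp
qed simp

lemma act1_dephase:
  assumes "finite A" "x \<in> A" "x' \<in> A"
  shows "act1 A (dephase g) \<rho> (x, s) (x', s') = (if g x = g x' then \<rho> (x, s) (x', s') else 0)"
proof -
  have "act1 A (dephase g) \<rho> (x, s) (x', s') =
      (\<Sum>u\<in>A. \<Sum>v\<in>A. if v = x' then (if u = x then (if g x = g x' then \<rho> (x, s) (x', s') else 0) else 0) else 0)"
    unfolding act1_def prod.case by (intro sum.cong refl) (auto simp: dephase_def)
  then show ?thesis using assms by simp
qed

text \<open>Alice keeps the message, so the copies are functions of her index. Appending them embeds
  the dephased state into a larger space and changes neither S(ABE) nor S(AE).\<close>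

lemma pub_transport:
  fixes \<rho> :: "('a, 'b, 'e) kern3"
  assumes fin: "finite A" "finite B" "finite E" and pos: "pos (A \<times> B \<times> E) \<rho>" and g: "g ` A \<subseteq> {..<k}"
  shows "ent (A \<times> (B \<times> {..<k}) \<times> (E \<times> {..<k})) (pub g \<rho>) = ent (A \<times> B \<times> E) (act1 A (dephase g) \<rho>)"
    and "pos (A \<times> (B \<times> {..<k}) \<times> (E \<times> {..<k})) (pub g \<rho>)"
    and "ent (A \<times> (E \<times> {..<k})) (mAE (B \<times> {..<k}) (pub g \<rho>)) = ent (A \<times> E) (mAE B (act1 A (dephase g) \<rho>))"
proof -
  let ?M = "act1 A (dephase g) \<rho>"
  have finBE: "finite (B \<times> E)" using fin by simp
  have posM: "pos (A \<times> B \<times> E) ?M" by (rule pos_act1[OF fin(1,1) finBE pos chan_dephase[OF fin(1) g]])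
  define f where "f = (\<lambda>(x, y, z). (x, (y, g x), (z, g x)) :: 'a \<times> ('b \<times> nat) \<times> ('e \<times> nat))"
  have inj: "inj_on f (A \<times> B \<times> E)" by (auto simp: inj_on_def f_def)
  have im: "f ` (A \<times> B \<times> E) \<subseteq> A \<times> (B \<times> {..<k}) \<times> (E \<times> {..<k})" using g by (auto simp: f_def)
  have on: "pub g \<rho> (f s) (f s') = ?M s s'" if "s \<in> A \<times> B \<times> E" "s' \<in> A \<times> B \<times> E" for s s'
    using that fin by (auto simp: f_def pub_def act1_dephase)
  have off: "pub g \<rho> t t' = 0 \<and> pub g \<rho> t' t = 0"
    if t0: "t \<in> A \<times> (B \<times> {..<k}) \<times> (E \<times> {..<k}) - f ` (A \<times> B \<times> E)" and "t' \<in> A \<times> (B \<times> {..<k}) \<times> (E \<times> {..<k})" for t t'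
  proof -
    obtain x y c z d where t: "t = (x, (y, c), (z, d))" "x \<in> A" "y \<in> B" "z \<in> E" using DiffD1[OF t0] by auto
    have "\<not> (c = g x \<and> d = g x)"
      using t0 t image_eqI[of t f "(x, y, z)" "A \<times> B \<times> E"] by (auto simp: f_def)
    then show ?thesis by (cases t') (auto simp: t pub_def)
  qed
  have finJ: "finite (A \<times> (B \<times> {..<k}) \<times> (E \<times> {..<k}))" using fin by simp
  show "ent (A \<times> (B \<times> {..<k}) \<times> (E \<times> {..<k})) (pub g \<rho>) = ent (A \<times> B \<times> E) ?M"
    using fin by (intro ent_embed[OF _ posM inj finJ im on off]) auto
  obtain K :: "nat set" and p u where "spec (A \<times> B \<times> E) ?M K p u"
    using pos_imp_spec[OF _ posM] fin by blast
  from spec_transport[OF this inj finJ im on off]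
  show "pos (A \<times> (B \<times> {..<k}) \<times> (E \<times> {..<k})) (pub g \<rho>)" by (rule pos_spec_imp)
  define f2 where "f2 = (\<lambda>(x, z). (x, (z, g x)) :: 'a \<times> ('e \<times> nat))"
  have mpub: "mAE (B \<times> {..<k}) (pub g \<rho>) (x, (z, d)) (x', (z', d')) =
      (if d = g x \<and> d' = g x \<and> g x' = g x then (\<Sum>y\<in>B. \<rho> (x, y, z) (x', y, z')) else 0)"
    if "x \<in> A" for x z d x' z' d'
  proof -
    have "g x < k" using that g by auto
    have "mAE (B \<times> {..<k}) (pub g \<rho>) (x, (z, d)) (x', (z', d')) = (\<Sum>y\<in>B. \<Sum>c<k. if c = g x then
        (if d = g x \<and> d' = g x \<and> g x' = g x then \<rho> (x, y, z) (x', y, z') else 0) else 0)"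
      unfolding mAE_def prod.case sum_Times by (intro sum.cong refl) (auto simp: pub_def)
    moreover have "(\<Sum>y\<in>B. if P then F y else 0) = (if P then \<Sum>y\<in>B. F y else 0)" for P and F :: "_ \<Rightarrow> complex"
      by simp
    ultimately show ?thesis using \<open>g x < k\<close> by (simp only: sum.delta finite_lessThan lessThan_iff if_True)
  qed
  have mM: "mAE B ?M (x, z) (x', z') = (if g x = g x' then (\<Sum>y\<in>B. \<rho> (x, y, z) (x', y, z')) else 0)"
    if "x \<in> A" "x' \<in> A" for x z x' z'
    using that fin(1) by (simp add: mAE_def act1_dephase)
  show "ent (A \<times> (E \<times> {..<k})) (mAE (B \<times> {..<k}) (pub g \<rho>)) = ent (A \<times> E) (mAE B ?M)"
  proof (rule ent_embed[where f = f2])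
    show "inj_on f2 (A \<times> E)" by (auto simp: inj_on_def f2_def)
    show "f2 ` (A \<times> E) \<subseteq> A \<times> (E \<times> {..<k})" using g by (auto simp: f2_def)
    fix s s' assume "s \<in> A \<times> E" "s' \<in> A \<times> E"
    then show "mAE (B \<times> {..<k}) (pub g \<rho>) (f2 s) (f2 s') = mAE B ?M s s'"
      by (auto simp: f2_def mpub mM)
  next
    fix t t' assume h: "t \<in> A \<times> (E \<times> {..<k}) - f2 ` (A \<times> E)" "t' \<in> A \<times> (E \<times> {..<k})"
    obtain x z d where t: "t = (x, (z, d))" "x \<in> A" "z \<in> E" using h by auto
    obtain x' z' d' where t': "t' = (x', (z', d'))" "x' \<in> A" using h by auto
    have "d \<noteq> g x"
      using h(1) t image_eqI[of t f2 "(x, z)" "A \<times> E"] by (auto simp: f2_def)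
    then show "mAE (B \<times> {..<k}) (pub g \<rho>) t t' = 0 \<and> mAE (B \<times> {..<k}) (pub g \<rho>) t' t = 0"
      using t t' by (auto simp: mpub)
  qed (use fin posM in \<open>auto intro: pos_mAE\<close>)
qed

text \<open>Let C be the message. Without Alice, the copies of Bob and Eve amount to a single
  register, and strong subadditivity gives S(BEC) - S(EC) \<le> S(BE) - S(E). The entropies with
  Alice are those of the dephased state, and dephasing is a local operation.\<close>

lemma CMI_pub_le:
  fixes \<rho> :: "('a, 'b, 'e) kern3"
  assumes fin: "finite A" "finite B" "finite E" and pos: "pos (A \<times> B \<times> E) \<rho>" and g: "g ` A \<subseteq> {..<k}"
  shows "CMI A (B \<times> {..<k}) (E \<times> {..<k}) (pub g \<rho>) \<le> CMI A B E \<rho>"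
proof -
  let ?C = "{..<k}"
  let ?M = "act1 A (dephase g) \<rho>"
  have finBE: "finite (B \<times> E)" using fin by simp
  \<comment> \<open>The state of Bob and Eve with one copy of the message. The second copy always
    agrees with it and is restored by the embedding \<open>f\<close>.\<close>
  define \<kappa> where "\<kappa> = (\<lambda>(y, z, c) (y', z', c').
    if c = c' then \<Sum>x\<in>A. if g x = c then \<rho> (x, y, z) (x, y', z') else 0 else (0 :: complex))"
  note pt = pub_transport[OF fin pos g]
  have finP: "finite ((B \<times> ?C) \<times> (E \<times> ?C))" using fin by simp
  have posP: "pos ((B \<times> ?C) \<times> (E \<times> ?C)) (ptr1 A (pub g \<rho>))" by (rule pos_ptr1[OF fin(1) finP pt(2)])
  define f where "f = (\<lambda>(y, z, c). ((y, c), (z, c)) :: ('b \<times> nat) \<times> ('e \<times> nat))"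
  have ppub: "ptr1 A (pub g \<rho>) ((y, c), (z, d)) ((y', c'), (z', d')) =
      (if c = d \<and> c' = d \<and> d' = d then \<Sum>x\<in>A. if g x = d then \<rho> (x, y, z) (x, y', z') else 0 else 0)"
    for y c z d y' c' z' d'
    unfolding ptr1_def pub_def by (auto intro!: sum.cong sum.neutral)
  have on: "ptr1 A (pub g \<rho>) (f s) (f s') = \<kappa> s s'" for s s'
    by (cases s, cases s') (auto simp: f_def \<kappa>_def ppub)
  have posK: "pos (B \<times> E \<times> ?C) \<kappa>"
  proof -
    have "pos (B \<times> E \<times> ?C) (\<lambda>s s'. ptr1 A (pub g \<rho>) (f s) (f s'))"
      by (rule pos_pullback[OF posP finP]) (auto simp: f_def)
    then show ?thesis by (simp add: on)
  qed
  have e1: "ent ((B \<times> ?C) \<times> (E \<times> ?C)) (ptr1 A (pub g \<rho>)) = ent (B \<times> E \<times> ?C) \<kappa>"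
  proof (rule ent_embed[where f = f])
    show "inj_on f (B \<times> E \<times> ?C)" by (auto simp: inj_on_def f_def)
    show "f ` (B \<times> E \<times> ?C) \<subseteq> (B \<times> ?C) \<times> (E \<times> ?C)" by (auto simp: f_def)
    fix t t' assume h: "t \<in> (B \<times> ?C) \<times> (E \<times> ?C) - f ` (B \<times> E \<times> ?C)" "t' \<in> (B \<times> ?C) \<times> (E \<times> ?C)"
    obtain y c z d where t: "t = ((y, c), (z, d))" "y \<in> B" "z \<in> E" "c < k" using h by auto
    have "c \<noteq> d"
      using h(1) t image_eqI[of t f "(y, z, c)" "B \<times> E \<times> ?C"] by (auto simp: f_def)
    then show "ptr1 A (pub g \<rho>) t t' = 0 \<and> ptr1 A (pub g \<rho>) t' t = 0"
      by (cases t') (auto simp: t ppub)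
  qed (use fin posK on in auto)
  have e2: "ent (E \<times> ?C) (ptr1 (B \<times> ?C) (ptr1 A (pub g \<rho>))) = ent (E \<times> ?C) (ptr1 B \<kappa>)"
  proof (intro ent_cong)
    fix s s' assume "s \<in> E \<times> ?C" "s' \<in> E \<times> ?C"
    then obtain z d z' d' where s: "s = (z, d)" "s' = (z', d')" "d < k" by auto
    have "ptr1 (B \<times> ?C) (ptr1 A (pub g \<rho>)) s s' = (\<Sum>y\<in>B. \<Sum>c<k. if c = d then
        (if d' = d then \<Sum>x\<in>A. if g x = d then \<rho> (x, y, z) (x, y, z') else 0 else 0) else 0)"
      unfolding ptr1_def[of "B \<times> ?C"] sum_Times s by (intro sum.cong refl) (auto simp: ppub)
    then show "ptr1 (B \<times> ?C) (ptr1 A (pub g \<rho>)) s s' = ptr1 B \<kappa> s s'"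
      using \<open>d < k\<close> by (cases "d = d'") (simp_all add: s ptr1_def[of B] \<kappa>_def)
  qed
  have p3: "ptr3 ?C \<kappa> (y, z) (y', z') = ptr1 A \<rho> (y, z) (y', z')" for y z y' z'
  proof -
    have "ptr3 ?C \<kappa> (y, z) (y', z') = (\<Sum>x\<in>A. \<Sum>c<k. if c = g x then \<rho> (x, y, z) (x, y', z') else 0)"
      unfolding ptr3_def \<kappa>_def by (simp, subst sum.swap) (auto intro!: sum.cong)
    also have "\<dots> = ptr1 A \<rho> (y, z) (y', z')"
      unfolding ptr1_def using g by (intro sum.cong) auto
    finally show ?thesis .
  qed
  then have p3': "ptr3 ?C \<kappa> = ptr1 A \<rho>" by (simp add: fun_eq_iff)
  have dM: "ptr1 A ?M = ptr1 A \<rho>" by (rule ptr1_act1[OF fin(1) chan_dephase[OF fin(1) g]])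
  have "ent (B \<times> E \<times> ?C) \<kappa> + ent E (ptr1 B (ptr3 ?C \<kappa>)) \<le> ent (B \<times> E) (ptr3 ?C \<kappa>) + ent (E \<times> ?C) (ptr1 B \<kappa>)"
    by (rule strong_subadditivity[OF fin(2,3) _ posK]) simp
  then have "CMI A (B \<times> ?C) (E \<times> ?C) (pub g \<rho>) \<le> CMI A B E ?M"
    unfolding CMI_def pt(1,3) e1 e2 p3' dM by simp
  also have "\<dots> \<le> CMI A B E \<rho>"
    by (rule CMI_act1_le[OF fin(1,1,2,3) pos chan_dephase[OF fin(1) g]])
  finally show ?thesis .
qed

text \<open>\<open>W\<close> tensored with the identity channel on the message register.\<close>

definition copy_chan :: "('f \<Rightarrow> 'f \<Rightarrow> 'e \<Rightarrow> 'e \<Rightarrow> complex) \<Rightarrow> 'f \<times> nat \<Rightarrow> 'f \<times> nat \<Rightarrow> 'e \<times> nat \<Rightarrow> 'e \<times> nat \<Rightarrow> complex"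
  where "copy_chan W = (\<lambda>(f, c) (f', c') (z, d) (z', d'). if c = d \<and> c' = d' then W f f' z z' else 0)"

lemma chan_copy:
  fixes k :: nat
  assumes "chan E F W"
  shows "chan (E \<times> {..<k}) (F \<times> {..<k}) (copy_chan W)"
proof -
  obtain m :: nat and K where W: "\<And>x x' y y'. x \<in> E \<Longrightarrow> x' \<in> E \<Longrightarrow> y \<in> F \<Longrightarrow> y' \<in> F \<Longrightarrow> W y y' x x' = (\<Sum>r<m. K r y x * cnj (K r y' x'))"
    by (rule chan_kraus[OF assms(1)]) (rule that)
  show ?thesis
  proof (rule chanI[where R = "{..<m}" and K = "\<lambda>r (f, c) (z, d). if c = d then K r f z else 0"])
    fix s s' assume s: "s \<in> E \<times> {..<k}" "s' \<in> E \<times> {..<k}"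
    then obtain z d z' d' where e: "s = (z, d)" "s' = (z', d')" "z \<in> E" "z' \<in> E" "d < k" by auto
    have "(\<Sum>t\<in>F \<times> {..<k}. copy_chan W t t s s') =
        (\<Sum>f\<in>F. \<Sum>c<k. if c = d then (if d = d' then W f f z z' else 0) else 0)"
      unfolding sum_Times e by (intro sum.cong refl) (auto simp: copy_chan_def)
    also have "\<dots> = (if d = d' then \<Sum>f\<in>F. W f f z z' else 0)"
      using \<open>d < k\<close> by (cases "d = d'") simp_all
    finally show "(\<Sum>t\<in>F \<times> {..<k}. copy_chan W t t s s') =
        (if s = s' then 1 else 0)"
      using chan_trace[OF assms e(3,4)] by (cases "z = z'") (simp_all add: e)
  qed (auto simp: W copy_chan_def)
qed

lemma actE_pub:
  assumes "finite E" and t: "t \<in> A \<times> (B \<times> {..<k}) \<times> (F \<times> {..<k})" "t' \<in> A \<times> (B \<times> {..<k}) \<times> (F \<times> {..<k})"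
  shows "actE (E \<times> {..<k}) (copy_chan W) (pub g \<rho>) t t'
    = pub g (actE E W \<rho>) t t'"
proof -
  obtain x y c f d where e: "t = (x, (y, c), (f, d))" "d < k" using t by auto
  obtain x' y' c' f' d' where e': "t' = (x', (y', c'), (f', d'))" "d' < k" using t by auto
  have "actE (E \<times> {..<k}) (copy_chan W) (pub g \<rho>) t t' =
      (\<Sum>u\<in>E. \<Sum>i<k. \<Sum>v\<in>E. \<Sum>j<k. if j = d' then (if i = d then W f f' u v * pub g \<rho> (x, (y, c), (u, d)) (x', (y', c'), (v, d')) else 0) else 0)"
    unfolding actE_def e e' prod.case sum_Times by (intro sum.cong refl) (auto simp: copy_chan_def)
  also have "\<dots> = (\<Sum>u\<in>E. \<Sum>i<k. if i = d then \<Sum>v\<in>E. W f f' u v * pub g \<rho> (x, (y, c), (u, d)) (x', (y', c'), (v, d')) else 0)"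
    using e' by (intro sum.cong refl) auto
  also have "\<dots> = (\<Sum>u\<in>E. \<Sum>v\<in>E. W f f' u v * pub g \<rho> (x, (y, c), (u, d)) (x', (y', c'), (v, d')))"
    using e by simp
  also have "\<dots> = pub g (actE E W \<rho>) t t'"
    by (auto simp: e e' pub_def actE_def)
  finally show ?thesis .
qed

lemma ach_pub:
  assumes fin: "finite A" "finite B" "finite E" and pos: "pos (A \<times> B \<times> E) \<rho>" and g: "g ` A \<subseteq> {..<k}"
    and "ach A B E \<rho> c"
  shows "ach A (B \<times> {..<k}) (E \<times> {..<k}) (pub g \<rho>) c"
proof -
  obtain J :: "nat set" and W where J: "finite J" "chan E J W" "CMI A B J (actE E W \<rho>) \<le> c"
    using assms(6) by (rule achE)
  let ?W = "copy_chan W"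
  have "CMI A (B \<times> {..<k}) (J \<times> {..<k}) (actE (E \<times> {..<k}) ?W (pub g \<rho>)) =
      CMI A (B \<times> {..<k}) (J \<times> {..<k}) (pub g (actE E W \<rho>))"
    by (intro CMI_cong actE_pub[OF fin(3)])
  also have "\<dots> \<le> c"
    using CMI_pub_le[OF fin(1,2) J(1) pos_actE[OF fin J(1) pos J(2)] g] J(3) by linarith
  finally show ?thesis
    using fin J pub_transport(2)[OF fin pos g] by (intro achI[where F = "J \<times> {..<k}" and W = ?W] chan_copy) auto
qed

section \<open>Tensor products\<close>

text \<open>Eigenvalues multiply, so their logarithms split; the traces appear as weights because
  the factors need not be normalised. \<open>f\<close> regroups the indices, since the factors of a
  product of tripartite kernels come interleaved.\<close>

lemma ent_tensor:
  assumes fin: "finite S1" "finite S2" and pos: "pos S1 \<rho>1" "pos S2 \<rho>2" and f: "bij_betw f J (S1 \<times> S2)"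
    and \<tau>: "\<And>a b. a \<in> J \<Longrightarrow> b \<in> J \<Longrightarrow> \<tau> a b = \<rho>1 (fst (f a)) (fst (f b)) * \<rho>2 (snd (f a)) (snd (f b))"
  shows "ent J \<tau> = tr S2 \<rho>2 * ent S1 \<rho>1 + tr S1 \<rho>1 * ent S2 \<rho>2"
    and "pos J \<tau>" and "tr J \<tau> = tr S1 \<rho>1 * tr S2 \<rho>2"
proof -
  obtain K1 :: "nat set" and p1 u1 where s1: "spec S1 \<rho>1 K1 p1 u1" using pos_imp_spec[OF fin(1) pos(1)] by blast
  obtain K2 :: "nat set" and p2 u2 where s2: "spec S2 \<rho>2 K2 p2 u2" using pos_imp_spec[OF fin(2) pos(2)] by blast
  define \<sigma> where "\<sigma> a b = \<rho>1 (fst a) (fst b) * \<rho>2 (snd a) (snd b)" for a b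
  define p where "p k = p1 (fst k) * p2 (snd k)" for k
  define u where "u k x = u1 (fst k) (fst x) * u2 (snd k) (snd x)" for k x
  have finS: "finite (S1 \<times> S2)" using fin by simp
  have ip: "ip (S1 \<times> S2) (u k) (u l) = ip S1 (u1 (fst k)) (u1 (fst l)) * ip S2 (u2 (snd k)) (u2 (snd l))" for k l
    unfolding ip_def sum_Times sum_product by (simp add: u_def mult_ac)
  have s: "spec (S1 \<times> S2) \<sigma> (K1 \<times> K2) p u"
    unfolding spec_def
  proof (intro conjI ballI)
    have o: "ortho S1 K1 u1" "ortho S2 K2 u2" using s1 s2 by (auto simp: spec_def)
    show "ortho (S1 \<times> S2) (K1 \<times> K2) u"
      unfolding ortho_def ip by (auto simp: orthoD[OF o(1)] orthoD[OF o(2)])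
    fix x y assume "x \<in> S1 \<times> S2" "y \<in> S1 \<times> S2"
    then have "\<sigma> x y = (\<Sum>k\<in>K1. of_real (p1 k) * u1 k (fst x) * cnj (u1 k (fst y))) * (\<Sum>k\<in>K2. of_real (p2 k) * u2 k (snd x) * cnj (u2 k (snd y)))"
      using s1 s2 by (auto simp: \<sigma>_def spec_def)
    then show "\<sigma> x y = (\<Sum>k\<in>K1 \<times> K2. of_real (p k) * u k x * cnj (u k y))"
      unfolding sum_Times sum_product by (simp add: p_def u_def mult_ac)
  qed (use s1 s2 in \<open>auto simp: spec_def p_def\<close>)
  have posS: "pos (S1 \<times> S2) \<sigma>" by (rule pos_spec_imp[OF s])
  have \<tau>': "\<tau> a b = \<sigma> (f a) (f b)" if "a \<in> J" "b \<in> J" for a b using \<tau>[OF that] by (simp add: \<sigma>_def)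
  have "(\<Sum>k\<in>K1 \<times> K2. p k * ln (p k)) = (\<Sum>i\<in>K1. \<Sum>j\<in>K2. p2 j * (p1 i * ln (p1 i)) + p1 i * (p2 j * ln (p2 j)))"
    unfolding sum_Times using s1 s2 by (intro sum.cong refl) (auto simp: p_def spec_def ln_mult algebra_simps)
  also have "\<dots> = sum p2 K2 * (\<Sum>i\<in>K1. p1 i * ln (p1 i)) + sum p1 K1 * (\<Sum>j\<in>K2. p2 j * ln (p2 j))"
  proof -
    have "(\<Sum>i\<in>K1. \<Sum>j\<in>K2. p2 j * (p1 i * ln (p1 i))) = sum p2 K2 * (\<Sum>i\<in>K1. p1 i * ln (p1 i))"
      unfolding sum_product by (rule sum.swap)
    then show ?thesis by (simp only: sum.distrib sum_product)
  qed
  finally have e: "ent (S1 \<times> S2) \<sigma> = tr S2 \<rho>2 * ent S1 \<rho>1 + tr S1 \<rho>1 * ent S2 \<rho>2"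
    unfolding ent_eq[OF finS s] ent_eq[OF fin(1) s1] ent_eq[OF fin(2) s2] tr_spec[OF s1] tr_spec[OF s2]
    by (simp only: mult_minus_right minus_add_distrib)
  have "ent J \<tau> = ent J (\<lambda>a b. \<sigma> (f a) (f b))" by (rule ent_cong) (rule \<tau>')
  then show "ent J \<tau> = tr S2 \<rho>2 * ent S1 \<rho>1 + tr S1 \<rho>1 * ent S2 \<rho>2"
    using ent_reindex[OF finS posS f] e by simp
  have "pos J (\<lambda>a b. \<sigma> (f a) (f b))"
    using f by (intro pos_pullback[OF posS finS]) (auto simp: bij_betw_def)
  then show "pos J \<tau>" using pos_cong[of J \<tau> "\<lambda>a b. \<sigma> (f a) (f b)"] \<tau>' by blast
  have "(\<Sum>x\<in>J. \<tau> x x) = (\<Sum>x\<in>S1 \<times> S2. \<sigma> x x)"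
    using sum.reindex_bij_betw[OF f, of "\<lambda>x. \<sigma> x x"] \<tau>' by simp
  then have "tr J \<tau> = tr (S1 \<times> S2) \<sigma>" by (simp add: tr_def)
  also have "\<dots> = sum p1 K1 * sum p2 K2"
    unfolding tr_spec[OF s] by (simp add: sum_Times p_def sum_product)
  finally show "tr J \<tau> = tr S1 \<rho>1 * tr S2 \<rho>2" by (simp add: tr_spec[OF s1] tr_spec[OF s2])
qed

definition tens :: "('a, 'b, 'e) kern3 \<Rightarrow> ('c, 'd, 'f) kern3 \<Rightarrow> ('a \<times> 'c, 'b \<times> 'd, 'e \<times> 'f) kern3" where
  "tens \<rho> \<sigma> = (\<lambda>((x1, x2), (y1, y2), (z1, z2)) ((x1', x2'), (y1', y2'), (z1', z2')).
     \<rho> (x1, y1, z1) (x1', y1', z1') * \<sigma> (x2, y2, z2) (x2', y2', z2'))"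

lemma tens_props:
  assumes fin: "finite A1" "finite B1" "finite E1" "finite A2" "finite B2" "finite E2"
    and pos: "pos (A1 \<times> B1 \<times> E1) \<rho>1" "pos (A2 \<times> B2 \<times> E2) \<rho>2"
  shows "pos ((A1 \<times> A2) \<times> (B1 \<times> B2) \<times> (E1 \<times> E2)) (tens \<rho>1 \<rho>2)"
    and "tr ((A1 \<times> A2) \<times> (B1 \<times> B2) \<times> (E1 \<times> E2)) (tens \<rho>1 \<rho>2) = tr (A1 \<times> B1 \<times> E1) \<rho>1 * tr (A2 \<times> B2 \<times> E2) \<rho>2"
    and "CMI (A1 \<times> A2) (B1 \<times> B2) (E1 \<times> E2) (tens \<rho>1 \<rho>2) =
      tr (A2 \<times> B2 \<times> E2) \<rho>2 * CMI A1 B1 E1 \<rho>1 + tr (A1 \<times> B1 \<times> E1) \<rho>1 * CMI A2 B2 E2 \<rho>2"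
proof -
  have fins: "finite (A1 \<times> B1 \<times> E1)" "finite (A2 \<times> B2 \<times> E2)" "finite (A1 \<times> E1)" "finite (A2 \<times> E2)"
    "finite (B1 \<times> E1)" "finite (B2 \<times> E2)" using fin by auto
  let ?f = "\<lambda>((x1, x2), (y1, y2), (z1, z2)). ((x1, y1, z1), (x2, y2, z2))"
  have bij: "bij_betw ?f ((A1 \<times> A2) \<times> (B1 \<times> B2) \<times> (E1 \<times> E2)) ((A1 \<times> B1 \<times> E1) \<times> (A2 \<times> B2 \<times> E2))"
    by (rule bij_betwI[where g = "\<lambda>((x1, y1, z1), (x2, y2, z2)). ((x1, x2), (y1, y2), (z1, z2))"]) auto
  note 1 = ent_tensor[OF fins(1,2) pos bij, of "tens \<rho>1 \<rho>2"]
  have 11: "ent ((A1 \<times> A2) \<times> (B1 \<times> B2) \<times> (E1 \<times> E2)) (tens \<rho>1 \<rho>2) =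
      tr (A2 \<times> B2 \<times> E2) \<rho>2 * ent (A1 \<times> B1 \<times> E1) \<rho>1 + tr (A1 \<times> B1 \<times> E1) \<rho>1 * ent (A2 \<times> B2 \<times> E2) \<rho>2"
    by (rule 1(1)) (auto simp: tens_def)
  show "pos ((A1 \<times> A2) \<times> (B1 \<times> B2) \<times> (E1 \<times> E2)) (tens \<rho>1 \<rho>2)"
    by (rule 1(2)) (auto simp: tens_def)
  show "tr ((A1 \<times> A2) \<times> (B1 \<times> B2) \<times> (E1 \<times> E2)) (tens \<rho>1 \<rho>2) = tr (A1 \<times> B1 \<times> E1) \<rho>1 * tr (A2 \<times> B2 \<times> E2) \<rho>2"
    by (rule 1(3)) (auto simp: tens_def)
  let ?g = "\<lambda>((x1, x2), (z1, z2)). ((x1, z1), (x2, z2))"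
  have bijg: "bij_betw ?g ((S1 \<times> S2) \<times> (E1 \<times> E2)) ((S1 \<times> E1) \<times> (S2 \<times> E2))" for S1 S2
    by (rule bij_betwI[where g = "\<lambda>((x1, z1), (x2, z2)). ((x1, x2), (z1, z2))"]) auto
  have mAE: "mAE (B1 \<times> B2) (tens \<rho>1 \<rho>2) ((x1, x2), (z1, z2)) ((x1', x2'), (z1', z2')) =
      mAE B1 \<rho>1 (x1, z1) (x1', z1') * mAE B2 \<rho>2 (x2, z2) (x2', z2')" for x1 x2 z1 z2 x1' x2' z1' z2'
    unfolding mAE_def prod.case sum_product sum_Times by (simp add: tens_def)
  have p1: "ptr1 (A1 \<times> A2) (tens \<rho>1 \<rho>2) ((y1, y2), (z1, z2)) ((y1', y2'), (z1', z2')) =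
      ptr1 A1 \<rho>1 (y1, z1) (y1', z1') * ptr1 A2 \<rho>2 (y2, z2) (y2', z2')" for y1 y2 z1 z2 y1' y2' z1' z2'
    unfolding ptr1_def sum_product sum_Times by (simp add: tens_def)
  have p2: "ptr1 (B1 \<times> B2) (ptr1 (A1 \<times> A2) (tens \<rho>1 \<rho>2)) (z1, z2) (z1', z2') =
      ptr1 B1 (ptr1 A1 \<rho>1) z1 z1' * ptr1 B2 (ptr1 A2 \<rho>2) z2 z2'" for z1 z2 z1' z2'
    unfolding ptr1_def[of "B1 \<times> B2"] sum_Times p1 by (simp add: ptr1_def[of B1] ptr1_def[of B2] sum_product)
  have 2: "ent ((A1 \<times> A2) \<times> (E1 \<times> E2)) (mAE (B1 \<times> B2) (tens \<rho>1 \<rho>2)) =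
      tr (A2 \<times> B2 \<times> E2) \<rho>2 * ent (A1 \<times> E1) (mAE B1 \<rho>1) + tr (A1 \<times> B1 \<times> E1) \<rho>1 * ent (A2 \<times> E2) (mAE B2 \<rho>2)"
    unfolding tr_mAE[symmetric, of A1 B1] tr_mAE[symmetric, of A2 B2]
    by (rule ent_tensor(1)[OF fins(3,4) pos_mAE[OF fin(1-3) pos(1)] pos_mAE[OF fin(4-6) pos(2)] bijg]) (auto simp: mAE)
  have 3: "ent ((B1 \<times> B2) \<times> (E1 \<times> E2)) (ptr1 (A1 \<times> A2) (tens \<rho>1 \<rho>2)) =
      tr (A2 \<times> B2 \<times> E2) \<rho>2 * ent (B1 \<times> E1) (ptr1 A1 \<rho>1) + tr (A1 \<times> B1 \<times> E1) \<rho>1 * ent (B2 \<times> E2) (ptr1 A2 \<rho>2)"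
    unfolding tr_ptr1[of "B1 \<times> E1" A1, symmetric] tr_ptr1[of "B2 \<times> E2" A2, symmetric]
    by (rule ent_tensor(1)[OF fins(5,6) pos_ptr1[OF fin(1) fins(5) pos(1)] pos_ptr1[OF fin(4) fins(6) pos(2)] bijg]) (auto simp: p1)
  have 4: "ent (E1 \<times> E2) (ptr1 (B1 \<times> B2) (ptr1 (A1 \<times> A2) (tens \<rho>1 \<rho>2))) =
      tr (A2 \<times> B2 \<times> E2) \<rho>2 * ent E1 (ptr1 B1 (ptr1 A1 \<rho>1)) + tr (A1 \<times> B1 \<times> E1) \<rho>1 * ent E2 (ptr1 B2 (ptr1 A2 \<rho>2))"
    unfolding tr_ptr1[of "B1 \<times> E1" A1, symmetric] tr_ptr1[of "B2 \<times> E2" A2, symmetric]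
      tr_ptr1[of E1 B1, symmetric] tr_ptr1[of E2 B2, symmetric]
    by (rule ent_tensor(1)[OF fin(3,6) _ _ bij_betw_id])
      (auto simp: p2 intro!: pos_ptr1[OF fin(2,3)] pos_ptr1[OF fin(5,6)] pos_ptr1[OF fin(1) fins(5) pos(1)] pos_ptr1[OF fin(4) fins(6) pos(2)])
  show "CMI (A1 \<times> A2) (B1 \<times> B2) (E1 \<times> E2) (tens \<rho>1 \<rho>2) =
      tr (A2 \<times> B2 \<times> E2) \<rho>2 * CMI A1 B1 E1 \<rho>1 + tr (A1 \<times> B1 \<times> E1) \<rho>1 * CMI A2 B2 E2 \<rho>2"
    unfolding CMI_def 11 2 3 4 by (simp add: algebra_simps)
qed

definition tens_chan where
  "tens_chan W1 W2 = (\<lambda>(f1, f2) (f1', f2') (z1, z2) (z1', z2'). W1 f1 f1' z1 z1' * W2 f2 f2' z2 z2' :: complex)"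

lemma chan_tens:
  assumes "chan E1 F1 W1" "chan E2 F2 W2"
  shows "chan (E1 \<times> E2) (F1 \<times> F2) (tens_chan W1 W2)"
proof -
  obtain m :: nat and K where W1: "\<And>x x' y y'. x \<in> E1 \<Longrightarrow> x' \<in> E1 \<Longrightarrow> y \<in> F1 \<Longrightarrow> y' \<in> F1 \<Longrightarrow> W1 y y' x x' = (\<Sum>r<m. K r y x * cnj (K r y' x'))"
    by (rule chan_kraus[OF assms(1)]) (rule that)
  obtain n :: nat and L where W2: "\<And>x x' y y'. x \<in> E2 \<Longrightarrow> x' \<in> E2 \<Longrightarrow> y \<in> F2 \<Longrightarrow> y' \<in> F2 \<Longrightarrow> W2 y y' x x' = (\<Sum>r<n. L r y x * cnj (L r y' x'))"
    by (rule chan_kraus[OF assms(2)]) (rule that)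
  show ?thesis
  proof (rule chanI[where R = "{..<m} \<times> {..<n}" and K = "\<lambda>(r, q) (f1, f2) (z1, z2). K r f1 z1 * L q f2 z2"])
    fix s s' assume "s \<in> E1 \<times> E2" "s' \<in> E1 \<times> E2"
    then obtain z1 z2 z1' z2' where e: "s = (z1, z2)" "s' = (z1', z2')" "z1 \<in> E1" "z2 \<in> E2" "z1' \<in> E1" "z2' \<in> E2" by auto
    have "(\<Sum>t\<in>F1 \<times> F2. tens_chan W1 W2 t t s s') =
        (\<Sum>f\<in>F1. W1 f f z1 z1') * (\<Sum>f\<in>F2. W2 f f z2 z2')"
      unfolding sum_Times sum_product e by (simp add: tens_chan_def)
    then show "(\<Sum>t\<in>F1 \<times> F2. tens_chan W1 W2 t t s s') =
        (if s = s' then 1 else 0)"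
      using chan_trace[OF assms(1) e(3,5)] chan_trace[OF assms(2) e(4,6)] by (simp add: e)
  next
    fix s s' t t' assume "s \<in> E1 \<times> E2" "s' \<in> E1 \<times> E2" "t \<in> F1 \<times> F2" "t' \<in> F1 \<times> F2"
    then show "tens_chan W1 W2 t t' s s' =
        (\<Sum>r\<in>{..<m} \<times> {..<n}. (\<lambda>(r, q) (f1, f2) (z1, z2). K r f1 z1 * L q f2 z2) r t s * cnj ((\<lambda>(r, q) (f1, f2) (z1, z2). K r f1 z1 * L q f2 z2) r t' s'))"
      by (auto simp: tens_chan_def W1 W2 sum_Times sum_product mult_ac)
  qed simp
qed

lemma actE_tens:
  "actE (E1 \<times> E2) (tens_chan W1 W2) (tens \<rho>1 \<rho>2)
    = tens (actE E1 W1 \<rho>1) (actE E2 W2 \<rho>2)"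
proof (intro ext, clarify)
  fix x1 x2 y1 y2 f1 f2 x1' x2' y1' y2' f1' f2'
  have "actE (E1 \<times> E2) (tens_chan W1 W2) (tens \<rho>1 \<rho>2)
      ((x1, x2), (y1, y2), (f1, f2)) ((x1', x2'), (y1', y2'), (f1', f2')) =
      (\<Sum>u1\<in>E1. \<Sum>u2\<in>E2. \<Sum>v1\<in>E1. \<Sum>v2\<in>E2. (W1 f1 f1' u1 v1 * \<rho>1 (x1, y1, u1) (x1', y1', v1)) * (W2 f2 f2' u2 v2 * \<rho>2 (x2, y2, u2) (x2', y2', v2)))"
    by (simp add: actE_def tens_def tens_chan_def sum_Times mult_ac)
  also have "\<dots> = (\<Sum>u1\<in>E1. \<Sum>v1\<in>E1. \<Sum>u2\<in>E2. \<Sum>v2\<in>E2. (W1 f1 f1' u1 v1 * \<rho>1 (x1, y1, u1) (x1', y1', v1)) * (W2 f2 f2' u2 v2 * \<rho>2 (x2, y2, u2) (x2', y2', v2)))"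
    by (intro sum.cong refl sum.swap)
  also have "\<dots> = (\<Sum>u1\<in>E1. \<Sum>v1\<in>E1. W1 f1 f1' u1 v1 * \<rho>1 (x1, y1, u1) (x1', y1', v1)) * (\<Sum>u2\<in>E2. \<Sum>v2\<in>E2. W2 f2 f2' u2 v2 * \<rho>2 (x2, y2, u2) (x2', y2', v2))"
    by (simp only: sum_distrib_right) (simp only: sum_distrib_left)
  finally show "actE (E1 \<times> E2) (tens_chan W1 W2) (tens \<rho>1 \<rho>2)
      ((x1, x2), (y1, y2), (f1, f2)) ((x1', x2'), (y1', y2'), (f1', f2')) =
      tens (actE E1 W1 \<rho>1) (actE E2 W2 \<rho>2) ((x1, x2), (y1, y2), (f1, f2)) ((x1', x2'), (y1', y2'), (f1', f2'))"
    by (simp add: tens_def actE_def)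
qed

text \<open>The product channel serves. Both outputs have trace 1, so the weights in
  \<open>tens_props\<close> are 1 and the values add.\<close>

lemma ach_tens:
  assumes fin: "finite A1" "finite B1" "finite E1" "finite A2" "finite B2" "finite E2"
    and pos: "pos (A1 \<times> B1 \<times> E1) \<rho>1" "pos (A2 \<times> B2 \<times> E2) \<rho>2"
    and t: "tr (A1 \<times> B1 \<times> E1) \<rho>1 = 1" "tr (A2 \<times> B2 \<times> E2) \<rho>2 = 1"
    and a: "ach A1 B1 E1 \<rho>1 c1" "ach A2 B2 E2 \<rho>2 c2"
  shows "ach (A1 \<times> A2) (B1 \<times> B2) (E1 \<times> E2) (tens \<rho>1 \<rho>2) (c1 + c2)"
proof -
  obtain J1 :: "nat set" and W1 where J1: "finite J1" "chan E1 J1 W1" "CMI A1 B1 J1 (actE E1 W1 \<rho>1) \<le> c1"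
    using a(1) by (rule achE)
  obtain J2 :: "nat set" and W2 where J2: "finite J2" "chan E2 J2 W2" "CMI A2 B2 J2 (actE E2 W2 \<rho>2) \<le> c2"
    using a(2) by (rule achE)
  let ?W = "tens_chan W1 W2"
  have "CMI (A1 \<times> A2) (B1 \<times> B2) (J1 \<times> J2) (actE (E1 \<times> E2) ?W (tens \<rho>1 \<rho>2)) \<le> c1 + c2"
    unfolding actE_tens
    using tens_props(3)[OF fin(1,2) J1(1) fin(4,5) J2(1) pos_actE[OF fin(1-3) J1(1) pos(1) J1(2)] pos_actE[OF fin(4-6) J2(1) pos(2) J2(2)]]
      J1(3) J2(3) by (simp add: tr_actE[OF fin(3) J1(2)] tr_actE[OF fin(6) J2(2)] t)
  then show ?thesis
    using fin J1(1) J2(1) tens_props(1)[OF fin pos]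
    by (intro achI[where F = "J1 \<times> J2" and W = ?W] chan_tens J1(2) J2(2)) auto
qed

section \<open>Matrices and kernels\<close>

definition ker :: "complex mat \<Rightarrow> nat \<Rightarrow> nat \<Rightarrow> complex" where
  "ker M = (\<lambda>i j. M $$ (i, j))"

fun idx :: "dims \<Rightarrow> (nat \<times> nat \<times> nat) set" where
  "idx (a, b, e) = {..<a} \<times> {..<b} \<times> {..<e}"

lemma quad_mat:
  assumes "M \<in> carrier_mat n n"
  shows "(M *\<^sub>v vec n v) \<bullet>c vec n v = quad {..<n} (ker M) v"
  using assms by (simp add: scalar_prod_def quad_def ker_def atLeast0LessThan sum_distrib_right sum_distrib_left mult_ac)

lemma psd_iff_pos: "psd n M \<longleftrightarrow> M \<in> carrier_mat n n \<and> pos {..<n} (ker M)"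
proof (cases "M \<in> carrier_mat n n")
  case True
  have "(\<forall>w\<in>carrier_vec n. 0 \<le> (M *\<^sub>v w) \<bullet>c w) \<longleftrightarrow> (\<forall>v. 0 \<le> (M *\<^sub>v vec n v) \<bullet>c vec n v)"
  proof
    assume h: "\<forall>v. 0 \<le> (M *\<^sub>v vec n v) \<bullet>c vec n v"
    show "\<forall>w\<in>carrier_vec n. 0 \<le> (M *\<^sub>v w) \<bullet>c w"
    proof
      fix w :: "complex vec" assume "w \<in> carrier_vec n"
      then have "vec n (\<lambda>i. w $ i) = w" by auto
      then show "0 \<le> (M *\<^sub>v w) \<bullet>c w" using h by metis
    qed
  qed simp
  then show ?thesis using True by (simp add: psd_def pos_def quad_mat)
qed (simp add: psd_def)

text \<open>The eigenvalue 0 contributes nothing on either side, as 0 log 0 = 0; the division by ln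
  2 converts nats to bits.\<close>

lemma vN_entropy_eq_ent:
  assumes "psd n M"
  shows "vN_entropy M = ent {..<n} (ker M) / ln 2"
proof -
  have M: "M \<in> carrier_mat n n" and pos: "pos {..<n} (ker M)" using assms by (auto simp: psd_iff_pos)
  obtain d u where u: "ortho {..<n} {..<n} u"
    and dec: "\<And>x y. x < n \<Longrightarrow> y < n \<Longrightarrow> ker M x y = (\<Sum>k<n. of_real (d k) * u k x * cnj (u k y))"
    by (rule hermitian_diagonalization[OF pos_herm[OF finite_lessThan pos]]) blast
  note ds = diagonal_spec[OF pos u dec]
  have "vN_entropy M = - (\<Sum>k<n. d k * log 2 (d k))"
    unfolding vN_entropy_def using dec by (subst trace_fun_diagonal[OF M u]) (auto simp: ker_def)
  also have "\<dots> = - (\<Sum>k<n. d k * ln (d k)) / ln 2"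
    by (simp add: log_def sum_divide_distrib)
  also have "(\<Sum>k<n. d k * ln (d k)) = (\<Sum>k\<in>{k. k < n \<and> 0 < d k}. d k * ln (d k))"
    using ds(1) by (intro sum.mono_neutral_right) (auto simp: le_less)
  finally show ?thesis using ent_eq[OF finite_lessThan ds(2)] by simp
qed

text \<open>Used mostly with \<open>h\<close> an encoding of a product index set, so that entropies
  of numbered matrices become entropies of kernels on products.\<close>

lemma vN_entropy_bij:
  assumes M: "M \<in> carrier_mat n n" and h: "bij_betw h I {..<n}"
    and pos: "pos I \<kappa>" and \<kappa>: "\<And>s s'. s \<in> I \<Longrightarrow> s' \<in> I \<Longrightarrow> M $$ (h s, h s') = \<kappa> s s'"
  shows "vN_entropy M = ent I \<kappa> / ln 2"
proof -
  have fin: "finite I" using h bij_betw_finite by blast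
  have inv: "bij_betw (inv_into I h) {..<n} I" by (rule bij_betw_inv_into[OF h])
  have "pos {..<n} (\<lambda>i j. \<kappa> (inv_into I h i) (inv_into I h j))"
    using inv by (intro pos_pullback[OF pos fin]) (auto simp: bij_betw_def)
  moreover have eq: "ker M i j = \<kappa> (inv_into I h i) (inv_into I h j)" if "i \<in> {..<n}" "j \<in> {..<n}" for i j
  proof -
    have "inv_into I h i \<in> I" "inv_into I h j \<in> I" "h (inv_into I h i) = i" "h (inv_into I h j) = j"
      using that h by (auto simp: bij_betw_def f_inv_into_f inv_into_into)
    then show ?thesis using \<kappa> by (metis ker_def)
  qed
  ultimately have "pos {..<n} (ker M)"
    using pos_cong[of "{..<n}" "ker M" "\<lambda>i j. \<kappa> (inv_into I h i) (inv_into I h j)"] by blast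
  then have "vN_entropy M = ent {..<n} (ker M) / ln 2"
    using M by (intro vN_entropy_eq_ent) (simp add: psd_iff_pos)
  also have "ent {..<n} (ker M) = ent {..<n} (\<lambda>i j. \<kappa> (inv_into I h i) (inv_into I h j))"
    by (rule ent_cong) (rule eq)
  also have "\<dots> = ent I \<kappa>" by (rule ent_reindex[OF fin pos inv])
  finally show ?thesis .
qed

lemma pair_less: "x < a \<Longrightarrow> z < e \<Longrightarrow> x * e + z < a * (e::nat)"
proof -
  assume "x < a" "z < e"
  then have "x * e + z < Suc x * e" by simp
  also have "\<dots> \<le> a * e" using \<open>x < a\<close> by (intro mult_le_mono1) simp
  finally show ?thesis .
qed

lemma bij_pair: "bij_betw (\<lambda>(x, z). x * e + z) ({..<a} \<times> {..<e}) {..<a * (e::nat)}"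
proof (rule bij_betwI[where g = "\<lambda>i. (i div e, i mod e)"])
  show "(\<lambda>i. (i div e, i mod e)) \<in> {..<a * e} \<rightarrow> {..<a} \<times> {..<e}"
    by (auto simp: less_mult_imp_div_less) (metis mod_less_divisor gr0I mult_0_right not_less0)
qed (auto simp: pair_less)

lemma enc_eq: "enc (a, b, e) = (\<lambda>(x, y, z). (x * b + y) * e + z)"
  by auto

lemma bij_enc: "bij_betw (enc (a, b, e)) (idx (a, b, e)) {..<a * b * e}"
proof -
  have "bij_betw ((\<lambda>(x, z). x * e + z) \<circ> map_prod (\<lambda>(x, y). x * b + y) id) (({..<a} \<times> {..<b}) \<times> {..<e}) {..<a * b * e}"
    by (rule bij_betw_trans[OF bij_betw_map_prod[OF bij_pair bij_betw_id] bij_pair])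
  moreover have "bij_betw (\<lambda>(x, y, z). ((x, y), z)) ({..<a} \<times> {..<b} \<times> {..<e}) (({..<a} \<times> {..<b}) \<times> {..<e})"
    by (rule bij_betwI[where g = "\<lambda>((x, y), z). (x, y, z)"]) auto
  ultimately have "bij_betw ((\<lambda>(x, z). x * e + z) \<circ> map_prod (\<lambda>(x, y). x * b + y) id \<circ> (\<lambda>(x, y, z). ((x, y), z)))
      ({..<a} \<times> {..<b} \<times> {..<e}) {..<a * b * e}"
    by (rule bij_betw_trans[rotated])
  then show ?thesis by (simp add: comp_def case_prod_unfold enc_eq del: enc.simps)
qed

lemma enc_less: "s \<in> idx (a, b, e) \<Longrightarrow> enc (a, b, e) s < a * b * e"
  using bij_enc[of a b e] by (auto simp: bij_betw_def)

lemma dec_enc: "s \<in> idx (a, b, e) \<Longrightarrow> dec (a, b, e) (enc (a, b, e) s) = s"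
proof -
  assume "s \<in> idx (a, b, e)"
  then obtain x y z where s: "s = (x, y, z)" "x < a" "y < b" "z < e" by auto
  let ?t = "(x * b + y) * e + z"
  have 1: "?t div e = x * b + y" using s by simp
  have "?t div (b * e) = ?t div e div b" by (subst mult.commute) (rule div_mult2_eq)
  also have "\<dots> = x" unfolding 1 using s by simp
  finally have 2: "?t div (b * e) = x" .
  show ?thesis using s 1 2 by simp
qed

lemma mat3_carrier: "mat3 D f \<in> carrier_mat (dim3 D) (dim3 D)"
  by (simp add: mat3_def)

lemma entry3_mat3: "s \<in> idx D \<Longrightarrow> t \<in> idx D \<Longrightarrow> entry3 D (mat3 D f) s t = f s t"
  by (cases D) (simp add: entry3_def mat3_def enc_less dec_enc del: enc.simps dec.simps idx.simps)

lemma entry3_pos: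
  assumes "psd (a * b * e) M"
  shows "pos ({..<a} \<times> {..<b} \<times> {..<e}) (entry3 (a, b, e) M)"
proof -
  have "pos (idx (a, b, e)) (\<lambda>s s'. ker M (enc (a, b, e) s) (enc (a, b, e) s'))"
  proof (rule pos_pullback)
    show "pos {..<a * b * e} (ker M)" using assms by (simp add: psd_iff_pos)
    show "enc (a, b, e) ` idx (a, b, e) \<subseteq> {..<a * b * e}" using enc_less by blast
  qed simp
  then show ?thesis by (simp add: ker_def entry3_def[abs_def])
qed

lemma entry3_1: "entry3 (1, a, b * e) M (0, x, y * e + z) (0, x', y' * e + z') = entry3 (a, b, e) M (x, y, z) (x', y', z')"
  by (simp add: entry3_def algebra_simps)

lemma entry3_2: "entry3 (a * b, e, 1) M (x * b + y, z, 0) (x' * b + y', z', 0) = entry3 (a, b, e) M (x, y, z) (x', y', z')"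
  by (simp add: entry3_def)

lemma sum_pair: "(\<Sum>w<a * b. f w) = (\<Sum>x<a. \<Sum>y<b. f (x * b + y :: nat))"
  using sum.reindex_bij_betw[OF bij_pair[of b a], of f, symmetric]
  by (simp add: sum_Times)

lemma cond_mutual_info_eq_CMI:
  assumes "psd (a * b * e) M"
  shows "cond_mutual_info (a, b, e) M = CMI {..<a} {..<b} {..<e} (entry3 (a, b, e) M) / ln 2"
proof -
  let ?A = "{..<a}" and ?B = "{..<b}" and ?E = "{..<e}" and ?\<rho> = "entry3 (a, b, e) M"
  have M: "M \<in> carrier_mat (a * b * e) (a * b * e)" using assms by (simp add: psd_def)
  have fin: "finite ?A" "finite ?B" "finite ?E" "finite (?B \<times> ?E)" by auto
  note pos = entry3_pos[OF assms]
  have 1: "vN_entropy M = ent (?A \<times> ?B \<times> ?E) ?\<rho> / ln 2"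
    by (rule vN_entropy_bij[OF M bij_enc[unfolded idx.simps] pos]) (simp add: entry3_def)
  have 2: "vN_entropy (ptrace (a, b, e) M) = ent (?A \<times> ?E) (mAE ?B ?\<rho>) / ln 2"
  proof (rule vN_entropy_bij[OF _ bij_pair[of e a] pos_mAE[OF fin(1-3) pos]])
    fix s s' assume "s \<in> ?A \<times> ?E" "s' \<in> ?A \<times> ?E"
    then show "ptrace (a, b, e) M $$ ((\<lambda>(x, z). x * e + z) s, (\<lambda>(x, z). x * e + z) s') = mAE ?B ?\<rho> s s'"
      by (auto simp: mAE_def pair_less)
  qed simp
  have 3: "vN_entropy (ptrace (1, a, b * e) M) = ent (?B \<times> ?E) (ptr1 ?A ?\<rho>) / ln 2"
  proof (rule vN_entropy_bij[OF _ bij_pair[of e b] pos_ptr1[OF fin(1,4) pos]])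
    fix s s' assume "s \<in> ?B \<times> ?E" "s' \<in> ?B \<times> ?E"
    then obtain y z y' z' where e: "s = (y, z)" "s' = (y', z')" "y < b" "z < e" "y' < b" "z' < e" by auto
    have l: "y * e + z < b * e" "y' * e + z' < b * e" using e pair_less by auto
    have "ptrace (1, a, b * e) M $$ (y * e + z, y' * e + z') =
        (\<Sum>x<a. entry3 (1, a, b * e) M (0, x, y * e + z) (0, x, y' * e + z'))"
      using l by simp
    then show "ptrace (1, a, b * e) M $$ ((\<lambda>(x, z). x * e + z) s, (\<lambda>(x, z). x * e + z) s') = ptr1 ?A ?\<rho> s s'"
      unfolding entry3_1 by (simp add: e ptr1_def)
  qed simp
  have 4: "vN_entropy (ptrace (1, a * b, e) M) = ent ?E (ptr1 ?B (ptr1 ?A ?\<rho>)) / ln 2"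
  proof (rule vN_entropy_bij[OF _ bij_betw_id pos_ptr1[OF fin(2,3) pos_ptr1[OF fin(1,4) pos]]])
    fix z z' assume "z \<in> ?E" "z' \<in> ?E"
    then have "ptrace (1, a * b, e) M $$ (z, z') = (\<Sum>x<a. \<Sum>y<b. ?\<rho> (x, y, z) (x, y, z'))"
      by (simp add: sum_pair entry3_def)
    also have "\<dots> = ptr1 ?B (ptr1 ?A ?\<rho>) z z'"
      unfolding ptr1_def by (rule sum.swap)
    finally show "ptrace (1, a * b, e) M $$ (id z, id z') = ptr1 ?B (ptr1 ?A ?\<rho>) z z'" by simp
  qed simp
  show ?thesis
    unfolding cond_mutual_info.simps 1 2 3 4 CMI_def by (simp add: diff_divide_distrib add_divide_distrib)
qed

section \<open>Completely positive maps\<close>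

definition munit :: "nat \<Rightarrow> nat \<times> nat \<Rightarrow> complex mat" where
  "munit d p = mat d d (\<lambda>q. if q = p then 1 else 0)"

text \<open>Additivity is given for two summands only, so the expansion in matrix units is an
  induction over the set \<open>F\<close> of entries kept in \<open>R F\<close>.\<close>

lemma linear_map_entry:
  assumes carr: "\<And>A. A \<in> carrier_mat d d \<Longrightarrow> \<Lambda> A \<in> carrier_mat d' d'"
    and add: "\<And>A B. A \<in> carrier_mat d d \<Longrightarrow> B \<in> carrier_mat d d \<Longrightarrow> \<Lambda> (A + B) = \<Lambda> A + \<Lambda> B"
    and scale: "\<And>c A. A \<in> carrier_mat d d \<Longrightarrow> \<Lambda> (c \<cdot>\<^sub>m A) = c \<cdot>\<^sub>m \<Lambda> A"
    and A: "A \<in> carrier_mat d d" and y: "y < d'" "y' < d'"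
  shows "\<Lambda> A $$ (y, y') = (\<Sum>u<d. \<Sum>v<d. \<Lambda> (munit d (u, v)) $$ (y, y') * A $$ (u, v))"
proof -
  define R where "R F = mat d d (\<lambda>q. if q \<in> F then A $$ q else 0)" for F
  have c: "R F \<in> carrier_mat d d" "munit d p \<in> carrier_mat d d" for F p by (auto simp: R_def munit_def)
  have "\<Lambda> (R F) $$ (y, y') = (\<Sum>p\<in>F. \<Lambda> (munit d p) $$ (y, y') * A $$ p)" if "finite F" for F
    using that
  proof (induction F)
    case empty
    have "R {} = 0 \<cdot>\<^sub>m R {}" by (intro eq_matI) (auto simp: R_def)
    then have "\<Lambda> (R {}) = 0 \<cdot>\<^sub>m \<Lambda> (R {})" using scale[OF c(1)] by metis
    moreover have "(0 \<cdot>\<^sub>m \<Lambda> (R {})) $$ (y, y') = 0" using carr[OF c(1), of "{}"] y by simp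
    ultimately show ?case by simp
  next
    case (insert p F)
    have "R (insert p F) = R F + A $$ p \<cdot>\<^sub>m munit d p"
      using insert(2) by (intro eq_matI) (auto simp: R_def munit_def)
    then have "\<Lambda> (R (insert p F)) = \<Lambda> (R F) + A $$ p \<cdot>\<^sub>m \<Lambda> (munit d p)"
      using add[OF c(1)] scale[OF c(2)] c by simp
    then show ?case
      using insert carr[OF c(1)] carr[OF c(2), of p] y by (simp add: mult.commute add.commute)
  qed
  from this[of "{..<d} \<times> {..<d}"] have "\<Lambda> (R ({..<d} \<times> {..<d})) $$ (y, y') = (\<Sum>u<d. \<Sum>v<d. \<Lambda> (munit d (u, v)) $$ (y, y') * A $$ (u, v))"
    by (simp add: sum_Times)
  moreover have "R ({..<d} \<times> {..<d}) = A" using A by (intro eq_matI) (auto simp: R_def)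
  ultimately show ?thesis by simp
qed

text \<open>The Kraus operators come from the spectral decomposition of the Choi matrix, the image of the
  unnormalised maximally entangled state.\<close>

lemma cptp_chan:
  assumes "cptp d d' \<Lambda>"
  obtains W where "chan {..<d} {..<d'} W"
    "\<And>A y y'. A \<in> carrier_mat d d \<Longrightarrow> y < d' \<Longrightarrow> y' < d' \<Longrightarrow> \<Lambda> A $$ (y, y') = (\<Sum>u<d. \<Sum>v<d. W y y' u v * A $$ (u, v))"
proof -
  have carr: "\<And>A. A \<in> carrier_mat d d \<Longrightarrow> \<Lambda> A \<in> carrier_mat d' d'"
    and add: "\<And>A B. A \<in> carrier_mat d d \<Longrightarrow> B \<in> carrier_mat d d \<Longrightarrow> \<Lambda> (A + B) = \<Lambda> A + \<Lambda> B"
    and scale: "\<And>c A. A \<in> carrier_mat d d \<Longrightarrow> \<Lambda> (c \<cdot>\<^sub>m A) = c \<cdot>\<^sub>m \<Lambda> A"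
    and trp: "\<And>A. A \<in> carrier_mat d d \<Longrightarrow> mtrace (\<Lambda> A) = mtrace A"
    and cp: "\<And>M. psd (d * d) M \<Longrightarrow> psd (d * d') (extend d 1 d d' \<Lambda> M)"
    using assms unfolding cptp_def by auto
  define W where "W y y' u v = \<Lambda> (munit d (u, v)) $$ (y, y')" for y y' u v
  \<comment> \<open>The index i stands for the pair (i div d, i mod d), so \<open>M\<close> is the
    rank-one operator of the sum of all e_j \<otimes> e_j.\<close>
  define M where "M = mat (d * d) (d * d) (\<lambda>(i, j). if i div d = i mod d \<and> j div d = j mod d then 1 else 0 :: complex)"
  have cu: "munit d p \<in> carrier_mat d d" for p by (simp add: munit_def)
  have psdM: "psd (d * d) M"
    unfolding psd_iff_pos pos_def
  proof (intro conjI allI)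
    show "M \<in> carrier_mat (d * d) (d * d)" by (simp add: M_def)
    fix v :: "nat \<Rightarrow> complex"
    let ?s = "\<Sum>j<d * d. if j div d = j mod d then v j else 0"
    have "quad {..<d * d} (ker M) v = cnj ?s * ?s"
      unfolding quad_def cnj_sum sum_product by (intro sum.cong refl) (auto simp: ker_def M_def)
    also have "\<dots> = of_real ((cmod ?s)\<^sup>2)" unfolding complex_norm_square by (simp only: mult.commute)
    finally show "0 \<le> quad {..<d * d} (ker M) v" by (simp only: of_real_nonneg_complex zero_le_power2)
  qed
  let ?N = "extend d 1 d d' \<Lambda> M"
  have N: "entry3 (d, d', 1) ?N (x, y, 0) (x', y', 0) = W y y' x x'"
    if "x < d" "y < d'" "x' < d" "y' < d'" for x y x' y'
  proof -
    \<comment> \<open>The block of \<open>M\<close> at outer indices x, x' is a matrix unit, so one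
      application of \<open>extend\<close> evaluates \<open>\<Lambda>\<close> on all of
      them.\<close>
    have "mat d d (\<lambda>(u, v). entry3 (d, d, 1) M (x, u, 0) (x', v, 0)) = munit d (x, x')"
      using that by (intro eq_matI) (auto simp: entry3_def M_def munit_def pair_less)
    then show ?thesis
      unfolding extend_def using that by (subst entry3_mat3) (auto simp: W_def)
  qed
  have "pos ({..<d} \<times> {..<d'} \<times> {..<1}) (entry3 (d, d', 1) ?N)"
    using cp[OF psdM] by (intro entry3_pos) simp
  then have posN: "pos ({..<d} \<times> {..<d'}) (\<lambda>s s'. entry3 (d, d', 1) ?N (fst s, snd s, 0) (fst s', snd s', 0))"
    by (rule pos_pullback[where f = "\<lambda>s. (fst s, snd s, 0)"]) auto
  then obtain K :: "nat set" and p u where sp: "spec ({..<d} \<times> {..<d'}) (\<lambda>s s'. entry3 (d, d', 1) ?N (fst s, snd s, 0) (fst s', snd s', 0)) K p u"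
    using pos_imp_spec[OF finite_cartesian_product[OF finite_lessThan finite_lessThan] posN] by blast
  \<comment> \<open>The positive weight \<open>p r\<close> is split as a square: the Kraus operator
    is sqrt (p r) times the eigenvector \<open>u r\<close> read as a matrix.\<close>
  have W: "W y y' x x' = (\<Sum>r\<in>K. (of_real (sqrt (p r)) * u r (x, y)) * cnj (of_real (sqrt (p r)) * u r (x', y')))"
    if "x < d" "y < d'" "x' < d" "y' < d'" for x y x' y'
  proof -
    have "W y y' x x' = (\<Sum>r\<in>K. of_real (p r) * u r (x, y) * cnj (u r (x', y')))"
      using sp that N[OF that] by (auto simp: spec_def)
    also have "\<dots> = (\<Sum>r\<in>K. (of_real (sqrt (p r)) * u r (x, y)) * cnj (of_real (sqrt (p r)) * u r (x', y')))"
    proof (intro sum.cong refl)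
      fix r assume "r \<in> K"
      then have "complex_of_real (p r) = of_real (sqrt (p r)) * of_real (sqrt (p r))"
        using sp by (simp add: spec_def less_imp_le flip: of_real_mult)
      then show "of_real (p r) * u r (x, y) * cnj (u r (x', y')) = (of_real (sqrt (p r)) * u r (x, y)) * cnj (of_real (sqrt (p r)) * u r (x', y'))"
        by (simp add: mult_ac)
    qed
    finally show ?thesis .
  qed
  have TP: "(\<Sum>y<d'. W y y x x') = (if x = x' then 1 else 0)" if "x < d" "x' < d" for x x'
  proof -
    have "(\<Sum>y<d'. W y y x x') = mtrace (\<Lambda> (munit d (x, x')))"
      using carrier_matD(1)[OF carr[OF cu]] by (simp add: W_def mtrace_def)
    also have "\<dots> = mtrace (munit d (x, x'))" by (rule trp[OF cu])
    also have "\<dots> = (\<Sum>i<d. if i = x then (if x = x' then 1 else 0) else 0)"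
      unfolding mtrace_def by (intro sum.cong) (auto simp: munit_def)
    finally show ?thesis using that by simp
  qed
  have "chan {..<d} {..<d'} W"
    using sp by (intro chanI[where R = K and K = "\<lambda>r y x. of_real (sqrt (p r)) * u r (x, y)"] W TP) (auto simp: spec_def)
  moreover have "\<Lambda> A $$ (y, y') = (\<Sum>u<d. \<Sum>v<d. W y y' u v * A $$ (u, v))"
    if "A \<in> carrier_mat d d" "y < d'" "y' < d'" for A y y'
    unfolding W_def by (rule linear_map_entry[OF carr add scale that])
  ultimately show thesis by (rule that)
qed

text \<open>\<open>extend\<close> acts on the middle of three factors, so Alice's factor is put
  there by a trivial factor on the left and by merging B and E on the right.\<close>

lemma extend_A_kernel:
  assumes W: "\<And>A y y'. A \<in> carrier_mat a a \<Longrightarrow> y < a' \<Longrightarrow> y' < a' \<Longrightarrow> \<Lambda> A $$ (y, y') = (\<Sum>u<a. \<Sum>v<a. W y y' u v * A $$ (u, v))"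
    and s: "s \<in> idx (a', b, e)" "s' \<in> idx (a', b, e)"
  shows "entry3 (a', b, e) (extend 1 (b * e) a a' \<Lambda> M) s s' = act1 {..<a} W (entry3 (a, b, e) M) s s'"
proof -
  obtain x y z x' y' z' where e: "s = (x, y, z)" "s' = (x', y', z')" and l: "x < a'" "y < b" "z < e" "x' < a'" "y' < b" "z' < e"
    using s by auto
  have "entry3 (a', b, e) (extend 1 (b * e) a a' \<Lambda> M) s s' =
      entry3 (1, a', b * e) (extend 1 (b * e) a a' \<Lambda> M) (0, x, y * e + z) (0, x', y' * e + z')"
    unfolding e entry3_1 ..
  also have "\<dots> = \<Lambda> (mat a a (\<lambda>(u, v). entry3 (1, a, b * e) M (0, u, y * e + z) (0, v, y' * e + z'))) $$ (x, x')"
    unfolding extend_def using l by (subst entry3_mat3) (auto simp: pair_less)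
  also have "\<dots> = act1 {..<a} W (entry3 (a, b, e) M) s s'"
    unfolding entry3_1 using l by (subst W) (auto simp: e act1_def)
  finally show ?thesis .
qed

lemma extend_B_kernel:
  assumes W: "\<And>A y y'. A \<in> carrier_mat b b \<Longrightarrow> y < b' \<Longrightarrow> y' < b' \<Longrightarrow> \<Lambda> A $$ (y, y') = (\<Sum>u<b. \<Sum>v<b. W y y' u v * A $$ (u, v))"
    and s: "s \<in> idx (a, b', e)" "s' \<in> idx (a, b', e)"
  shows "entry3 (a, b', e) (extend a e b b' \<Lambda> M) s s' = swp (act1 {..<b} W (swp (entry3 (a, b, e) M))) s s'"
proof -
  obtain x y z x' y' z' where e: "s = (x, y, z)" "s' = (x', y', z')" and l: "x < a" "y < b'" "z < e" "x' < a" "y' < b'" "z' < e"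
    using s by auto
  have "entry3 (a, b', e) (extend a e b b' \<Lambda> M) s s' =
      \<Lambda> (mat b b (\<lambda>(u, v). entry3 (a, b, e) M (x, u, z) (x', v, z'))) $$ (y, y')"
    unfolding extend_def e using l by (subst entry3_mat3) auto
  also have "\<dots> = swp (act1 {..<b} W (swp (entry3 (a, b, e) M))) s s'"
    using l by (subst W) (auto simp: e act1_def swp_def)
  finally show ?thesis .
qed

lemma extend_E_kernel:
  assumes W: "\<And>A y y'. A \<in> carrier_mat e e \<Longrightarrow> y < e' \<Longrightarrow> y' < e' \<Longrightarrow> \<Lambda> A $$ (y, y') = (\<Sum>u<e. \<Sum>v<e. W y y' u v * A $$ (u, v))"
    and s: "s \<in> idx (a, b, e')" "s' \<in> idx (a, b, e')"
  shows "entry3 (a, b, e') (extend (a * b) 1 e e' \<Lambda> M) s s' = actE {..<e} W (entry3 (a, b, e) M) s s'"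
proof -
  obtain x y z x' y' z' where e: "s = (x, y, z)" "s' = (x', y', z')" and l: "x < a" "y < b" "z < e'" "x' < a" "y' < b" "z' < e'"
    using s by auto
  have "entry3 (a, b, e') (extend (a * b) 1 e e' \<Lambda> M) s s' =
      entry3 (a * b, e', 1) (extend (a * b) 1 e e' \<Lambda> M) (x * b + y, z, 0) (x' * b + y', z', 0)"
    unfolding e entry3_2 ..
  also have "\<dots> = \<Lambda> (mat e e (\<lambda>(u, v). entry3 (a * b, e, 1) M (x * b + y, u, 0) (x' * b + y', v, 0))) $$ (z, z')"
    unfolding extend_def using l by (subst entry3_mat3) (auto simp: pair_less)
  also have "\<dots> = actE {..<e} W (entry3 (a, b, e) M) s s'"
    unfolding entry3_2 using l by (subst W) (auto simp: e actE_def)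
  finally show ?thesis .
qed

text \<open>Registers are last factors, so \<open>y div k\<close> is Bob's old index and
  \<open>y mod k\<close> his copy. Alice's index stays whole, since the register was already
  hers.\<close>

lemma publish_A_kernel:
  assumes s: "s \<in> idx (a * k, b * k, e * k)" "s' \<in> idx (a * k, b * k, e * k)"
  shows "entry3 (a * k, b * k, e * k) (publish_A (a, b, e) k M) s s' =
    (\<lambda>(x, y, z) (x', y', z'). pub (\<lambda>x. x mod k) (entry3 (a * k, b, e) M)
      (id x, (y div k, y mod k), (z div k, z mod k)) (id x', (y' div k, y' mod k), (z' div k, z' mod k))) s s'"
  unfolding publish_A_def prod.case using s by (subst entry3_mat3) (auto simp: pub_def)

lemma publish_B_kernel:
  assumes s: "s \<in> idx (a * k, b * k, e * k)" "s' \<in> idx (a * k, b * k, e * k)"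
  shows "entry3 (a * k, b * k, e * k) (publish_B (a, b, e) k M) s s' =
    swp (\<lambda>(x, y, z) (x', y', z'). pub (\<lambda>x. x mod k) (swp (entry3 (a, b * k, e) M))
      (id x, (y div k, y mod k), (z div k, z mod k)) (id x', (y' div k, y' mod k), (z' div k, z' mod k))) s s'"
  unfolding publish_B_def prod.case using s by (subst entry3_mat3) (auto simp: pub_def swp_def)

lemma bij_div_mod: "bij_betw (\<lambda>y. (y div k, y mod k)) {..<b * k} ({..<b} \<times> {..<k :: nat})"
proof (rule bij_betwI[where g = "\<lambda>(q, r). q * k + r"])
  show "(\<lambda>i. (i div k, i mod k)) \<in> {..<b * k} \<rightarrow> {..<b} \<times> {..<k}"
    by (auto simp: less_mult_imp_div_less) (metis mod_less_divisor gr0I mult_0_right not_less0)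
qed (auto simp: pair_less)

section \<open>Monotonicity under LOPC and additivity\<close>

text \<open>Positivity is carried along because in the induction over \<open>lopc\<close> each step
  needs it of its input.\<close>

definition tri_ach :: "dims \<Rightarrow> complex mat \<Rightarrow> real \<Rightarrow> bool" where
  "tri_ach = (\<lambda>(a, b, e) M c. pos ({..<a} \<times> {..<b} \<times> {..<e}) (entry3 (a, b, e) M) \<and>
     ach {..<a} {..<b} {..<e} (entry3 (a, b, e) M) c)"

lemma tri_ach_cong:
  assumes "\<And>s s'. s \<in> idx (a, b, e) \<Longrightarrow> s' \<in> idx (a, b, e) \<Longrightarrow> entry3 (a, b, e) M s s' = \<kappa> s s'"
    and "pos ({..<a} \<times> {..<b} \<times> {..<e}) \<kappa>" "ach {..<a} {..<b} {..<e} \<kappa> c"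
  shows "tri_ach (a, b, e) M c"
  unfolding tri_ach_def prod.case
  using assms pos_cong[of "{..<a} \<times> {..<b} \<times> {..<e}" "entry3 (a, b, e) M" \<kappa>]
    ach_cong[of "{..<a}" "{..<b}" "{..<e}" "entry3 (a, b, e) M" \<kappa> c] by (simp only: idx.simps)

text \<open>Bob's two cases are Alice's after the parties are exchanged with \<open>swp\<close> and
  then exchanged back.\<close>

lemma lopc_step_tri_ach:
  assumes "lopc_step D D' \<Gamma>" "tri_ach D M c"
  shows "tri_ach D' (\<Gamma> M) c"
  using assms
proof (cases rule: lopc_step.cases)
  case (local_A a a' \<Lambda> b e)
  obtain W where W: "chan {..<a} {..<a'} W"
    "\<And>A y y'. A \<in> carrier_mat a a \<Longrightarrow> y < a' \<Longrightarrow> y' < a' \<Longrightarrow> \<Lambda> A $$ (y, y') = (\<Sum>u<a. \<Sum>v<a. W y y' u v * A $$ (u, v))"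
    by (rule cptp_chan[OF local_A(4)]) (rule that)
  have p: "pos ({..<a} \<times> {..<b} \<times> {..<e}) (entry3 (a, b, e) M)" and h: "ach {..<a} {..<b} {..<e} (entry3 (a, b, e) M) c"
    using assms(2) local_A(1) by (auto simp: tri_ach_def)
  show ?thesis
    unfolding local_A(2,3)
  proof (rule tri_ach_cong[OF extend_A_kernel[OF W(2)]])
    show "pos ({..<a'} \<times> {..<b} \<times> {..<e}) (act1 {..<a} W (entry3 (a, b, e) M))"
      by (rule pos_act1[OF _ _ _ p W(1)]) auto
    show "ach {..<a'} {..<b} {..<e} (act1 {..<a} W (entry3 (a, b, e) M)) c"
      by (rule ach_act1[OF _ _ _ _ p W(1) h]) auto
  qed
next
  case (local_B b b' \<Lambda> a e)
  obtain W where W: "chan {..<b} {..<b'} W"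
    "\<And>A y y'. A \<in> carrier_mat b b \<Longrightarrow> y < b' \<Longrightarrow> y' < b' \<Longrightarrow> \<Lambda> A $$ (y, y') = (\<Sum>u<b. \<Sum>v<b. W y y' u v * A $$ (u, v))"
    by (rule cptp_chan[OF local_B(4)]) (rule that)
  have p: "pos ({..<a} \<times> {..<b} \<times> {..<e}) (entry3 (a, b, e) M)" and h: "ach {..<a} {..<b} {..<e} (entry3 (a, b, e) M) c"
    using assms(2) local_B(1) by (auto simp: tri_ach_def)
  have p': "pos ({..<b} \<times> {..<a} \<times> {..<e}) (swp (entry3 (a, b, e) M))"
    by (rule pos_swp[OF _ _ _ p]) auto
  have h': "ach {..<b} {..<a} {..<e} (swp (entry3 (a, b, e) M)) c"
    by (rule ach_swp[OF _ _ _ p h]) auto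
  have p'': "pos ({..<b'} \<times> {..<a} \<times> {..<e}) (act1 {..<b} W (swp (entry3 (a, b, e) M)))"
    by (rule pos_act1[OF _ _ _ p' W(1)]) auto
  show ?thesis
    unfolding local_B(2,3)
  proof (rule tri_ach_cong[OF extend_B_kernel[OF W(2)]])
    show "pos ({..<a} \<times> {..<b'} \<times> {..<e}) (swp (act1 {..<b} W (swp (entry3 (a, b, e) M))))"
      by (rule pos_swp[OF _ _ _ p'']) auto
    show "ach {..<a} {..<b'} {..<e} (swp (act1 {..<b} W (swp (entry3 (a, b, e) M)))) c"
      by (rule ach_swp[OF _ _ _ p'' ach_act1[OF _ _ _ _ p' W(1) h']]) auto
  qed
next
  case (public_A a k b e)
  have p: "pos ({..<a * k} \<times> {..<b} \<times> {..<e}) (entry3 (a * k, b, e) M)" and h: "ach {..<a * k} {..<b} {..<e} (entry3 (a * k, b, e) M) c"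
    using assms(2) public_A(1) by (auto simp: tri_ach_def)
  \<comment> \<open>For k = 0 the domain is empty, so the range condition holds there as
    well.\<close>
  have g: "(\<lambda>x. x mod k) ` {..<a * k} \<subseteq> {..<k}"
    by auto (metis mod_less_divisor gr0I mult_0_right not_less0)
  note pp = pub_transport(2)[OF _ _ _ p g] and hp = ach_pub[OF _ _ _ p g h]
  show ?thesis
    unfolding public_A(2,3)
  proof (rule tri_ach_cong[OF publish_A_kernel])
    show "pos ({..<a * k} \<times> {..<b * k} \<times> {..<e * k}) (\<lambda>(x, y, z) (x', y', z'). pub (\<lambda>x. x mod k) (entry3 (a * k, b, e) M)
      (id x, (y div k, y mod k), (z div k, z mod k)) (id x', (y' div k, y' mod k), (z' div k, z' mod k)))"
      using bij_div_mod by (intro pos_reindex3[OF _ _ _ pp]) (auto simp: bij_betw_def)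
    show "ach {..<a * k} {..<b * k} {..<e * k} (\<lambda>(x, y, z) (x', y', z'). pub (\<lambda>x. x mod k) (entry3 (a * k, b, e) M)
      (id x, (y div k, y mod k), (z div k, z mod k)) (id x', (y' div k, y' mod k), (z' div k, z' mod k))) c"
      by (rule ach_reindex[OF _ _ _ pp bij_betw_id bij_div_mod bij_div_mod hp]) auto
  qed
next
  case (public_B a b k e)
  have p: "pos ({..<a} \<times> {..<b * k} \<times> {..<e}) (entry3 (a, b * k, e) M)" and h: "ach {..<a} {..<b * k} {..<e} (entry3 (a, b * k, e) M) c"
    using assms(2) public_B(1) by (auto simp: tri_ach_def)
  have p': "pos ({..<b * k} \<times> {..<a} \<times> {..<e}) (swp (entry3 (a, b * k, e) M))"
    by (rule pos_swp[OF _ _ _ p]) auto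
  have h': "ach {..<b * k} {..<a} {..<e} (swp (entry3 (a, b * k, e) M)) c"
    by (rule ach_swp[OF _ _ _ p h]) auto
  have g: "(\<lambda>x. x mod k) ` {..<b * k} \<subseteq> {..<k}"
    by auto (metis mod_less_divisor gr0I mult_0_right not_less0)
  note pp = pub_transport(2)[OF _ _ _ p' g] and hp = ach_pub[OF _ _ _ p' g h']
  let ?\<kappa> = "\<lambda>(x, y, z) (x', y', z'). pub (\<lambda>x. x mod k) (swp (entry3 (a, b * k, e) M))
      (id x, (y div k, y mod k), (z div k, z mod k)) (id x', (y' div k, y' mod k), (z' div k, z' mod k))"
  have p'': "pos ({..<b * k} \<times> {..<a * k} \<times> {..<e * k}) ?\<kappa>"
    using bij_div_mod by (intro pos_reindex3[OF _ _ _ pp]) (auto simp: bij_betw_def)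
  have h'': "ach {..<b * k} {..<a * k} {..<e * k} ?\<kappa> c"
    by (rule ach_reindex[OF _ _ _ pp bij_betw_id bij_div_mod bij_div_mod hp]) auto
  show ?thesis
    unfolding public_B(2,3)
  proof (rule tri_ach_cong[OF publish_B_kernel])
    show "pos ({..<a * k} \<times> {..<b * k} \<times> {..<e * k}) (swp ?\<kappa>)" by (rule pos_swp[OF _ _ _ p'']) auto
    show "ach {..<a * k} {..<b * k} {..<e * k} (swp ?\<kappa>) c" by (rule ach_swp[OF _ _ _ p'' h'']) auto
  qed
qed

lemma lopc_tri_ach: "lopc D D' \<Gamma> \<Longrightarrow> tri_ach D M c \<Longrightarrow> tri_ach D' (\<Gamma> M) c"
  by (induction rule: lopc.induct) (auto intro: lopc_step_tri_ach)

lemma digit_mod: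
  assumes "i < n" "0 < a"
  shows "digit a i (x mod a ^ n) = digit a i x"
proof -
  obtain j where j: "n = i + Suc j" using assms(1) by (metis less_iff_Suc_add add_Suc_right)
  have n: "a ^ n = a ^ i * (a * a ^ j)" by (simp add: j power_add)
  have "x mod a ^ n div a ^ i = x div a ^ i mod (a * a ^ j)"
    unfolding n mod_mult2_eq using assms(2) by simp
  then show ?thesis by (simp add: digit_def mod_mod_cancel)
qed

lemma digit_top: "x < a ^ Suc n \<Longrightarrow> digit a n x = x div a ^ n"
  by (simp add: digit_def less_mult_imp_div_less)

text \<open>Splitting x into x div a^n and x mod a^n, the top digit and the rest, turns the power n
  + 1 into \<open>\<rho>\<close> tensored with the power n, and \<open>ach_tens\<close> adds the
  values. Trace 1 is part of the induction because \<open>ach_tens\<close> requires it.\<close>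

lemma tensor_power_tri_ach:
  assumes den: "density (a * b * e) \<rho>" and h: "ach {..<a} {..<b} {..<e} (entry3 (a, b, e) \<rho>) c" and "0 \<le> c"
  shows "tri_ach (a ^ n, b ^ n, e ^ n) (tensor_power (a, b, e) n \<rho>) (real n * c) \<and>
    tr ({..<a ^ n} \<times> {..<b ^ n} \<times> {..<e ^ n}) (entry3 (a ^ n, b ^ n, e ^ n) (tensor_power (a, b, e) n \<rho>)) = 1"
proof -
  let ?\<rho> = "entry3 (a, b, e) \<rho>"
  have p: "pos ({..<a} \<times> {..<b} \<times> {..<e}) ?\<rho>" using den by (simp add: density_def entry3_pos)
  have t: "tr ({..<a} \<times> {..<b} \<times> {..<e}) ?\<rho> = 1"
  proof -
    have "mtrace \<rho> = (\<Sum>i<a * b * e. \<rho> $$ (i, i))" using den by (auto simp: mtrace_def density_def psd_def)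
    also have "\<dots> = (\<Sum>s\<in>idx (a, b, e). ?\<rho> s s)"
      using sum.reindex_bij_betw[OF bij_enc, of "\<lambda>i. \<rho> $$ (i, i)" a b e] by (simp add: entry3_def)
    finally show ?thesis using den by (simp add: tr_def density_def)
  qed
  \<comment> \<open>Trace 1 excludes an empty index set; \<open>digit_mod\<close> asks for positive
    bases.\<close>
  have pos_dims: "0 < a" "0 < b" "0 < e"
  proof -
    have "a * b * e \<noteq> 0"
    proof
      assume "a * b * e = 0"
      then have "{..<a} \<times> {..<b} \<times> {..<e} = {}" by auto
      then show False using t by (simp only: tr_def sum.empty) simp
    qed
    then show "0 < a" "0 < b" "0 < e" by auto
  qed
  define T where "T n = (\<lambda>(x, y, z) (x', y', z'). \<Prod>i<n. ?\<rho> (digit a i x, digit b i y, digit e i z) (digit a i x', digit b i y', digit e i z'))" for n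
  have T: "entry3 (a ^ n, b ^ n, e ^ n) (tensor_power (a, b, e) n \<rho>) s s' = T n s s'"
    if "s \<in> idx (a ^ n, b ^ n, e ^ n)" "s' \<in> idx (a ^ n, b ^ n, e ^ n)" for n s s'
    unfolding tensor_power.simps T_def using that by (subst entry3_mat3) auto
  have "pos ({..<a ^ n} \<times> {..<b ^ n} \<times> {..<e ^ n}) (T n) \<and> tr ({..<a ^ n} \<times> {..<b ^ n} \<times> {..<e ^ n}) (T n) = 1 \<and>
      ach {..<a ^ n} {..<b ^ n} {..<e ^ n} (T n) (real n * c)" for n
  proof (induction n)
    case 0
    have T0: "T 0 = (\<lambda>_ _. 1)" by (simp add: T_def fun_eq_iff)
    let ?I = "{..<a ^ 0} \<times> {..<b ^ 0} \<times> {..<e ^ 0}"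
    have I: "?I = {(0, 0, 0)}" by auto
    have pos0: "pos ?I (T 0)"
      unfolding I T0 pos_def quad_def by (simp add: less_eq_complex_def)
    moreover have tr0: "tr ?I (T 0) = 1" unfolding I T0 tr_def by simp
    moreover have "ach {..<a ^ 0} {..<b ^ 0} {..<e ^ 0} (T 0) (real 0 * c)"
    proof (rule achI[OF _ _ _ _ pos0 chan_id])
      let ?W = "\<lambda>f f' z z'. if f = z \<and> f' = z' then 1 else 0"
      have ch: "chan {..<e ^ 0} {..<e ^ 0} ?W" by (rule chan_id) simp
      have pW: "pos ?I (actE {..<e ^ 0} ?W (T 0))" by (rule pos_actE[OF _ _ _ _ pos0 ch]) auto
      \<comment> \<open>Alice's system is one-dimensional, so the bound of \<open>CMI_le\<close>
        contains the factor ln 1 = 0.\<close>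
      have "CMI {..<a ^ 0} {..<b ^ 0} {..<e ^ 0} (actE {..<e ^ 0} ?W (T 0)) \<le>
          2 * tr ?I (actE {..<e ^ 0} ?W (T 0)) * ln (card {..<a ^ 0})"
        by (rule CMI_le[OF _ _ _ pW]) auto
      then show "CMI {..<a ^ 0} {..<b ^ 0} {..<e ^ 0} (actE {..<e ^ 0} ?W (T 0)) \<le> real 0 * c" by simp
    qed auto
    ultimately show ?case by blast
  next
    case (Suc n)
    let ?f = "\<lambda>a x. (x div a ^ n, x mod a ^ n)"
    have TS: "T (Suc n) s s' = (\<lambda>(x, y, z) (x', y', z'). tens ?\<rho> (T n) (?f a x, ?f b y, ?f e z) (?f a x', ?f b y', ?f e z')) s s'"
      if ss: "s \<in> {..<a ^ Suc n} \<times> {..<b ^ Suc n} \<times> {..<e ^ Suc n}" "s' \<in> {..<a ^ Suc n} \<times> {..<b ^ Suc n} \<times> {..<e ^ Suc n}" for s s'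
    proof -
      obtain x y z x' y' z' where e: "s = (x, y, z)" "s' = (x', y', z')"
        and l: "x < a ^ Suc n" "y < b ^ Suc n" "z < e ^ Suc n" "x' < a ^ Suc n" "y' < b ^ Suc n" "z' < e ^ Suc n"
        using ss by auto
      show ?thesis
        unfolding e T_def prod.case tens_def prod.lessThan_Suc
        using pos_dims l by (simp add: digit_mod digit_top mult.commute del: power_Suc)
    qed
    let ?S = "{..<a ^ Suc n} \<times> {..<b ^ Suc n} \<times> {..<e ^ Suc n}"
    let ?\<kappa> = "\<lambda>(x, y, z) (x', y', z'). tens ?\<rho> (T n) (?f a x, ?f b y, ?f e z) (?f a x', ?f b y', ?f e z')"
    have fin: "finite {..<a}" "finite {..<b}" "finite {..<e}" "finite {..<a ^ n}" "finite {..<b ^ n}" "finite {..<e ^ n}" by auto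
    from Suc have pn: "pos ({..<a ^ n} \<times> {..<b ^ n} \<times> {..<e ^ n}) (T n)"
      and tn: "tr ({..<a ^ n} \<times> {..<b ^ n} \<times> {..<e ^ n}) (T n) = 1"
      and hn: "ach {..<a ^ n} {..<b ^ n} {..<e ^ n} (T n) (real n * c)" by auto
    note tp = tens_props(1,2)[OF fin p pn]
    have at: "ach ({..<a} \<times> {..<a ^ n}) ({..<b} \<times> {..<b ^ n}) ({..<e} \<times> {..<e ^ n}) (tens ?\<rho> (T n)) (c + real n * c)"
      by (rule ach_tens[OF fin p pn t tn h hn])
    have bij: "bij_betw (?f a) {..<a ^ Suc n} ({..<a} \<times> {..<a ^ n})" for a :: nat
      unfolding power_Suc by (rule bij_div_mod)
    have "ach {..<a ^ Suc n} {..<b ^ Suc n} {..<e ^ Suc n} ?\<kappa> (c + real n * c)"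
      by (rule ach_reindex[OF _ _ _ tp(1) bij bij bij at]) auto
    then have 1: "ach {..<a ^ Suc n} {..<b ^ Suc n} {..<e ^ Suc n} (T (Suc n)) (real (Suc n) * c)"
      using ach_cong[of "{..<a ^ Suc n}" "{..<b ^ Suc n}" "{..<e ^ Suc n}" "T (Suc n)" ?\<kappa>] TS by (simp add: distrib_right del: power_Suc)
    have "pos ?S ?\<kappa>"
      using bij by (intro pos_reindex3[OF _ _ _ tp(1)]) (auto simp: bij_betw_def simp del: power_Suc)
    then have 2: "pos ?S (T (Suc n))"
      using pos_cong[of ?S "T (Suc n)" ?\<kappa>] TS by blast
    have "(\<Sum>s\<in>?S. T (Suc n) s s) = (\<Sum>s\<in>?S. tens ?\<rho> (T n) (map_prod (?f a) (map_prod (?f b) (?f e)) s) (map_prod (?f a) (map_prod (?f b) (?f e)) s))"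
    proof (rule sum.cong[OF refl])
      fix s assume "s \<in> ?S"
      then show "T (Suc n) s s = tens ?\<rho> (T n) (map_prod (?f a) (map_prod (?f b) (?f e)) s) (map_prod (?f a) (map_prod (?f b) (?f e)) s)"
        using TS[of s s] by (cases s) simp
    qed
    also have "\<dots> = (\<Sum>s\<in>({..<a} \<times> {..<a ^ n}) \<times> ({..<b} \<times> {..<b ^ n}) \<times> ({..<e} \<times> {..<e ^ n}). tens ?\<rho> (T n) s s)"
      by (rule sum.reindex_bij_betw) (intro bij_betw_map_prod bij)
    finally have "tr ?S (T (Suc n)) = tr (({..<a} \<times> {..<a ^ n}) \<times> ({..<b} \<times> {..<b ^ n}) \<times> ({..<e} \<times> {..<e ^ n})) (tens ?\<rho> (T n))"
      by (simp only: tr_def)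
    then have 3: "tr ?S (T (Suc n)) = 1" by (simp only: tp(2) t tn mult_1)
    show ?case using 1 2 3 by blast
  qed
  from this[of n] show ?thesis
    using pos_cong[of "idx (a ^ n, b ^ n, e ^ n)" "entry3 (a ^ n, b ^ n, e ^ n) (tensor_power (a, b, e) n \<rho>)" "T n"] T
      ach_cong[of "{..<a ^ n}" "{..<b ^ n}" "{..<e ^ n}" "entry3 (a ^ n, b ^ n, e ^ n) (tensor_power (a, b, e) n \<rho>)" "T n"]
    by (auto simp: tri_ach_def tr_def simp del: tensor_power.simps)
qed

section \<open>The key state\<close>

definition key_kern :: "nat \<Rightarrow> ('e \<Rightarrow> 'e \<Rightarrow> complex) \<Rightarrow> (nat, nat, 'e) kern3" where
  "key_kern L \<tau> = (\<lambda>(x, y, z) (x', y', z'). if x < L \<and> y = x \<and> x' = x \<and> y' = x then \<tau> z z' / of_nat L else 0)"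

lemma uniform_kernel:
  fixes L :: nat
  assumes "0 < L"
  defines "\<delta> \<equiv> \<lambda>x x'. if x = x' then 1 / complex_of_nat L else 0"
  shows "pos {..<L} \<delta>" "tr {..<L} \<delta> = 1" "ent {..<L} \<delta> = ln L"
proof -
  have s: "spec {..<L} \<delta> {..<L} (\<lambda>_. 1 / real L) (\<lambda>k x. if x = k then 1 else 0)"
    unfolding spec_def ortho_def ip_def \<delta>_def
  proof (intro conjI ballI)
    fix x y :: nat assume "x \<in> {..<L}" "y \<in> {..<L}"
    have "(\<Sum>k<L. complex_of_real (1 / real L) * (if x = k then 1 else 0) * cnj (if y = k then 1 else 0)) =
        (\<Sum>k<L. if k = x then (if x = y then 1 / complex_of_nat L else 0) else 0)"
      by (intro sum.cong) auto
    then show "(if x = y then 1 / complex_of_nat L else 0) = (\<Sum>k<L. complex_of_real (1 / real L) * (if x = k then 1 else 0) * cnj (if y = k then 1 else 0))"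
      using \<open>x \<in> {..<L}\<close> by simp
  next
    fix k l :: nat assume "k \<in> {..<L}" "l \<in> {..<L}"
    have "(\<Sum>x<L. cnj (if x = k then 1 else 0) * (if x = l then 1 else 0)) = (\<Sum>x<L. if x = k then (if k = l then 1 else 0) else 0 :: complex)"
      by (intro sum.cong) auto
    then show "(\<Sum>x<L. cnj (if x = k then 1 else 0) * (if x = l then 1 else 0)) = (if k = l then 1 else (0 :: complex))"
      using \<open>k \<in> {..<L}\<close> by simp
  qed (use assms in auto)
  show "pos {..<L} \<delta>" by (rule pos_spec_imp[OF s])
  show "tr {..<L} \<delta> = 1" using assms(1) by (simp add: tr_spec[OF s])
  show "ent {..<L} \<delta> = ln L" using assms(1) by (simp add: ent_eq[OF _ s] ln_div)
qed

text \<open>Alice's and Bob's values coincide, so ABE, AE and BE each carry the uniform distribution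
  times \<tau> and have entropy ln L + S(E). In the combination S(E) cancels.\<close>

lemma CMI_key:
  assumes "0 < L" "finite J" "pos J \<tau>" "tr J \<tau> = 1"
  shows "pos ({..<L} \<times> {..<L} \<times> J) (key_kern L \<tau>)" "CMI {..<L} {..<L} J (key_kern L \<tau>) = ln L"
proof -
  define \<delta> where "\<delta> = (\<lambda>x x' :: nat. if x = x' then 1 / complex_of_nat L else 0)"
  note u = uniform_kernel[OF assms(1), folded \<delta>_def]
  define \<kappa> where "\<kappa> = (\<lambda>s s'. \<delta> (fst s) (fst s') * \<tau> (snd s) (snd s'))"
  have tens: "ent ({..<L} \<times> J) \<kappa> = ln L + ent J \<tau>" "pos ({..<L} \<times> J) \<kappa>"
    using ent_tensor(1,2)[OF finite_lessThan assms(2) u(1) assms(3) bij_betw_id, of \<kappa>] by (simp_all add: \<kappa>_def u assms(4))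
  define f where "f = (\<lambda>(x, z). (x, x, z) :: nat \<times> nat \<times> 'a)"
  have inj: "inj_on f ({..<L} \<times> J)" by (auto simp: inj_on_def f_def)
  have im: "f ` ({..<L} \<times> J) \<subseteq> {..<L} \<times> {..<L} \<times> J" by (auto simp: f_def)
  have fin: "finite ({..<L} \<times> {..<L} \<times> J)" using assms(2) by simp
  have on: "key_kern L \<tau> (f s) (f s') = \<kappa> s s'" if "s \<in> {..<L} \<times> J" "s' \<in> {..<L} \<times> J" for s s'
    using that by (auto simp: f_def key_kern_def \<kappa>_def \<delta>_def)
  have off: "key_kern L \<tau> t t' = 0 \<and> key_kern L \<tau> t' t = 0" if t0: "t \<in> {..<L} \<times> {..<L} \<times> J - f ` ({..<L} \<times> J)" and "t' \<in> {..<L} \<times> {..<L} \<times> J" for t t'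
  proof -
    obtain x y z where t: "t = (x, y, z)" "x < L" "z \<in> J" using DiffD1[OF t0] by auto
    have "y \<noteq> x" using t0 t image_eqI[of t f "(x, z)" "{..<L} \<times> J"] by (auto simp: f_def)
    then show ?thesis by (cases t') (auto simp: t key_kern_def)
  qed
  have e1: "ent ({..<L} \<times> {..<L} \<times> J) (key_kern L \<tau>) = ln L + ent J \<tau>"
    using ent_embed[OF _ tens(2) inj fin im on off] assms(2) tens(1) by simp
  obtain K :: "nat set" and p v where "spec ({..<L} \<times> J) \<kappa> K p v" using pos_imp_spec[OF _ tens(2)] assms(2) by blast
  from spec_transport[OF this inj fin im on off] show "pos ({..<L} \<times> {..<L} \<times> J) (key_kern L \<tau>)" by (rule pos_spec_imp)
  have m: "mAE {..<L} (key_kern L \<tau>) s s' = \<kappa> s s'" if ss: "s \<in> {..<L} \<times> J" "s' \<in> {..<L} \<times> J" for s s'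
  proof -
    obtain x z x' z' where e: "s = (x, z)" "s' = (x', z')" "x < L" using ss by auto
    have "mAE {..<L} (key_kern L \<tau>) s s' = (\<Sum>y<L. if y = x then \<kappa> s s' else 0)"
      unfolding mAE_def e prod.case using e(3) by (intro sum.cong) (auto simp: key_kern_def \<kappa>_def \<delta>_def)
    then show ?thesis using e(3) by simp
  qed
  have p: "ptr1 {..<L} (key_kern L \<tau>) s s' = \<kappa> s s'" if ss: "s \<in> {..<L} \<times> J" "s' \<in> {..<L} \<times> J" for s s'
  proof -
    obtain x z x' z' where e: "s = (x, z)" "s' = (x', z')" "x < L" using ss by auto
    have "ptr1 {..<L} (key_kern L \<tau>) s s' = (\<Sum>y<L. if y = x then \<kappa> s s' else 0)"
      unfolding ptr1_def e using e(3) by (intro sum.cong) (auto simp: key_kern_def \<kappa>_def \<delta>_def)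
    then show ?thesis using e(3) by simp
  qed
  have e2: "ent ({..<L} \<times> J) (mAE {..<L} (key_kern L \<tau>)) = ln L + ent J \<tau>"
    unfolding tens(1)[symmetric] by (rule ent_cong) (rule m)
  have e3: "ent ({..<L} \<times> J) (ptr1 {..<L} (key_kern L \<tau>)) = ln L + ent J \<tau>"
    unfolding tens(1)[symmetric] by (rule ent_cong) (rule p)
  have e4: "ent J (ptr1 {..<L} (ptr1 {..<L} (key_kern L \<tau>))) = ent J \<tau>"
  proof (rule ent_cong)
    fix z z' assume "z \<in> J" "z' \<in> J"
    then have "ptr1 {..<L} (ptr1 {..<L} (key_kern L \<tau>)) z z' = (\<Sum>x<L. \<kappa> (x, z) (x, z'))"
      unfolding ptr1_def[of _ "ptr1 {..<L} (key_kern L \<tau>)"] by (intro sum.cong refl p) auto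
    then show "ptr1 {..<L} (ptr1 {..<L} (key_kern L \<tau>)) z z' = \<tau> z z'"
      using assms(1) by (simp add: \<kappa>_def \<delta>_def)
  qed
  show "CMI {..<L} {..<L} J (key_kern L \<tau>) = ln L" by (simp add: CMI_def e1 e2 e3 e4)
qed

text \<open>Reduces a system to its first \<open>L\<close> basis vectors, by resetting all others to the vector 0.\<close>

definition fold_kern :: "nat \<Rightarrow> nat \<Rightarrow> nat \<Rightarrow> nat \<Rightarrow> nat \<Rightarrow> complex" where
  "fold_kern L x x' u v = (if u < L \<and> v < L then (if x = u \<and> x' = v then 1 else 0)
     else if u = v \<and> x = 0 \<and> x' = 0 then 1 else 0)"

text \<open>Kraus operator 0 projects onto the first L basis vectors; operator Suc u sends the basis
  vector u, for u at least L, to the basis vector 0. The shift by one keeps the label 0 free for the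
  projection.\<close>

lemma chan_fold:
  assumes "0 < L"
  shows "chan {..<a} {..<L} (fold_kern L)"
proof (rule chanI[where R = "{..<Suc a}"
      and K = "\<lambda>r x u. if r = 0 then (if u < L \<and> x = u then 1 else 0) else (if L \<le> u \<and> r = Suc u \<and> x = 0 then 1 else 0)"])
  fix u v x x' assume h: "u \<in> {..<a}" "v \<in> {..<a}" "x \<in> {..<L}" "x' \<in> {..<L}"
  have "(\<Sum>r<a. (if L \<le> u \<and> r = u \<and> x = 0 then 1 else 0) * cnj (if L \<le> v \<and> r = v \<and> x' = 0 then 1 else 0)) =
      (\<Sum>r<a. if r = u then (if L \<le> u \<and> x = 0 \<and> u = v \<and> x' = 0 then 1 else 0) else 0 :: complex)"
    by (intro sum.cong) auto
  also have "\<dots> = (if L \<le> u \<and> x = 0 \<and> u = v \<and> x' = 0 then 1 else 0)" using h by simp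
  finally show "fold_kern L x x' u v = (\<Sum>r<Suc a. (if r = 0 then (if u < L \<and> x = u then 1 else 0) else (if L \<le> u \<and> r = Suc u \<and> x = 0 then 1 else 0)) *
      cnj (if r = 0 then (if v < L \<and> x' = v then 1 else 0) else (if L \<le> v \<and> r = Suc v \<and> x' = 0 then 1 else 0)))"
    unfolding sum.lessThan_Suc_shift by (auto simp: fold_kern_def)
next
  fix u v assume "u \<in> {..<a}" "v \<in> {..<a}"
  have "(\<Sum>y<L. fold_kern L y y u v) = (\<Sum>y<L. if y = (if u < L \<and> v < L then u else 0) then (if u = v then 1 else 0) else 0)"
    by (intro sum.cong) (auto simp: fold_kern_def)
  then show "(\<Sum>y<L. fold_kern L y y u v) = (if u = v then 1 else 0)" using assms by simp
qed simp

lemma act1_fold_key: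
  assumes "L \<le> a" "x < L" "x' < L"
  shows "act1 {..<a} (fold_kern L) (key_kern L \<tau>) (x, s) (x', s') = key_kern L \<tau> (x, s) (x', s')"
proof -
  have "act1 {..<a} (fold_kern L) (key_kern L \<tau>) (x, s) (x', s') =
      (\<Sum>u<a. \<Sum>v<a. if v = x' then (if u = x then key_kern L \<tau> (x, s) (x', s') else 0) else 0)"
    unfolding act1_def prod.case using assms
    by (intro sum.cong refl, cases s, cases s') (auto simp: fold_kern_def key_kern_def)
  then show ?thesis using assms by simp
qed

lemma swp_key: "swp (key_kern L \<tau>) = key_kern L \<tau>"
  by (auto simp: swp_def key_kern_def fun_eq_iff)

lemma actE_key:
  "actE E W (key_kern L \<tau>) = key_kern L (\<lambda>f f'. \<Sum>u\<in>E. \<Sum>v\<in>E. W f f' u v * \<tau> u v)"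
  by (auto simp: actE_def key_kern_def fun_eq_iff sum_divide_distrib)

lemma act1_add: "act1 I W (\<lambda>s s'. \<rho> s s' + \<sigma> s s') = (\<lambda>s s'. act1 I W \<rho> s s' + act1 I W \<sigma> s s')"
  by (simp add: act1_def case_prod_unfold distrib_left sum.distrib)

lemma actE_add: "actE E W (\<lambda>s s'. \<rho> s s' + \<sigma> s s') = (\<lambda>s s'. actE E W \<rho> s s' + actE E W \<sigma> s s')"
  by (simp add: actE_def case_prod_unfold distrib_left sum.distrib)

lemma swp_add: "swp (\<lambda>s s'. \<rho> s s' + \<sigma> s s') = (\<lambda>s s'. swp \<rho> s s' + swp \<sigma> s s')"
  by (simp add: swp_def case_prod_unfold)

lemma tr_swp: "tr (B \<times> A \<times> E) (swp \<rho>) = tr (A \<times> B \<times> E) \<rho>"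
  unfolding tr_def sum_Times swp_def prod.case by (subst sum.swap) (rule refl)

lemma chan_on_state:
  assumes "finite E" "finite J" "pos E \<tau>" "chan E J W"
  shows "pos J (\<lambda>f f'. \<Sum>u\<in>E. \<Sum>v\<in>E. W f f' u v * \<tau> u v)" "tr J (\<lambda>f f'. \<Sum>u\<in>E. \<Sum>v\<in>E. W f f' u v * \<tau> u v) = tr E \<tau>"
proof -
  let ?\<sigma> = "\<lambda>s s'. \<tau> (fst s) (fst s')"
  have "pos (E \<times> {()}) ?\<sigma>" using assms by (intro pos_pullback[OF assms(3)]) auto
  then have "pos (J \<times> {()}) (act1 E W ?\<sigma>)" using assms by (intro pos_act1) auto
  then have "pos J (\<lambda>f f'. act1 E W ?\<sigma> (f, ()) (f', ()))"
    using assms(2) by (intro pos_pullback[where f = "\<lambda>f. (f, ())"]) auto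
  then show "pos J (\<lambda>f f'. \<Sum>u\<in>E. \<Sum>v\<in>E. W f f' u v * \<tau> u v)" by (simp add: act1_def)
  have "tr (J \<times> {()}) (act1 E W ?\<sigma>) = tr (E \<times> {()}) ?\<sigma>" by (rule tr_act1[OF assms(1,4)])
  then show "tr J (\<lambda>f f'. \<Sum>u\<in>E. \<Sum>v\<in>E. W f f' u v * \<tau> u v) = tr E \<tau>"
    by (simp add: tr_def sum_Times act1_def)
qed

text \<open>Folding Alice and Bob to dimension L before the comparison replaces ln a by ln L in
  \<open>CMI_continuity\<close>. The folding and Eve's channel \<open>W\<close> take the key state
  to a key state with another state of Eve, so the value compared with is still ln L.\<close>

lemma near_key_bound:
  fixes E :: "nat set"
  assumes L: "0 < L" "L \<le> a" "L \<le> b" and E: "finite E"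
    and pos: "pos ({..<a} \<times> {..<b} \<times> E) \<rho>" "pos ({..<a} \<times> {..<b} \<times> E) N" "pos ({..<a} \<times> {..<b} \<times> E) P"
    and tau: "pos E \<tau>" "tr E \<tau> = 1"
    and t: "tr ({..<a} \<times> {..<b} \<times> E) \<rho> = 1" "tr ({..<a} \<times> {..<b} \<times> E) N = \<epsilon>" "tr ({..<a} \<times> {..<b} \<times> E) P = \<epsilon>"
    and eq: "\<And>s s'. s \<in> {..<a} \<times> {..<b} \<times> E \<Longrightarrow> s' \<in> {..<a} \<times> {..<b} \<times> E \<Longrightarrow> \<rho> s s' + N s s' = key_kern L \<tau> s s' + P s s'"
    and h: "ach {..<a} {..<b} E \<rho> c"
  shows "ln L - 2 * \<epsilon> * ln L - 4 * (1 + \<epsilon>) * ln 2 \<le> c"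
proof -
  obtain J :: "nat set" and W where J: "finite J" "chan E J W" "CMI {..<a} {..<b} J (actE E W \<rho>) \<le> c"
    using h by (rule achE)
  let ?A = "\<lambda>\<kappa>. act1 {..<a} (fold_kern L) (actE E W \<kappa>)"
  let ?B = "\<lambda>\<kappa>. act1 {..<b} (fold_kern L) (swp (?A \<kappa>))"
  define T where "T \<kappa> = swp (?B \<kappa>)" for \<kappa> :: "(nat, nat, nat) kern3"
  let ?S = "{..<a} \<times> {..<b} \<times> E" and ?S' = "{..<L} \<times> {..<L} \<times> J"
  note cf = chan_fold[OF L(1)]
  have pT: "pos ({..<a} \<times> {..<b} \<times> J) (actE E W \<kappa>)" "pos ({..<L} \<times> {..<b} \<times> J) (?A \<kappa>)"
    "pos ({..<b} \<times> {..<L} \<times> J) (swp (?A \<kappa>))"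
    "pos ({..<L} \<times> {..<L} \<times> J) (?B \<kappa>)"
    "pos ?S' (T \<kappa>)" if k: "pos ?S \<kappa>" for \<kappa>
  proof -
    show 1: "pos ({..<a} \<times> {..<b} \<times> J) (actE E W \<kappa>)" by (rule pos_actE[OF _ _ E J(1) k J(2)]) auto
    show 2: "pos ({..<L} \<times> {..<b} \<times> J) (?A \<kappa>)" by (rule pos_act1[OF _ _ _ 1 cf]) (use J in auto)
    show 3: "pos ({..<b} \<times> {..<L} \<times> J) (swp (?A \<kappa>))" by (rule pos_swp[OF _ _ J(1) 2]) auto
    show 4: "pos ({..<L} \<times> {..<L} \<times> J) (?B \<kappa>)"
      by (rule pos_act1[OF _ _ _ 3 cf]) (use J in auto)
    show "pos ?S' (T \<kappa>)" unfolding T_def by (rule pos_swp[OF _ _ J(1) 4]) auto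
  qed
  have tT: "tr ?S' (T \<kappa>) = tr ?S \<kappa>" for \<kappa>
    unfolding T_def tr_swp tr_act1[OF finite_lessThan cf] tr_actE[OF E J(2)] ..
  have cmi: "CMI {..<L} {..<L} J (T \<kappa>) \<le> CMI {..<a} {..<b} J (actE E W \<kappa>)" if k: "pos ?S \<kappa>" for \<kappa>
  proof -
    have "CMI {..<L} {..<L} J (T \<kappa>) = CMI {..<L} {..<L} J (?B \<kappa>)"
      unfolding T_def by (rule CMI_swp[OF _ _ J(1) pT(4)[OF k]]) auto
    also have "\<dots> \<le> CMI {..<b} {..<L} J (swp (?A \<kappa>))"
      by (rule CMI_act1_le[OF _ _ _ J(1) pT(3)[OF k] cf]) auto
    also have "\<dots> = CMI {..<L} {..<b} J (?A \<kappa>)"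
      by (rule CMI_swp[OF _ _ J(1) pT(2)[OF k]]) auto
    also have "\<dots> \<le> CMI {..<a} {..<b} J (actE E W \<kappa>)"
      by (rule CMI_act1_le[OF _ _ _ J(1) pT(1)[OF k] cf]) auto
    finally show ?thesis .
  qed
  have Tadd: "T (\<lambda>s s'. \<kappa> s s' + \<mu> s s') = (\<lambda>s s'. T \<kappa> s s' + T \<mu> s s')" for \<kappa> \<mu>
    unfolding T_def actE_add act1_add swp_add ..
  let ?\<tau>' = "\<lambda>f f'. \<Sum>u\<in>E. \<Sum>v\<in>E. W f f' u v * \<tau> u v"
  note tau' = chan_on_state[OF E J(1) tau(1) J(2)]
  have Tkey: "T (key_kern L \<tau>) s s' = key_kern L ?\<tau>' s s'" if s: "s \<in> ?S'" "s' \<in> ?S'" for s s'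
  proof -
    obtain x y z x' y' z' where e: "s = (x, y, z)" "s' = (x', y', z')" "x < L" "y < L" "x' < L" "y' < L" using s by auto
    let ?k = "key_kern L ?\<tau>'"
    have 1: "act1 {..<a} (fold_kern L) ?k (x, r) (x', r') = ?k (x, r) (x', r')" if "x < L" "x' < L" for x x' r r'
      by (rule act1_fold_key[OF L(2) that])
    have "T (key_kern L \<tau>) s s' = (\<Sum>u<b. \<Sum>v<b. fold_kern L y y' u v * act1 {..<a} (fold_kern L) ?k (x, u, z) (x', v, z'))"
      unfolding T_def actE_key e by (simp add: swp_def act1_def[of "{..<b}"])
    also have "\<dots> = (\<Sum>u<b. \<Sum>v<b. fold_kern L y y' u v * swp ?k (u, x, z) (v, x', z'))"
      using e by (simp add: 1 swp_def)
    also have "\<dots> = act1 {..<b} (fold_kern L) ?k (y, x, z) (y', x', z')"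
      unfolding swp_key by (simp add: act1_def)
    also have "\<dots> = swp ?k (x, y, z) (x', y', z')"
      using e by (simp add: act1_fold_key[OF L(3)] swp_def)
    finally show ?thesis unfolding swp_key e .
  qed
  \<comment> \<open>\<open>eq\<close> holds only on the index set. With \<open>P'\<close> in place
    of \<open>P\<close> it becomes an identity of functions, so \<open>T\<close> can be applied to
    both sides.\<close>
  define P' where "P' s s' = \<rho> s s' + N s s' - key_kern L \<tau> s s'" for s s'
  have P': "P' s s' = P s s'" if "s \<in> ?S" "s' \<in> ?S" for s s' using eq[OF that] by (simp add: P'_def)
  have posP': "pos ?S P'" using pos(3) pos_cong[of ?S P' P] P' by blast
  have trP': "tr ?S P' = \<epsilon>" using P' t(3) by (simp add: tr_def)
  note key = CMI_key[OF L(1) J(1) tau'(1) tau'(2)[unfolded tau(2)]]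
  have "CMI {..<L} {..<L} J (key_kern L ?\<tau>') - 2 * \<epsilon> * ln (card {..<L}) - 4 * (1 + \<epsilon>) * ln 2 \<le> CMI {..<L} {..<L} J (T \<rho>)"
  proof (rule CMI_continuity[OF _ _ J(1) _ pT(5)[OF pos(1)] key(1) pT(5)[OF pos(2)] pT(5)[OF posP']])
    have sum: "(\<lambda>s s'. \<rho> s s' + N s s') = (\<lambda>s s'. key_kern L \<tau> s s' + P' s s')" by (simp add: P'_def)
    fix s s' assume s: "s \<in> ?S'" "s' \<in> ?S'"
    have "T \<rho> s s' + T N s s' = T (key_kern L \<tau>) s s' + T P' s s'"
      using fun_cong[OF fun_cong[OF arg_cong[OF sum, of T, unfolded Tadd]]] .
    then show "T \<rho> s s' + T N s s' = key_kern L ?\<tau>' s s' + T P' s s'" using Tkey[OF s] by simp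
  next
    have "tr ?S' (key_kern L ?\<tau>') = tr J ?\<tau>'"
    proof -
      have "(\<Sum>x<L. \<Sum>y<L. \<Sum>z\<in>J. key_kern L ?\<tau>' (x, y, z) (x, y, z)) = (\<Sum>x<L. \<Sum>y<L. if y = x then (\<Sum>z\<in>J. ?\<tau>' z z / of_nat L) else 0)"
        by (intro sum.cong refl) (auto simp: key_kern_def)
      also have "\<dots> = (\<Sum>z\<in>J. ?\<tau>' z z)" using L(1) by (simp flip: sum_divide_distrib)
      finally show ?thesis by (simp add: tr_def sum_Times)
    qed
    then show "tr ?S' (key_kern L ?\<tau>') = 1" using tau' tau by simp
  qed (use L(1) t trP' in \<open>auto simp: tT\<close>)
  also have "\<dots> \<le> c" using cmi[OF pos(1)] J(3) by linarith
  finally show ?thesis by (simp add: key(2))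
qed

section \<open>Trace distance\<close>

lemma tr_ker: "M \<in> carrier_mat n n \<Longrightarrow> tr {..<n} (ker M) = Re (mtrace M)"
  by (simp add: tr_def ker_def mtrace_def)

lemma pos_rank_one: "0 \<le> c \<Longrightarrow> pos I (\<lambda>x y. of_real c * u x * cnj (u y))"
proof -
  assume c: "0 \<le> c"
  have "quad I (\<lambda>x y. of_real c * u x * cnj (u y)) v = of_real (c * (cmod (ip I u v))\<^sup>2)" for v
  proof -
    have "quad I (\<lambda>x y. of_real c * u x * cnj (u y)) v = of_real c * (ip I v u * ip I u v)"
    proof -
      have "quad I (\<lambda>x y. of_real c * u x * cnj (u y)) v = of_real c * (\<Sum>x\<in>I. \<Sum>y\<in>I. (cnj (v x) * u x) * (cnj (u y) * v y))"
        unfolding quad_def sum_distrib_left by (intro sum.cong refl) (simp add: mult_ac)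
      then show ?thesis by (simp only: ip_def sum_product)
    qed
    also have "ip I v u * ip I u v = of_real ((cmod (ip I u v))\<^sup>2)"
      unfolding complex_norm_square ip_cnj by (rule mult.commute)
    finally show ?thesis by simp
  qed
  then show ?thesis using c by (simp add: pos_def of_real_nonneg_complex del: of_real_mult of_real_power)
qed

lemma tr_diagonal:
  fixes d :: "nat \<Rightarrow> real"
  assumes "ortho {..<n} {..<n} u"
  shows "tr {..<n} (\<lambda>x y. \<Sum>k<n. of_real (d k) * u k x * cnj (u k y)) = (\<Sum>k<n. d k)"
proof -
  have "(\<Sum>x<n. \<Sum>k<n. of_real (d k) * u k x * cnj (u k x)) = (\<Sum>k<n. of_real (d k) * ip {..<n} (u k) (u k))"
    by (subst sum.swap) (simp add: ip_def sum_distrib_left mult_ac)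
  also have "\<dots> = of_real (\<Sum>k<n. d k)"
    unfolding of_real_sum using assms by (intro sum.cong refl) (auto simp: orthoD)
  finally show ?thesis by (simp add: tr_def del: of_real_sum)
qed

text \<open>\<open>P\<close> and \<open>N\<close> are the positive and negative parts of \<rho> -
  \<sigma>. Their traces agree because both states have trace 1, and they add up to the trace norm,
  so each is the trace distance.\<close>

lemma trace_dist_decomposition:
  assumes "density n \<rho>" "density n \<sigma>"
  shows "\<exists>N P. pos {..<n} N \<and> pos {..<n} P \<and>
    (\<forall>x<n. \<forall>y<n. ker \<rho> x y + N x y = ker \<sigma> x y + P x y) \<and>
    tr {..<n} N = trace_dist \<rho> \<sigma> \<and> tr {..<n} P = trace_dist \<rho> \<sigma>"
proof -
  have c: "\<rho> \<in> carrier_mat n n" "\<sigma> \<in> carrier_mat n n" using assms by (auto simp: density_def psd_def)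
  have p: "pos {..<n} (ker \<rho>)" "pos {..<n} (ker \<sigma>)" using assms by (auto simp: density_def psd_iff_pos)
  define H where "H x y = ker \<rho> x y - ker \<sigma> x y" for x y
  have herm: "herm {..<n} H"
    using pos_herm[OF finite_lessThan p(1)] pos_herm[OF finite_lessThan p(2)] by (simp add: herm_def H_def)
  obtain d u where u: "ortho {..<n} {..<n} u"
    and dec: "\<And>x y. x < n \<Longrightarrow> y < n \<Longrightarrow> H x y = (\<Sum>k<n. of_real (d k) * u k x * cnj (u k y))"
    by (rule hermitian_diagonalization[OF herm]) blast
  define N where "N = (\<lambda>x y. \<Sum>k<n. of_real (max (- d k) 0) * u k x * cnj (u k y))"
  define P where "P = (\<lambda>x y. \<Sum>k<n. of_real (max (d k) 0) * u k x * cnj (u k y))"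
  have pNP: "pos {..<n} N" "pos {..<n} P"
    unfolding N_def P_def by (intro pos_sum pos_rank_one; simp)+
  have NP: "ker \<rho> x y + N x y = ker \<sigma> x y + P x y" if "x < n" "y < n" for x y
  proof -
    have "P x y - N x y = (\<Sum>k<n. (of_real (max (d k) 0) - of_real (max (- d k) 0)) * u k x * cnj (u k y))"
      by (simp only: P_def N_def sum_subtractf[symmetric] left_diff_distrib)
    also have "\<dots> = H x y"
      unfolding dec[OF that] of_real_diff[symmetric] by (intro sum.cong refl) (auto simp: max_def)
    finally show ?thesis by (simp add: H_def algebra_simps)
  qed
  have tN: "tr {..<n} N = (\<Sum>k<n. max (- d k) 0)" and tP: "tr {..<n} P = (\<Sum>k<n. max (d k) 0)"
    unfolding N_def P_def by (rule tr_diagonal[OF u])+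
  have "tr {..<n} (\<lambda>x y. ker \<rho> x y + N x y) = tr {..<n} (\<lambda>x y. ker \<sigma> x y + P x y)"
    using NP by (simp add: tr_def)
  then have NP_eq: "tr {..<n} N = tr {..<n} P"
    using assms c by (simp add: tr_add tr_ker density_def)
  let ?D = "mat_adjoint (\<rho> - \<sigma>) * (\<rho> - \<sigma>)"
  have adj: "mat_adjoint (\<rho> - \<sigma>) \<in> carrier_mat n n" using c by (auto simp: mat_adjoint_def)
  have adj': "mat_adjoint (\<rho> - \<sigma>) $$ (x, y) = H x y" if "x < n" "y < n" for x y
  proof -
    have "mat_adjoint (\<rho> - \<sigma>) $$ (x, y) = cnj ((\<rho> - \<sigma>) $$ (y, x))"
      using c that by (simp add: mat_adjoint_def mat_of_rows_def)
    also have "\<dots> = cnj (H y x)" using c that by (simp add: H_def ker_def)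
    finally show ?thesis using hermD[OF herm] that by simp
  qed
  have D: "?D \<in> carrier_mat n n" using adj c by auto
  \<comment> \<open>\<open>H\<close> is Hermitian, so the matrix under the square root is the square
    of \<open>H\<close>, with eigenvalues d^2.\<close>
  have "?D $$ (x, y) = (\<Sum>k<n. of_real ((d k)\<^sup>2) * u k x * cnj (u k y))" if xy: "x < n" "y < n" for x y
  proof -
    have "?D $$ (x, y) = (\<Sum>z<n. mat_adjoint (\<rho> - \<sigma>) $$ (x, z) * (\<rho> - \<sigma>) $$ (z, y))"
      using adj c xy by (simp add: scalar_prod_def atLeast0LessThan)
    also have "\<dots> = (\<Sum>z<n. H x z * H z y)"
      using c xy adj' by (intro sum.cong refl) (simp add: H_def[of _ y] ker_def)
    also have "\<dots> = (\<Sum>z<n. \<Sum>k<n. \<Sum>l<n. of_real (d k) * of_real (d l) * (u k x * cnj (u l y)) * (cnj (u k z) * u l z))"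
    proof (rule sum.cong[OF refl])
      fix z assume "z \<in> {..<n}"
      then have z: "z < n" by simp
      show "H x z * H z y = (\<Sum>k<n. \<Sum>l<n. of_real (d k) * of_real (d l) * (u k x * cnj (u l y)) * (cnj (u k z) * u l z))"
        unfolding dec[OF xy(1) z] dec[OF z xy(2)] sum_product by (intro sum.cong refl) (simp add: mult_ac)
    qed
    also have "\<dots> = (\<Sum>k<n. \<Sum>l<n. \<Sum>z<n. of_real (d k) * of_real (d l) * (u k x * cnj (u l y)) * (cnj (u k z) * u l z))"
      by (rule sum_swap12)
    also have "\<dots> = (\<Sum>k<n. \<Sum>l<n. of_real (d k) * of_real (d l) * (u k x * cnj (u l y)) * ip {..<n} (u k) (u l))"
      by (simp add: ip_def sum_distrib_left)
    also have "\<dots> = (\<Sum>k<n. \<Sum>l<n. if l = k then of_real ((d k)\<^sup>2) * u k x * cnj (u k y) else 0)"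
      using u by (intro sum.cong refl) (auto simp: orthoD power2_eq_square)
    finally show ?thesis by simp
  qed
  then have "trace_fun sqrt ?D = (\<Sum>k<n. sqrt ((d k)\<^sup>2))" by (rule trace_fun_diagonal[OF D u])
  also have "\<dots> = (\<Sum>k<n. max (- d k) 0 + max (d k) 0)" by (intro sum.cong) (auto simp: max_def)
  finally have "2 * trace_dist \<rho> \<sigma> = tr {..<n} N + tr {..<n} P"
    by (simp add: trace_dist_def tN tP sum.distrib)
  then have "tr {..<n} N = trace_dist \<rho> \<sigma>" "tr {..<n} P = trace_dist \<rho> \<sigma>" using NP_eq by linarith+
  then show ?thesis using pNP NP by blast
qed

section \<open>The bound on the key rate\<close>

lemma pull_enc:
  assumes "pos {..<a * b * e} \<kappa>"
  shows "pos ({..<a} \<times> {..<b} \<times> {..<e}) (\<lambda>s s'. \<kappa> (enc (a, b, e) s) (enc (a, b, e) s'))"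
    and "tr ({..<a} \<times> {..<b} \<times> {..<e}) (\<lambda>s s'. \<kappa> (enc (a, b, e) s) (enc (a, b, e) s')) = tr {..<a * b * e} \<kappa>"
proof -
  have "enc (a, b, e) ` idx (a, b, e) \<subseteq> {..<a * b * e}" using enc_less by blast
  then show "pos ({..<a} \<times> {..<b} \<times> {..<e}) (\<lambda>s s'. \<kappa> (enc (a, b, e) s) (enc (a, b, e) s'))"
    using pos_pullback[OF assms finite_lessThan, of "enc (a, b, e)" "idx (a, b, e)"] by (simp del: enc.simps)
  show "tr ({..<a} \<times> {..<b} \<times> {..<e}) (\<lambda>s s'. \<kappa> (enc (a, b, e) s) (enc (a, b, e) s')) = tr {..<a * b * e} \<kappa>"
    using sum.reindex_bij_betw[OF bij_enc, of "\<lambda>i. \<kappa> i i" a b e] by (simp add: tr_def del: enc.simps)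
qed

text \<open>Converse of \<open>entry3_pos\<close> through the decoding map; it recognises output
  matrices as positive from their kernels.\<close>

lemma psd_of_entry3:
  assumes "M \<in> carrier_mat (a * b * e) (a * b * e)" "pos ({..<a} \<times> {..<b} \<times> {..<e}) (entry3 (a, b, e) M)"
  shows "psd (a * b * e) M"
proof -
  have "bij_betw (dec (a, b, e)) {..<a * b * e} (idx (a, b, e)) \<and> (\<forall>i<a * b * e. enc (a, b, e) (dec (a, b, e) i) = i)"
  proof -
    have inv: "dec (a, b, e) i = inv_into (idx (a, b, e)) (enc (a, b, e)) i" if "i < a * b * e" for i
    proof -
      have "i \<in> enc (a, b, e) ` idx (a, b, e)" using bij_enc[of a b e] that by (simp add: bij_betw_def del: enc.simps idx.simps)
      then obtain s where s: "s \<in> idx (a, b, e)" "i = enc (a, b, e) s" by blast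
      then have "inv_into (idx (a, b, e)) (enc (a, b, e)) i = s"
        using bij_enc[of a b e] by (simp add: bij_betw_def del: enc.simps idx.simps)
      then show ?thesis using dec_enc[OF s(1)] s(2) by simp
    qed
    have "bij_betw (inv_into (idx (a, b, e)) (enc (a, b, e))) {..<a * b * e} (idx (a, b, e))"
      by (rule bij_betw_inv_into[OF bij_enc])
    then have "bij_betw (dec (a, b, e)) {..<a * b * e} (idx (a, b, e))"
      by (rule bij_betw_cong[THEN iffD1, rotated]) (simp add: inv del: enc.simps idx.simps dec.simps)
    moreover have "enc (a, b, e) (dec (a, b, e) i) = i" if "i < a * b * e" for i
      unfolding inv[OF that] using bij_enc[of a b e] that
      by (intro f_inv_into_f) (simp add: bij_betw_def del: enc.simps idx.simps)
    ultimately show ?thesis by blast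
  qed
  then have bij: "dec (a, b, e) ` {..<a * b * e} \<subseteq> {..<a} \<times> {..<b} \<times> {..<e}"
    and id: "\<And>i. i < a * b * e \<Longrightarrow> enc (a, b, e) (dec (a, b, e) i) = i"
    by (auto simp: bij_betw_def simp del: enc.simps dec.simps)
  have "pos {..<a * b * e} (\<lambda>i j. entry3 (a, b, e) M (dec (a, b, e) i) (dec (a, b, e) j))"
    by (rule pos_pullback[OF assms(2) _ bij]) simp
  moreover have "entry3 (a, b, e) M (dec (a, b, e) i) (dec (a, b, e) j) = ker M i j"
    if "i \<in> {..<a * b * e}" "j \<in> {..<a * b * e}" for i j
    using id that by (simp add: entry3_def ker_def del: enc.simps dec.simps)
  ultimately have "pos {..<a * b * e} (ker M)"
    using pos_cong[of "{..<a * b * e}" "ker M" "\<lambda>i j. entry3 (a, b, e) M (dec (a, b, e) i) (dec (a, b, e) j)"] by metis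
  then show ?thesis using assms(1) by (simp add: psd_iff_pos)
qed

lemma key_state_entry:
  assumes "s \<in> idx (a, b, e)" "s' \<in> idx (a, b, e)"
  shows "entry3 (a, b, e) (key_state (a, b, e) l \<tau>) s s' = key_kern (2 ^ l) (ker \<tau>) s s'"
  unfolding key_state.simps using assms by (subst entry3_mat3) (auto simp: key_kern_def ker_def)

text \<open>The key state vanishes outside the first 2^l values of Alice and Bob, so positivity
  carries over from that block. It is thus a density matrix, and the difference to \<open>M\<close>
  can be split into positive and negative parts.\<close>

lemma key_bound:
  assumes den: "density (a * b * e) M" and tri: "tri_ach (a, b, e) M c"
    and fits: "fits_key (a, b, e) l" and tau: "density e \<tau>"
  defines "\<epsilon> \<equiv> trace_dist M (key_state (a, b, e) l \<tau>)"
  shows "real l * ln 2 * (1 - 2 * \<epsilon>) - 4 * (1 + \<epsilon>) * ln 2 \<le> c"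
proof -
  let ?S = "{..<a} \<times> {..<b} \<times> {..<e}" and ?K = "key_state (a, b, e) l \<tau>" and ?L = "2 ^ l :: nat"
  have ptau: "pos {..<e} (ker \<tau>)" and ttau: "tr {..<e} (ker \<tau>) = 1"
    using tau by (auto simp: density_def psd_iff_pos tr_ker)
  have L: "0 < ?L" "?L \<le> a" "?L \<le> b" using fits by auto
  have K: "?K \<in> carrier_mat (a * b * e) (a * b * e)" using mat3_carrier[of "(a, b, e)"] by simp
  have pe: "pos ?S (entry3 (a, b, e) ?K)" and trK: "tr ?S (key_kern ?L (ker \<tau>)) = 1"
  proof -
    let ?f = "\<lambda>s. s"
    note ck = CMI_key(1)[OF L(1) finite_lessThan ptau ttau]
    have "pos ?S (key_kern ?L (ker \<tau>))"
    proof -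
      obtain N :: "nat set" and p u where sp: "spec ({..<?L} \<times> {..<?L} \<times> {..<e}) (key_kern ?L (ker \<tau>)) N p u"
        using pos_imp_spec[OF _ ck] by blast
      have "spec ?S (key_kern ?L (ker \<tau>)) N p (\<lambda>k x. if x \<in> ?f ` ({..<?L} \<times> {..<?L} \<times> {..<e}) then u k (inv_into ({..<?L} \<times> {..<?L} \<times> {..<e}) ?f x) else 0)"
        using L by (intro spec_transport[OF sp]) (auto simp: key_kern_def split: if_splits)
      then show ?thesis by (rule pos_spec_imp)
    qed
    then show "pos ?S (entry3 (a, b, e) ?K)"
      using pos_cong[of ?S "entry3 (a, b, e) ?K" "key_kern ?L (ker \<tau>)"] key_state_entry[of _ a b e _ l \<tau>] by simp
    have "(\<Sum>x<a. \<Sum>y<b. \<Sum>z<e. key_kern ?L (ker \<tau>) (x, y, z) (x, y, z)) =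
        (\<Sum>x<a. \<Sum>y<b. if y = x then if x < ?L then (\<Sum>z<e. ker \<tau> z z) / of_nat ?L else 0 else 0)"
      by (intro sum.cong refl) (auto simp: key_kern_def sum_divide_distrib)
    also have "\<dots> = (\<Sum>x<a. if x < ?L then (\<Sum>z<e. ker \<tau> z z) / of_nat ?L else 0)"
      using L by (intro sum.cong refl) auto
    also have "\<dots> = (\<Sum>x<?L. (\<Sum>z<e. ker \<tau> z z) / of_nat ?L)"
      using L by (intro sum.mono_neutral_cong_right) auto
    also have "\<dots> = (\<Sum>z<e. ker \<tau> z z)" by simp
    finally show "tr ?S (key_kern ?L (ker \<tau>)) = 1" using ttau by (simp add: tr_def sum_Times)
  qed
  have denK: "density (a * b * e) ?K"
  proof -
    have "mtrace ?K = (\<Sum>i<a * b * e. ?K $$ (i, i))" using K by (simp add: mtrace_def del: key_state.simps)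
    also have "\<dots> = (\<Sum>s\<in>idx (a, b, e). entry3 (a, b, e) ?K s s)"
      using sum.reindex_bij_betw[OF bij_enc, of "\<lambda>i. ?K $$ (i, i)" a b e] by (simp add: entry3_def del: key_state.simps)
    finally have "Re (mtrace ?K) = 1"
      using trK key_state_entry[of _ a b e _ l \<tau>] by (simp add: tr_def del: key_state.simps)
    moreover have psdK: "psd (a * b * e) ?K" by (rule psd_of_entry3[OF K pe])
    \<comment> \<open>\<open>density\<close> asks for the complex trace to be 1, while
      \<open>tr\<close> records only its real part; the diagonal of a Hermitian kernel is
      real.\<close>
    moreover have "Im (mtrace ?K) = 0"
    proof -
      have "herm {..<a * b * e} (ker ?K)" using psdK by (intro pos_herm) (auto simp: psd_iff_pos)
      then have "Im (?K $$ (i, i)) = 0" if "i < a * b * e" for i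
        using hermD[of "{..<a * b * e}" "ker ?K" i i] that by (simp add: ker_def complex_eq_iff del: key_state.simps)
      then show ?thesis using K by (simp add: mtrace_def del: key_state.simps)
    qed
    ultimately show ?thesis by (simp add: density_def complex_eq_iff del: key_state.simps)
  qed
  obtain N P where NP: "pos {..<a * b * e} N" "pos {..<a * b * e} P"
    "\<And>x y. x < a * b * e \<Longrightarrow> y < a * b * e \<Longrightarrow> ker M x y + N x y = ker ?K x y + P x y"
    "tr {..<a * b * e} N = \<epsilon>" "tr {..<a * b * e} P = \<epsilon>"
    using trace_dist_decomposition[OF den denK] unfolding \<epsilon>_def by blast
  let ?pull = "\<lambda>\<kappa> s s'. \<kappa> (enc (a, b, e) s) (enc (a, b, e) s') :: complex"
  have M: "pos {..<a * b * e} (ker M)" "tr {..<a * b * e} (ker M) = 1"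
    using den by (auto simp: density_def psd_iff_pos tr_ker)
  have eM: "entry3 (a, b, e) M = ?pull (ker M)" by (simp add: entry3_def[abs_def] ker_def)
  have "ln (real ?L) - 2 * \<epsilon> * ln (real ?L) - 4 * (1 + \<epsilon>) * ln 2 \<le> c"
  proof (rule near_key_bound[OF L finite_lessThan])
    show "pos ?S (entry3 (a, b, e) M)" "ach {..<a} {..<b} {..<e} (entry3 (a, b, e) M) c"
      using tri by (auto simp: tri_ach_def)
    show "pos ?S (?pull N)" "pos ?S (?pull P)" "tr ?S (?pull N) = \<epsilon>" "tr ?S (?pull P) = \<epsilon>"
      using pull_enc[OF NP(1)] pull_enc[OF NP(2)] NP(4,5) by auto
    show "tr ?S (entry3 (a, b, e) M) = 1" unfolding eM using pull_enc(2)[OF M(1)] M(2) by simp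
    show "pos {..<e} (ker \<tau>)" "tr {..<e} (ker \<tau>) = 1" by fact+
    fix s s' assume s: "s \<in> ?S" "s' \<in> ?S"
    then have "ker M (enc (a, b, e) s) (enc (a, b, e) s') + N (enc (a, b, e) s) (enc (a, b, e) s') =
        ker ?K (enc (a, b, e) s) (enc (a, b, e) s') + P (enc (a, b, e) s) (enc (a, b, e) s')"
      by (intro NP(3) enc_less) auto
    moreover have "ker ?K (enc (a, b, e) s) (enc (a, b, e) s') = key_kern ?L (ker \<tau>) s s'"
      using key_state_entry[of s a b e s' l \<tau>] s by (simp add: entry3_def ker_def del: key_state.simps enc.simps)
    ultimately show "entry3 (a, b, e) M s s' + ?pull N s s' = key_kern ?L (ker \<tau>) s s' + ?pull P s s'"
      by (simp add: eM del: key_state.simps enc.simps)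
  qed
  moreover have "ln (real ?L) = real l * ln 2" by (simp add: ln_realpow)
  ultimately show ?thesis by (simp add: algebra_simps)
qed

lemma protocol_bound:
  assumes den: "density (dA * dB * dE) \<rho>" and prot: "lopc_protocol (dA, dB, dE) D \<Lambda>"
    and dist: "distills (dA, dB, dE) \<rho> D \<Lambda> R" and ch: "cptp dE e' \<Phi>"
  shows "R \<le> ereal (cond_mutual_info (dA, dB, e') (extend (dA * dB) 1 dE e' \<Phi> \<rho>))"
proof -
  let ?\<rho> = "entry3 (dA, dB, dE) \<rho>"
  define I where "I = cond_mutual_info (dA, dB, e') (extend (dA * dB) 1 dE e' \<Phi> \<rho>)"
  have psd: "psd (dA * dB * dE) \<rho>" using den by (simp add: density_def)
  have p: "pos ({..<dA} \<times> {..<dB} \<times> {..<dE}) ?\<rho>" by (rule entry3_pos[OF psd])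
  obtain W where W: "chan {..<dE} {..<e'} W"
    "\<And>A y y'. A \<in> carrier_mat dE dE \<Longrightarrow> y < e' \<Longrightarrow> y' < e' \<Longrightarrow> \<Phi> A $$ (y, y') = (\<Sum>u<dE. \<Sum>v<dE. W y y' u v * A $$ (u, v))"
    by (rule cptp_chan[OF ch]) (rule that)
  let ?X = "extend (dA * dB) 1 dE e' \<Phi> \<rho>"
  have pW: "pos ({..<dA} \<times> {..<dB} \<times> {..<e'}) (actE {..<dE} W ?\<rho>)" by (rule pos_actE[OF _ _ _ _ p W(1)]) auto
  have kX: "entry3 (dA, dB, e') ?X s s' = actE {..<dE} W ?\<rho> s s'"
    if "s \<in> {..<dA} \<times> {..<dB} \<times> {..<e'}" "s' \<in> {..<dA} \<times> {..<dB} \<times> {..<e'}" for s s'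
    using that by (intro extend_E_kernel[OF W(2)]) auto
  have psdX: "psd (dA * dB * e') ?X"
    using ch psd unfolding cptp_def by blast
  have CMI: "CMI {..<dA} {..<dB} {..<e'} (actE {..<dE} W ?\<rho>) = I * ln 2"
  proof -
    have "CMI {..<dA} {..<dB} {..<e'} (entry3 (dA, dB, e') ?X) = CMI {..<dA} {..<dB} {..<e'} (actE {..<dE} W ?\<rho>)"
      by (rule CMI_cong) (rule kX)
    then show ?thesis unfolding I_def cond_mutual_info_eq_CMI[OF psdX] by simp
  qed
  then have I0: "0 \<le> I * ln 2" using CMI_nonneg[OF _ _ _ pW] by simp
  have ach: "ach {..<dA} {..<dB} {..<dE} ?\<rho> (I * ln 2)"
    by (rule achI[OF _ _ _ _ p W(1)]) (simp_all add: CMI)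
  obtain l \<tau> where fits: "\<And>n. fits_key (D n) (l n)" and eve: "\<And>n. eve_state (D n) (\<tau> n)"
    and R: "limsup (\<lambda>n. ereal (real (l n) / real n)) = R"
    and lim: "(\<lambda>n. trace_dist (\<Lambda> n (tensor_power (dA, dB, dE) n \<rho>)) (key_state (D n) (l n) (\<tau> n))) \<longlonglongrightarrow> 0"
    using dist unfolding distills_def by blast
  define \<epsilon> where "\<epsilon> n = trace_dist (\<Lambda> n (tensor_power (dA, dB, dE) n \<rho>)) (key_state (D n) (l n) (\<tau> n))" for n
  have bound: "real (l n) * (1 - 2 * \<epsilon> n) - 4 * (1 + \<epsilon> n) \<le> real n * I" for n
  proof -
    obtain a b e where D: "D n = (a, b, e)" by (cases "D n")
    let ?T = "tensor_power (dA, dB, dE) n \<rho>"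
    have cp: "cptp (dA ^ n * dB ^ n * dE ^ n) (a * b * e) (\<Lambda> n)" and lo: "lopc (dA ^ n, dB ^ n, dE ^ n) (a, b, e) (\<Lambda> n)"
      using prot D unfolding lopc_protocol_def by (metis dim3.simps dims_power.simps)+
    note tp = tensor_power_tri_ach[OF den ach I0, of n]
    have T: "?T \<in> carrier_mat (dA ^ n * dB ^ n * dE ^ n) (dA ^ n * dB ^ n * dE ^ n)"
      using mat3_carrier[of "(dA ^ n, dB ^ n, dE ^ n)"] by simp
    have tri: "tri_ach (a, b, e) (\<Lambda> n ?T) (real n * (I * ln 2))" by (rule lopc_tri_ach[OF lo]) (use tp in blast)
    have mT: "Re (mtrace ?T) = 1"
    proof -
      have "mtrace ?T = (\<Sum>i<dA ^ n * dB ^ n * dE ^ n. ?T $$ (i, i))" using T by (simp add: mtrace_def del: tensor_power.simps)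
      also have "\<dots> = (\<Sum>s\<in>idx (dA ^ n, dB ^ n, dE ^ n). entry3 (dA ^ n, dB ^ n, dE ^ n) ?T s s)"
        using sum.reindex_bij_betw[OF bij_enc, of "\<lambda>i. ?T $$ (i, i)" "dA ^ n" "dB ^ n" "dE ^ n"] by (simp add: entry3_def del: tensor_power.simps)
      finally show ?thesis using tp by (simp add: tr_def del: tensor_power.simps)
    qed
    have pT: "psd (dA ^ n * dB ^ n * dE ^ n) ?T" using tp by (intro psd_of_entry3 T) (simp add: tri_ach_def del: tensor_power.simps)
    have M: "\<Lambda> n ?T \<in> carrier_mat (a * b * e) (a * b * e)" using cp T unfolding cptp_def by blast
    have pM: "psd (a * b * e) (\<Lambda> n ?T)" using tri by (intro psd_of_entry3 M) (simp add: tri_ach_def del: tensor_power.simps)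
    have "mtrace ?T = 1"
    proof -
      have "herm {..<dA ^ n * dB ^ n * dE ^ n} (ker ?T)" using pT by (intro pos_herm) (auto simp: psd_iff_pos)
      then have "Im (?T $$ (i, i)) = 0" if "i < dA ^ n * dB ^ n * dE ^ n" for i
        using hermD[of "{..<dA ^ n * dB ^ n * dE ^ n}" "ker ?T" i i] that by (simp add: ker_def complex_eq_iff del: tensor_power.simps)
      then show ?thesis using mT T by (simp add: complex_eq_iff mtrace_def del: tensor_power.simps)
    qed
    \<comment> \<open>Positivity of the output comes from \<open>tri_ach\<close>; its trace is 1
      because \<open>lopc_protocol\<close> makes \<open>\<Lambda> n\<close> trace
      preserving.\<close>
    then have "mtrace (\<Lambda> n ?T) = 1" using cp T unfolding cptp_def by metis
    then have denM: "density (a * b * e) (\<Lambda> n ?T)" using pM by (simp add: density_def)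
    have "real (l n) * ln 2 * (1 - 2 * \<epsilon> n) - 4 * (1 + \<epsilon> n) * ln 2 \<le> real n * (I * ln 2)"
      using key_bound[OF denM tri, of "l n" "\<tau> n"] fits[of n] eve[of n] by (simp add: D \<epsilon>_def del: tensor_power.simps key_state.simps)
    then have "(real (l n) * (1 - 2 * \<epsilon> n) - 4 * (1 + \<epsilon> n)) * ln 2 \<le> (real n * I) * ln 2"
      by (simp add: algebra_simps)
    then show ?thesis by (simp add: mult_le_cancel_right)
  qed
  \<comment> \<open>The bound solved for l n / n. This is legitimate once \<epsilon> n < 1/2 and n >
    0, so the comparison holds only eventually, which the limsup permits.\<close>
  define g where "g n = (I + 4 * (1 + \<epsilon> n) / real n) / (1 - 2 * \<epsilon> n)" for n
  have e0: "\<epsilon> \<longlonglongrightarrow> 0" using lim by (simp add: \<epsilon>_def[abs_def])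
  have "g \<longlonglongrightarrow> (I + 0) / (1 - 2 * 0)"
  proof -
    have "(\<lambda>n. 4 * (1 + \<epsilon> n) * (1 / real n)) \<longlonglongrightarrow> 4 * (1 + 0) * 0"
      by (intro tendsto_intros e0 lim_1_over_n)
    then have "(\<lambda>n. 4 * (1 + \<epsilon> n) / real n) \<longlonglongrightarrow> 0" by simp
    then show ?thesis unfolding g_def by (intro tendsto_intros e0) auto
  qed
  then have g: "(\<lambda>n. ereal (g n)) \<longlonglongrightarrow> ereal I" by simp
  have half: "\<forall>\<^sub>F n in sequentially. \<epsilon> n < 1 / 2"
    by (rule order_tendstoD(2)[OF e0]) simp
  have "\<forall>\<^sub>F n in sequentially. ereal (real (l n) / real n) \<le> ereal (g n)"
    using half eventually_gt_at_top[of 0]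
  proof eventually_elim
    case (elim n)
    have "real (l n) * (1 - 2 * \<epsilon> n) \<le> real n * (I + 4 * (1 + \<epsilon> n) / real n)"
    proof -
      have "real n * (I + 4 * (1 + \<epsilon> n) / real n) = real n * I + 4 * (1 + \<epsilon> n)"
        using elim by (simp add: field_simps)
      then show ?thesis using bound[of n] by linarith
    qed
    then have "real (l n) / real n * (1 - 2 * \<epsilon> n) \<le> I + 4 * (1 + \<epsilon> n) / real n"
      using elim by (simp add: pos_divide_le_eq mult.commute)
    then show ?case using elim by (simp add: g_def pos_le_divide_eq)
  qed
  then have "limsup (\<lambda>n. ereal (real (l n) / real n)) \<le> limsup (\<lambda>n. ereal (g n))"
    by (rule Limsup_mono)
  also have "\<dots> = ereal I" by (rule lim_imp_Limsup[OF sequentially_bot g])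
  finally show ?thesis by (simp only: R I_def)
qed

text \<open>\<open>protocol_bound\<close> treats one protocol and one channel at a time, so the
  supremum and the infimum can be taken independently.\<close>

theorem theorem3p5:
  fixes dA dB dE :: nat and \<rho> :: "complex mat"
  assumes "density (dA * dB * dE) \<rho>"
  shows "key_rate (dA, dB, dE) \<rho> \<le> intrinsic_info (dA, dB, dE) \<rho>"
  unfolding key_rate_def intrinsic_info.simps
  using protocol_bound[OF assms] by (intro Sup_least INF_greatest) auto

end
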